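(* Let $y_0\in\mathbb{R}^d$ be non-random, and let $b:[0,\infty)\times\mathbb{R}^d\to\mathbb{R}^d$ and $\sigma:[0,\infty)\times\mathbb{R}^d\to\mathbb{R}^{d\times m}$ be measurable functions for which there are constants $K>0$ and $\gamma>0$ such that for all $x,y\in\mathbb{R}^d$ and $s,t\ge 0$, \begin{align*} &|b(t,x)-b(t,y)|+|\sigma(t,x)-\sigma(t,y)|\le K|x-y|,\\ &|b(t,x)|+|\sigma(t,x)|\le K(1+|x|),\\ &|b(s,x)-b(t,x)|+|\sigma(s,x)-\sigma(t,x)|\le K(1+|x|)|s-t|^{\gamma}. \end{align*} Let $X$ be the unique strong solution on $[0,\infty)$ of $$X(t)=y_0+\int_0^t b(r,X(r))\,dr+\int_0^t\sigma(r,X(r))\,dB(r),$$ and, for $\delta\in(0,1)$, let $X_\delta$ be the continuously interpolated Euler--Maruyama process on $[0,\infty)$ with step size $\delta$ (defined in the context). Then there exists a constant $C>0$, not depending on $\delta\in(0,1)$ or $t$, such that $$\mathbb{E}\Bigl[\sup_{0\le s\le t}|X(s)-X_\delta(s)|^2\Bigr]\le Ce^{Ct}\,\delta^{\min(2\gamma,1)}\quad\text{for all } t\ge 0.$$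
   Context: $(\Omega,\mathcal{F},\mathbb{P})$ is a complete probability space with a filtration $(\mathcal{F}_t)_{t\ge0}$ satisfying the usual conditions, and $B$ is an $m$-dimensional $(\mathcal{F}_t)$-adapted Brownian motion (a Brownian motion with respect to $(\mathcal{F}_t)$) starting at $0$. $|\cdot|$ denotes the Euclidean norm of the appropriate dimension (for matrices too). Euler--Maruyama process: for $\delta\in(0,1)$ put $\tau_n:=n\delta$, $n=0,1,2,\ldots$. Set $X_\delta(0):=y_0$ and, for $n=0,1,2,\ldots$ and $t\in[\tau_n,\tau_{n+1}]$, $$X_\delta(t):=X_\delta(\tau_n)+b(\tau_n,X_\delta(\tau_n))(t-\tau_n)+\sigma(\tau_n,X_\delta(\tau_n))(B(t)-B(\tau_n)).$$ In particular, taking $t=\tau_{n+1}$ defines $X_\delta(\tau_{n+1})$ recursively. *)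

theory Defs
  imports "HOL-Probability.Probability"
begin

section \<open>Filtrations and Brownian motion on the half-line\<close>

text \<open>Time is a real number, and a condition on a time-indexed family is imposed only at times
  \<open>t \<ge> 0\<close>; values at negative times are irrelevant. For this reason the library notions
  \<open>filtration\<close> and \<open>stopping_time\<close>, which quantify over the whole index type, are restated here
  for the half-line.\<close>

definition usual_filtration :: "'a measure \<Rightarrow> (real \<Rightarrow> 'a measure) \<Rightarrow> bool" where
  "usual_filtration M F \<longleftrightarrow>
     (\<forall>t\<ge>0. subalgebra M (F t)) \<and>
     (\<forall>s t. 0 \<le> s \<and> s \<le> t \<longrightarrow> sets (F s) \<subseteq> sets (F t)) \<and>
     (\<forall>t\<ge>0. sets (F t) = (\<Inter>u\<in>{t<..}. sets (F u))) \<and>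
     null_sets M \<subseteq> sets (F 0)"

definition adapted_process ::
    "(real \<Rightarrow> 'a measure) \<Rightarrow> (real \<Rightarrow> 'a \<Rightarrow> 'b::topological_space) \<Rightarrow> bool" where
  "adapted_process F X \<longleftrightarrow> (\<forall>t\<ge>0. X t \<in> borel_measurable (F t))"

definition continuous_process ::
    "'a measure \<Rightarrow> (real \<Rightarrow> 'a \<Rightarrow> 'b::topological_space) \<Rightarrow> bool" where
  "continuous_process M X \<longleftrightarrow> (AE \<omega> in M. continuous_on {0..} (\<lambda>t. X t \<omega>))"

definition progressive_process ::
    "(real \<Rightarrow> 'a measure) \<Rightarrow> (real \<Rightarrow> 'a \<Rightarrow> 'b::topological_space) \<Rightarrow> bool" where
  "progressive_process F X \<longleftrightarrow>
     (\<forall>t\<ge>0. (\<lambda>(s, \<omega>). X s \<omega>) \<in> borel_measurable (restrict_space borel {0..t} \<Otimes>\<^sub>M F t))"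

definition nonneg_stopping_time ::
    "'a measure \<Rightarrow> (real \<Rightarrow> 'a measure) \<Rightarrow> ('a \<Rightarrow> real) \<Rightarrow> bool" where
  "nonneg_stopping_time M F \<tau> \<longleftrightarrow>
     (\<forall>\<omega>\<in>space M. 0 \<le> \<tau> \<omega>) \<and> (\<forall>t\<ge>0. Measurable.pred (F t) (\<lambda>\<omega>. \<tau> \<omega> \<le> t))"

definition brownian_motion ::
    "'a measure \<Rightarrow> (real \<Rightarrow> 'a measure) \<Rightarrow> (real \<Rightarrow> 'a \<Rightarrow> real ^ 'm) \<Rightarrow> bool" where
  "brownian_motion M F B \<longleftrightarrow>
     adapted_process F B \<and>
     continuous_process M B \<and>
     (AE \<omega> in M. B 0 \<omega> = 0) \<and>
     (\<forall>s t. 0 \<le> s \<and> s < t \<longrightarrow>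
        prob_space.indep_set M (sets (F s))
          (sets (vimage_algebra (space M) (\<lambda>\<omega>. B t \<omega> - B s \<omega>) borel)) \<and>
        prob_space.indep_vars M (\<lambda>_. borel) (\<lambda>i \<omega>. (B t \<omega> - B s \<omega>) $ i) UNIV \<and>
        (\<forall>i. distributed M lborel (\<lambda>\<omega>. (B t \<omega> - B s \<omega>) $ i)
               (normal_density 0 (sqrt (t - s)))))"

section \<open>The Ito integral\<close>

text \<open>A simple integrand is given by a number \<open>N\<close> of intervals, partition points
  \<open>p 0 \<le> \<dots> \<le> p N\<close> and coefficients \<open>\<xi> 0, \<dots>, \<xi> (N - 1)\<close>; it takes the value \<open>\<xi> k\<close>
  on the interval from \<open>p k\<close> (excluded) to \<open>p (Suc k)\<close> (included).\<close>

definition simple_integrand ::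
    "'a measure \<Rightarrow> (real \<Rightarrow> 'a measure) \<Rightarrow> nat \<Rightarrow> (nat \<Rightarrow> real) \<Rightarrow>
     (nat \<Rightarrow> 'a \<Rightarrow> real ^ 'm ^ 'd) \<Rightarrow> bool" where
  "simple_integrand M F N p \<xi> \<longleftrightarrow>
     0 \<le> p 0 \<and>
     (\<forall>k<N. p k \<le> p (Suc k) \<and> \<xi> k \<in> borel_measurable (F (p k)) \<and> bounded (\<xi> k ` space M))"

definition simple_process ::
    "nat \<Rightarrow> (nat \<Rightarrow> real) \<Rightarrow> (nat \<Rightarrow> 'a \<Rightarrow> real ^ 'm ^ 'd) \<Rightarrow> real \<Rightarrow> 'a \<Rightarrow> real ^ 'm ^ 'd" where
  "simple_process N p \<xi> t \<omega> = (\<Sum>k<N. indicat_real {p k<..p (Suc k)} t *\<^sub>R \<xi> k \<omega>)"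

definition simple_ito_integral ::
    "(real \<Rightarrow> 'a \<Rightarrow> real ^ 'm) \<Rightarrow> nat \<Rightarrow> (nat \<Rightarrow> real) \<Rightarrow> (nat \<Rightarrow> 'a \<Rightarrow> real ^ 'm ^ 'd) \<Rightarrow>
     real \<Rightarrow> 'a \<Rightarrow> real ^ 'd" where
  "simple_ito_integral B N p \<xi> t \<omega> =
     (\<Sum>k<N. \<xi> k \<omega> *v (B (min t (p (Suc k))) \<omega> - B (min t (p k)) \<omega>))"

text \<open>The integral process \<open>I\<close> is determined by \<open>H\<close> and \<open>B\<close> only up to a null set, so the Ito
  integral is a relation: \<open>ito_integral M F B H I\<close> means that \<open>I\<close> is a continuous version of the
  integral of \<open>H\<close> with respect to \<open>B\<close>, as a process on the half-line. First the case where \<open>H\<close> is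
  square integrable on \<open>\<Omega> \<times> [0, T]\<close> for every \<open>T\<close>. The norm of a matrix is the Euclidean
  (Frobenius) norm.\<close>

definition ito_integral_L2 ::
    "'a measure \<Rightarrow> (real \<Rightarrow> 'a measure) \<Rightarrow> (real \<Rightarrow> 'a \<Rightarrow> real ^ 'm) \<Rightarrow>
     (real \<Rightarrow> 'a \<Rightarrow> real ^ 'm ^ 'd) \<Rightarrow> (real \<Rightarrow> 'a \<Rightarrow> real ^ 'd) \<Rightarrow> bool" where
  "ito_integral_L2 M F B H I \<longleftrightarrow>
     progressive_process F H \<and>
     (\<forall>T\<ge>0. (\<integral>\<^sup>+\<omega>. (\<integral>\<^sup>+r\<in>{0..T}. ennreal ((norm (H r \<omega>))\<^sup>2) \<partial>lborel) \<partial>M) < \<infinity>) \<and>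
     adapted_process F I \<and>
     continuous_process M I \<and>
     (\<exists>N p \<xi>.
        (\<forall>n. simple_integrand M F (N n) (p n) (\<xi> n)) \<and>
        (\<forall>T\<ge>0. (\<lambda>n. \<integral>\<^sup>+\<omega>. (\<integral>\<^sup>+r\<in>{0..T}.
                   ennreal ((norm (simple_process (N n) (p n) (\<xi> n) r \<omega> - H r \<omega>))\<^sup>2)
                 \<partial>lborel) \<partial>M) \<longlonglongrightarrow> 0) \<and>
        (\<forall>t\<ge>0. (\<lambda>n. \<integral>\<^sup>+\<omega>.
                   ennreal ((norm (simple_ito_integral B (N n) (p n) (\<xi> n) t \<omega> - I t \<omega>))\<^sup>2)
                 \<partial>M) \<longlonglongrightarrow> 0))"

text \<open>The general case, by localization. A localizing sequence may be taken real-valued, since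
  \<open>\<tau> n\<close> can be replaced by \<open>min (\<tau> n) n\<close>.\<close>

definition ito_integral ::
    "'a measure \<Rightarrow> (real \<Rightarrow> 'a measure) \<Rightarrow> (real \<Rightarrow> 'a \<Rightarrow> real ^ 'm) \<Rightarrow>
     (real \<Rightarrow> 'a \<Rightarrow> real ^ 'm ^ 'd) \<Rightarrow> (real \<Rightarrow> 'a \<Rightarrow> real ^ 'd) \<Rightarrow> bool" where
  "ito_integral M F B H I \<longleftrightarrow>
     progressive_process F H \<and>
     adapted_process F I \<and>
     continuous_process M I \<and>
     (\<exists>\<tau> :: nat \<Rightarrow> 'a \<Rightarrow> real.
        (\<forall>n. nonneg_stopping_time M F (\<tau> n)) \<and>
        (AE \<omega> in M. incseq (\<lambda>n. \<tau> n \<omega>) \<and> filterlim (\<lambda>n. \<tau> n \<omega>) at_top sequentially) \<and>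
        (\<forall>n. ito_integral_L2 M F B
               (\<lambda>r \<omega>. indicat_real {0..\<tau> n \<omega>} r *\<^sub>R H r \<omega>)
               (\<lambda>t \<omega>. I (min t (\<tau> n \<omega>)) \<omega>)))"

section \<open>Stochastic differential equations and the Euler--Maruyama process\<close>

text \<open>\<open>X\<close> solves \<open>X(t) = y0 + \<integral>\<^sub>0\<^sup>t b(r, X(r)) dr + \<integral>\<^sub>0\<^sup>t \<sigma>(r, X(r)) dB(r)\<close> for the given
  Brownian motion \<open>B\<close> and filtration \<open>F\<close>.\<close>

definition strong_solution ::
    "'a measure \<Rightarrow> (real \<Rightarrow> 'a measure) \<Rightarrow> (real \<Rightarrow> 'a \<Rightarrow> real ^ 'm) \<Rightarrow>
     (real \<Rightarrow> real ^ 'd \<Rightarrow> real ^ 'd) \<Rightarrow> (real \<Rightarrow> real ^ 'd \<Rightarrow> real ^ 'm ^ 'd) \<Rightarrow>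
     real ^ 'd \<Rightarrow> (real \<Rightarrow> 'a \<Rightarrow> real ^ 'd) \<Rightarrow> bool" where
  "strong_solution M F B b \<sigma> y0 X \<longleftrightarrow>
     adapted_process F X \<and>
     continuous_process M X \<and>
     (AE \<omega> in M. \<forall>t\<ge>0. set_integrable lborel {0..t} (\<lambda>r. b r (X r \<omega>))) \<and>
     (\<exists>I. ito_integral M F B (\<lambda>r \<omega>. \<sigma> r (X r \<omega>)) I \<and>
          (AE \<omega> in M. \<forall>t\<ge>0.
             X t \<omega> = y0 + (LINT r:{0..t}|lborel. b r (X r \<omega>)) + I t \<omega>))"

text \<open>The Euler--Maruyama process is defined through its values at the grid points \<open>n \<delta>\<close>.\<close>

primrec em_grid ::
    "(real \<Rightarrow> 'a \<Rightarrow> real ^ 'm) \<Rightarrow> (real \<Rightarrow> real ^ 'd \<Rightarrow> real ^ 'd) \<Rightarrow>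
     (real \<Rightarrow> real ^ 'd \<Rightarrow> real ^ 'm ^ 'd) \<Rightarrow> real ^ 'd \<Rightarrow> real \<Rightarrow> nat \<Rightarrow> 'a \<Rightarrow> real ^ 'd" where
  "em_grid B b \<sigma> y0 \<delta> 0 \<omega> = y0"
| "em_grid B b \<sigma> y0 \<delta> (Suc n) \<omega> =
     em_grid B b \<sigma> y0 \<delta> n \<omega>
     + (real (Suc n) * \<delta> - real n * \<delta>) *\<^sub>R b (real n * \<delta>) (em_grid B b \<sigma> y0 \<delta> n \<omega>)
     + \<sigma> (real n * \<delta>) (em_grid B b \<sigma> y0 \<delta> n \<omega>)
         *v (B (real (Suc n) * \<delta>) \<omega> - B (real n * \<delta>) \<omega>)"

definition euler_maruyama ::
    "(real \<Rightarrow> 'a \<Rightarrow> real ^ 'm) \<Rightarrow> (real \<Rightarrow> real ^ 'd \<Rightarrow> real ^ 'd) \<Rightarrow>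
     (real \<Rightarrow> real ^ 'd \<Rightarrow> real ^ 'm ^ 'd) \<Rightarrow> real ^ 'd \<Rightarrow> real \<Rightarrow> real \<Rightarrow> 'a \<Rightarrow> real ^ 'd" where
  "euler_maruyama B b \<sigma> y0 \<delta> t \<omega> =
     (let n = nat \<lfloor>t / \<delta>\<rfloor>; x = em_grid B b \<sigma> y0 \<delta> n \<omega>
      in x + (t - real n * \<delta>) *\<^sub>R b (real n * \<delta>) x
           + \<sigma> (real n * \<delta>) x *v (B t \<omega> - B (real n * \<delta>) \<omega>))"

lemma euler_maruyama_grid:
  assumes "0 < \<delta>"
  shows "euler_maruyama B b \<sigma> y0 \<delta> (real n * \<delta>) \<omega> = em_grid B b \<sigma> y0 \<delta> n \<omega>"
  using assms by (simp add: euler_maruyama_def)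

lemma euler_maruyama_0:
  assumes "0 < \<delta>"
  shows "euler_maruyama B b \<sigma> y0 \<delta> 0 \<omega> = y0"
  using euler_maruyama_grid[OF assms, of B b \<sigma> y0 0] by simp

text \<open>The interpolation formula holds on closed intervals between grid points.\<close>

lemma euler_maruyama_step:
  fixes B :: "real \<Rightarrow> 'a \<Rightarrow> real ^ 'm" and y0 :: "real ^ 'd"
    and b :: "real \<Rightarrow> real ^ 'd \<Rightarrow> real ^ 'd" and \<sigma> :: "real \<Rightarrow> real ^ 'd \<Rightarrow> real ^ 'm ^ 'd"
    and n :: nat
  assumes "0 < \<delta>" and "t \<in> {real n * \<delta>..real (Suc n) * \<delta>}"
  defines "X \<equiv> euler_maruyama B b \<sigma> y0 \<delta>" and "u \<equiv> real n * \<delta>"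
  shows "X t \<omega> = X u \<omega> + (t - u) *\<^sub>R b u (X u \<omega>) + \<sigma> u (X u \<omega>) *v (B t \<omega> - B u \<omega>)"
proof (cases "t = real (Suc n) * \<delta>")
  case True
  show ?thesis
    unfolding X_def u_def True euler_maruyama_grid[OF assms(1)] by simp
next
  case False
  then have "real n \<le> t / \<delta>" "t / \<delta> < real n + 1"
    using assms(1,2) by (auto simp: field_simps)
  then have "nat \<lfloor>t / \<delta>\<rfloor> = n"
    by linarith
  then show ?thesis
    unfolding X_def u_def euler_maruyama_grid[OF assms(1)]
    by (simp add: euler_maruyama_def Let_def)
qed

end

theory Submission
  imports Defs
begin

text \<open>Write \<open>e(s) = X(s) - X\<^sub>\<delta>(s)\<close> and let \<open>\<eta>(r)\<close> be the grid point before \<open>r\<close>. On the half-line,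
  \<open>X\<^sub>\<delta>\<close> is the solution of the same equation with coefficients frozen at
  \<open>(\<eta>(r), X\<^sub>\<delta>(\<eta>(r)))\<close>, so \<open>e\<close> is a drift integral plus a stochastic integral of differences of
  coefficients. The hypotheses bound these differences by
  \<open>K ((1 + |X(r)|) \<delta>\<^sup>\<gamma> + |X(r) - X(\<eta>(r))| + |e(\<eta>(r))|)\<close>. The first two summands have second moment
  of order \<open>\<delta>\<close> to the power \<open>min (2\<gamma>) 1\<close>, because \<open>E|X(r)|\<^sup>2\<close> grows at most exponentially
  (\<open>second_moment_growth\<close>) and \<open>E|X(t) - X(s)|\<^sup>2\<close> is of order \<open>t - s\<close>
  (\<open>increment_second_moment\<close>). Gronwall's inequality for \<open>E|e(\<eta>(t))|\<^sup>2\<close> controls the third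
  (\<open>strong_error\<close>).

  The bound \<open>C exp(C t)\<close> for all \<open>t\<close> at once needs care with the drift: the Cauchy--Schwarz
  inequality on \<open>[0, t]\<close> costs a factor \<open>t\<close>, and Gronwall's inequality would turn it into
  \<open>exp(C t\<^sup>2)\<close>. With the weight \<open>exp(t - r)\<close> inside the integral this factor disappears
  (\<open>nn_integral_square_le_exp\<close>), and Gronwall's inequality in the matching weighted form
  (\<open>gronwall_exp\<close>) yields an exponential with a linear exponent.

  The stochastic part rests on one estimate (\<open>ito_sup\<close>): if \<open>I\<close> is an Ito integral of \<open>H\<close> and \<open>J\<close> the
  integral of an elementary integrand \<open>G\<close>, then the supremum of \<open>|(I - J)(u) - (I - J)(s)|\<^sup>2\<close> over
  \<open>u \<in> [s, T]\<close> has expectation at most \<open>16\<close> times \<open>E \<integral> |H - G|\<^sup>2\<close> over \<open>(s, T]\<close>. It suffices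
  for the theorem since the noise of \<open>X\<^sub>\<delta>\<close> is such a \<open>J\<close>. For elementary integrands it is
  the Ito isometry (\<open>elem_integral_isometry\<close>) combined with Doob's inequality on finite time grids
  (\<open>elem_integral_doob\<close>); it passes to square integrable integrands by approximation
  (\<open>ito_L2_grid\<close>), to the general ones by Fatou's lemma along a localizing sequence (\<open>ito_grid\<close>), and
  from grids to intervals by continuity of paths (\<open>grid_sup_dominated\<close>).

  Numerical constants are not optimized: sums of squares are split with weights such as \<open>2, 4, 4\<close>. The
  moment estimates compare nonnegative integrals with values in \<open>[0, \<infinity>]\<close>, so that finiteness is an
  issue only where Gronwall's inequality requires it.\<close>

section \<open>Weighted Cauchy--Schwarz and Gronwall inequalities\<close>

abbreviation sqn :: "'a::real_normed_vector \<Rightarrow> ennreal" where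
  "sqn x \<equiv> ennreal ((norm x)\<^sup>2)"

abbreviation exp_conv :: "(real \<Rightarrow> ennreal) \<Rightarrow> real \<Rightarrow> ennreal" where
  "exp_conv h t \<equiv> \<integral>\<^sup>+r\<in>{0<..t}. ennreal (exp (t - r)) * h r \<partial>lborel"

lemma ennreal_sum_squares_bound: "2 * (u * v) \<le> u\<^sup>2 + (v::ennreal)\<^sup>2"
proof (cases "u = \<top> \<or> v = \<top>")
  case True
  then have "u\<^sup>2 + v\<^sup>2 = \<top>" by (auto simp: power2_eq_square ennreal_mult_eq_top_iff)
  then show ?thesis by (metis top_greatest)
next
  case False
  then show ?thesis
  proof (cases u; cases v)
    fix a b :: real assume "0 \<le> a" "u = ennreal a" "0 \<le> b" "v = ennreal b"
    moreover have "2 * (a * b) \<le> a\<^sup>2 + b\<^sup>2"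
      using sum_squares_bound[of a b] by simp
    ultimately show ?thesis
      by (simp add: ennreal_mult[symmetric] ennreal_power ennreal_plus[symmetric]
            ennreal_numeral[symmetric] del: ennreal_plus ennreal_numeral)
  qed auto
qed

text \<open>Integrate \<open>2 (f x g y) (g x f y) \<le> (f x g y)\<^sup>2 + (g x f y)\<^sup>2\<close> over \<open>x\<close> and \<open>y\<close>. This works for
  extended values, without normalizing \<open>f\<close> or \<open>g\<close> and hence without case distinctions on
  zero or infinite integrals.\<close>

lemma nn_integral_Cauchy_Schwarz:
  assumes [measurable]: "f \<in> borel_measurable M" "g \<in> borel_measurable M"
  shows "(\<integral>\<^sup>+x. f x * g x \<partial>M)\<^sup>2 \<le> (\<integral>\<^sup>+x. (f x)\<^sup>2 \<partial>M) * (\<integral>\<^sup>+x. (g x)\<^sup>2 \<partial>M)"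
proof -
  let ?I = "\<integral>\<^sup>+x. f x * g x \<partial>M" and ?P = "\<integral>\<^sup>+x. (f x)\<^sup>2 \<partial>M" and ?Q = "\<integral>\<^sup>+x. (g x)\<^sup>2 \<partial>M"
  have "2 * (f x * g x * ?I) \<le> (f x)\<^sup>2 * ?Q + (g x)\<^sup>2 * ?P" for x
  proof -
    have "2 * (f x * g x * ?I) = (\<integral>\<^sup>+y. 2 * ((f x * g y) * (g x * f y)) \<partial>M)"
      by (subst nn_integral_cmult[symmetric], simp, subst nn_integral_cmult[symmetric], simp)
         (auto intro!: nn_integral_cong simp: ac_simps)
    also have "\<dots> \<le> (\<integral>\<^sup>+y. (f x * g y)\<^sup>2 + (g x * f y)\<^sup>2 \<partial>M)"
      by (intro nn_integral_mono ennreal_sum_squares_bound)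
    also have "\<dots> = (f x)\<^sup>2 * ?Q + (g x)\<^sup>2 * ?P"
      by (simp add: nn_integral_add nn_integral_cmult power_mult_distrib)
    finally show ?thesis .
  qed
  then have "(\<integral>\<^sup>+x. 2 * (f x * g x * ?I) \<partial>M) \<le> (\<integral>\<^sup>+x. (f x)\<^sup>2 * ?Q + (g x)\<^sup>2 * ?P \<partial>M)"
    by (intro nn_integral_mono)
  also have "(\<integral>\<^sup>+x. 2 * (f x * g x * ?I) \<partial>M) = 2 * ?I\<^sup>2"
    by (subst nn_integral_cmult, simp, subst nn_integral_multc) (simp_all add: power2_eq_square)
  also have "(\<integral>\<^sup>+x. (f x)\<^sup>2 * ?Q + (g x)\<^sup>2 * ?P \<partial>M) = 2 * (?P * ?Q)"
    by (subst nn_integral_add, simp, simp, subst nn_integral_multc, simp, subst nn_integral_multc)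
       (simp_all add: mult_2 mult.commute)
  finally have "2 * ?I\<^sup>2 \<le> 2 * (?P * ?Q)" .
  then show ?thesis
    by (subst (asm) ennreal_mult_le_mult_iff) auto
qed

lemma nn_integral_exp_Ioc:
  assumes "c > 0" "s \<le> t"
  shows "(\<integral>\<^sup>+r\<in>{s<..t}. ennreal (exp (c * r)) \<partial>lborel) \<le> ennreal (exp (c * t) / c)"
proof -
  have "(\<integral>\<^sup>+r\<in>{s<..t}. ennreal (exp (c * r)) \<partial>lborel)
      \<le> (\<integral>\<^sup>+r\<in>{s..t}. ennreal (exp (c * r)) \<partial>lborel)"
    by (intro nn_integral_mono) (auto split: split_indicator)
  also have "\<dots> = ennreal (exp (c * t) / c - exp (c * s) / c)"
    using assms
    by (intro nn_integral_FTC_Icc) (auto intro!: derivative_eq_intros)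
  also have "\<dots> \<le> ennreal (exp (c * t) / c)"
    using assms by (intro ennreal_leI) auto
  finally show ?thesis .
qed

text \<open>The Cauchy--Schwarz inequality for the factorization \<open>h(r) = exp(r/2) (exp(-r/2) h(r))\<close>, with
  \<open>exp t\<close> as a bound for the integral of \<open>exp r\<close>. The usual factor \<open>t\<close> is thereby traded for a weight
  that \<open>gronwall_exp\<close> absorbs.\<close>

lemma nn_integral_square_le_exp:
  fixes h :: "real \<Rightarrow> ennreal"
  assumes [measurable]: "h \<in> borel_measurable borel" and "0 \<le> t"
  shows "(\<integral>\<^sup>+r\<in>{0<..t}. h r \<partial>lborel)\<^sup>2
           \<le> (exp_conv (\<lambda>r. (h r)\<^sup>2) t)"
proof -
  let ?f = "\<lambda>r. ennreal (exp (r / 2)) * indicator {0<..t} r :: ennreal"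
  let ?g = "\<lambda>r. ennreal (exp (- r / 2)) * h r * indicator {0<..t} r :: ennreal"
  have split: "(\<integral>\<^sup>+r\<in>{0<..t}. h r \<partial>lborel) = (\<integral>\<^sup>+r. ?f r * ?g r \<partial>lborel)"
    by (intro nn_integral_cong)
       (auto split: split_indicator simp: mult.assoc[symmetric] ennreal_mult[symmetric] exp_add[symmetric])
  have "(\<integral>\<^sup>+r. (?f r)\<^sup>2 \<partial>lborel) = (\<integral>\<^sup>+r\<in>{0<..t}. ennreal (exp (1 * r)) \<partial>lborel)"
  proof (intro nn_integral_cong)
    fix r
    have "(ennreal (exp (r / 2)))\<^sup>2 = ennreal (exp r)"
      unfolding power2_eq_square by (simp add: ennreal_mult[symmetric] exp_add[symmetric])
    then show "(?f r)\<^sup>2 = ennreal (exp (1 * r)) * indicator {0<..t} r"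
      by (simp split: split_indicator)
  qed
  also have "\<dots> \<le> ennreal (exp (1 * t) / 1)"
    using assms by (intro nn_integral_exp_Ioc) auto
  finally have f: "(\<integral>\<^sup>+r. (?f r)\<^sup>2 \<partial>lborel) \<le> ennreal (exp t)" by simp
  have g: "ennreal (exp t) * (?g r)\<^sup>2 = ennreal (exp (t - r)) * (h r)\<^sup>2 * indicator {0<..t} r" for r
  proof -
    have "ennreal (exp t) * (ennreal (exp (- r / 2)))\<^sup>2 = ennreal (exp (t - r))"
      unfolding power2_eq_square by (simp add: ennreal_mult[symmetric] exp_add[symmetric])
    then show ?thesis
      by (simp split: split_indicator add: power_mult_distrib mult.assoc[symmetric])
  qed
  have "(\<integral>\<^sup>+r\<in>{0<..t}. h r \<partial>lborel)\<^sup>2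
      \<le> (\<integral>\<^sup>+r. (?f r)\<^sup>2 \<partial>lborel) * (\<integral>\<^sup>+r. (?g r)\<^sup>2 \<partial>lborel)"
    unfolding split by (intro nn_integral_Cauchy_Schwarz) auto
  also have "\<dots> \<le> ennreal (exp t) * (\<integral>\<^sup>+r. (?g r)\<^sup>2 \<partial>lborel)"
    by (intro mult_right_mono f) auto
  also have "\<dots> = (exp_conv (\<lambda>r. (h r)\<^sup>2) t)"
    unfolding g[symmetric] by (subst nn_integral_cmult) auto
  finally show ?thesis .
qed

lemma nn_integral_square_le_length:
  fixes h :: "real \<Rightarrow> ennreal"
  assumes [measurable]: "h \<in> borel_measurable borel" and "s \<le> t"
  shows "(\<integral>\<^sup>+r\<in>{s<..t}. h r \<partial>lborel)\<^sup>2 \<le> ennreal (t - s) * (\<integral>\<^sup>+r\<in>{s<..t}. (h r)\<^sup>2 \<partial>lborel)"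
proof -
  have "(\<integral>\<^sup>+r\<in>{s<..t}. h r \<partial>lborel)\<^sup>2 = (\<integral>\<^sup>+r. indicator {s<..t} r * (h r * indicator {s<..t} r) \<partial>lborel)\<^sup>2"
    by (intro arg_cong[where f="\<lambda>x. x\<^sup>2"] nn_integral_cong) (auto split: split_indicator)
  also have "\<dots> \<le> (\<integral>\<^sup>+r. (indicator {s<..t} r)\<^sup>2 \<partial>lborel) * (\<integral>\<^sup>+r. (h r * indicator {s<..t} r)\<^sup>2 \<partial>lborel)"
    by (intro nn_integral_Cauchy_Schwarz) auto
  also have "(\<integral>\<^sup>+r. (indicator {s<..t} r)\<^sup>2 \<partial>lborel) = ennreal (t - s)"
  proof -
    have "(\<integral>\<^sup>+r. (indicator {s<..t} r :: ennreal)\<^sup>2 \<partial>lborel) = (\<integral>\<^sup>+r. indicator {s<..t} r \<partial>lborel)"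
      by (intro nn_integral_cong) (auto split: split_indicator)
    then show ?thesis using assms by simp
  qed
  also have "(\<integral>\<^sup>+r. (h r * indicator {s<..t} r)\<^sup>2 \<partial>lborel) = (\<integral>\<^sup>+r\<in>{s<..t}. (h r)\<^sup>2 \<partial>lborel)"
    by (intro nn_integral_cong) (auto split: split_indicator)
  finally show ?thesis .
qed

text \<open>The function \<open>exp(-l t) f(t)\<close> has a finite supremum \<open>S\<close>. Inserting \<open>f(r) \<le> S exp(l r)\<close> on the right
  of the hypothesis and integrating gives \<open>S \<le> A + C S / (l - 1) \<le> A + S / 2\<close>, so \<open>S \<le> 2 A\<close>.\<close>

lemma gronwall_exp:
  fixes f :: "real \<Rightarrow> ennreal"
  assumes C: "0 < C" "2 * C + 1 \<le> l"
    and le: "\<And>t. 0 \<le> t \<Longrightarrow> t \<le> T \<Longrightarrow>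
      f t \<le> A * ennreal (exp (l * t)) + ennreal C * (exp_conv f t)"
    and bdd: "\<And>t. 0 \<le> t \<Longrightarrow> t \<le> T \<Longrightarrow> f t \<le> m" and m: "m < \<top>"
    and t: "0 \<le> t" "t \<le> T"
  shows "f t \<le> 2 * A * ennreal (exp (l * t))"
proof -
  define S where "S = (SUP t\<in>{0..T}. ennreal (exp (- (l * t))) * f t)"
  have exp_inv: "ennreal (exp (l * t)) * (ennreal (exp (- (l * t))) * x) = x"
      "ennreal (exp (- (l * t))) * (ennreal (exp (l * t)) * x) = x" for t x
    by (simp_all add: mult.assoc[symmetric] ennreal_mult[symmetric] exp_add[symmetric])
  have "S \<le> m"
    unfolding S_def
  proof (intro SUP_least)
    fix t assume t: "t \<in> {0..T}"
    have "ennreal (exp (- (l * t))) * f t \<le> 1 * m"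
      using t C bdd by (intro mult_mono) (auto simp: ennreal_le_1)
    then show "ennreal (exp (- (l * t))) * f t \<le> m" by simp
  qed
  then have "S < \<top>" using m by (rule le_less_trans)
  then obtain s where s: "0 \<le> s" "S = ennreal s"
    by (cases S) auto
  have fS: "f t \<le> ennreal (exp (l * t)) * S" if "0 \<le> t" "t \<le> T" for t
  proof -
    have "ennreal (exp (- (l * t))) * f t \<le> S"
      unfolding S_def using that by (intro SUP_upper) auto
    then have "ennreal (exp (l * t)) * (ennreal (exp (- (l * t))) * f t) \<le> ennreal (exp (l * t)) * S"
      by (rule mult_left_mono) simp
    then show ?thesis by (simp add: exp_inv)
  qed
  \<comment> \<open>the contraction step: the weight \<open>l\<close> is large enough to make the integral term at most \<open>S / 2\<close>\<close>
  have "S \<le> A + S / 2"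
    unfolding S_def
  proof (intro SUP_least)
    fix t assume t: "t \<in> {0..T}"
    have "(exp_conv f t)
        \<le> (\<integral>\<^sup>+r. ennreal (exp t * s) * (ennreal (exp ((l - 1) * r)) * indicator {0<..t} r) \<partial>lborel)"
    proof (intro nn_integral_mono)
      fix r
      have "ennreal (exp (t - r)) * f r \<le> ennreal (exp t * s) * ennreal (exp ((l - 1) * r))"
        if r: "r \<in> {0<..t}"
      proof -
        have "ennreal (exp (t - r)) * f r \<le> ennreal (exp (t - r)) * (ennreal (exp (l * r)) * S)"
          using r t by (intro mult_left_mono fS) auto
        also have "\<dots> = ennreal (exp (t - r) * exp (l * r) * s)"
          using s by (simp add: ennreal_mult mult.assoc)
        also have "exp (t - r) * exp (l * r) * s = exp t * s * exp ((l - 1) * r)"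
          by (simp add: exp_diff algebra_simps)
        finally show ?thesis using s by (simp add: ennreal_mult)
      qed
      then show "ennreal (exp (t - r)) * f r * indicator {0<..t} r
          \<le> ennreal (exp t * s) * (ennreal (exp ((l - 1) * r)) * indicator {0<..t} r)"
        by (auto split: split_indicator)
    qed
    also have "\<dots> \<le> ennreal (exp t * s) * ennreal (exp ((l - 1) * t) / (l - 1))"
      using C t by (subst nn_integral_cmult) (auto intro!: mult_left_mono nn_integral_exp_Ioc)
    also have "\<dots> = ennreal (exp (l * t) * s / (l - 1))"
      using C s by (simp add: ennreal_mult[symmetric] left_diff_distrib exp_diff)
    finally have "f t \<le> A * ennreal (exp (l * t)) + ennreal C * ennreal (exp (l * t) * s / (l - 1))"
      using le[of t] t by (meson atLeastAtMost_iff add_left_mono mult_left_mono order_trans zero_le)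
    also have "ennreal C * ennreal (exp (l * t) * s / (l - 1)) \<le> ennreal (exp (l * t) * (s / 2))"
    proof -
      have "C * (exp (l * t) * s / (l - 1)) = exp (l * t) * s * (C / (l - 1))" by simp
      also have "\<dots> \<le> exp (l * t) * s * (1 / 2)"
        using C s by (intro mult_left_mono) (auto simp: field_simps)
      finally show ?thesis
        using C s by (subst ennreal_mult[symmetric]) (auto intro!: ennreal_leI)
    qed
    finally have "f t \<le> ennreal (exp (l * t)) * (A + S / 2)"
      using s by (simp add: ring_distribs ac_simps ennreal_mult ennreal_divide_numeral[symmetric]
        ennreal_times_divide)
    then have "ennreal (exp (- (l * t))) * f t \<le> ennreal (exp (- (l * t))) * (ennreal (exp (l * t)) * (A + S / 2))"
      by (rule mult_left_mono) simp
    then show "ennreal (exp (- (l * t))) * f t \<le> A + (SUP t\<in>{0..T}. ennreal (exp (- (l * t))) * f t) / 2"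
      unfolding S_def[symmetric] by (simp add: exp_inv)
  qed
  \<comment> \<open>subtracting \<open>S / 2\<close> is legitimate because \<open>S\<close> is finite\<close>
  have "S \<le> 2 * A"
  proof (cases A)
    case (real a)
    then have "ennreal s \<le> ennreal (a + s / 2)"
      using \<open>S \<le> A + S / 2\<close> s by (simp add: ennreal_divide_numeral)
    then have "s \<le> 2 * a" using real s by (subst (asm) ennreal_le_iff) auto
    then show ?thesis
      using real s ennreal_leI[of s "2 * a"] by (simp add: ennreal_mult)
  qed (simp add: ennreal_mult_top)
  have "f t \<le> ennreal (exp (l * t)) * S" using t by (rule fS)
  also have "\<dots> \<le> ennreal (exp (l * t)) * (2 * A)"
    using \<open>S \<le> 2 * A\<close> by (rule mult_left_mono) simp
  finally show ?thesis by (simp add: ac_simps)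
qed

section \<open>Doob's maximal inequality in discrete time\<close>

text \<open>Summation by parts against the running maximum, which increases only when the sequence equals
  it: in the induction step either \<open>m\<close> does not change, or \<open>m (n+1) = s (n+1)\<close> and the difference of the
  two sides is a square.\<close>

lemma running_max_pathwise:
  fixes s :: "nat \<Rightarrow> real"
  assumes nn: "\<And>i. 0 \<le> s i"
  defines "m \<equiv> \<lambda>k. MAX i\<in>{..k}. s i"
  shows "(m n)\<^sup>2 + 2 * (\<Sum>k<n. m k * (s (Suc k) - s k)) \<le> 2 * m n * s n"
proof (induction n)
  case 0
  then show ?case by (simp add: m_def power2_eq_square)
next
  case (Suc n)
  have m_Suc: "m (Suc n) = max (s (Suc n)) (m n)"
    unfolding m_def by (simp add: atMost_Suc)
  show ?case
  proof (cases "s (Suc n) \<le> m n")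
    case True
    then have "m (Suc n) = m n" using m_Suc by simp
    then show ?thesis using Suc by (simp add: algebra_simps)
  next
    case False
    then have "m (Suc n) = s (Suc n)" using m_Suc by simp
    moreover have "0 \<le> (s (Suc n) - m n)\<^sup>2" by simp
    ultimately show ?thesis using Suc by (simp add: algebra_simps power2_eq_square)
  qed
qed

text \<open>A pathwise form of Doob's inequality: for a martingale \<open>N\<close> the subtracted sum is a discrete
  stochastic integral and has expectation zero. It follows from the preceding lemma for \<open>|N|\<close>, since
  \<open>|y| - |x| \<ge> sgn x (y - x)\<close>.\<close>

lemma running_max_sq_pathwise:
  fixes N :: "nat \<Rightarrow> real"
  defines "m \<equiv> \<lambda>k. MAX i\<in>{..k}. \<bar>N i\<bar>"
  shows "(m n)\<^sup>2 \<le> 4 * (N n)\<^sup>2 - 4 * (\<Sum>k<n. m k * sgn (N k) * (N (Suc k) - N k))"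
proof -
  have m0: "0 \<le> m k" for k
    unfolding m_def by (rule order_trans[OF abs_ge_zero[of "N 0"]]) (auto intro!: Max_ge)
  have "(\<Sum>k<n. m k * sgn (N k) * (N (Suc k) - N k)) \<le> (\<Sum>k<n. m k * (\<bar>N (Suc k)\<bar> - \<bar>N k\<bar>))"
  proof (intro sum_mono)
    fix k
    have "sgn (N k) * (N (Suc k) - N k) \<le> \<bar>N (Suc k)\<bar> - \<bar>N k\<bar>"
      by (auto simp: sgn_if abs_if)
    then show "m k * sgn (N k) * (N (Suc k) - N k) \<le> m k * (\<bar>N (Suc k)\<bar> - \<bar>N k\<bar>)"
      using m0 by (simp add: mult.assoc mult_left_mono)
  qed
  moreover have "(m n)\<^sup>2 + 2 * (\<Sum>k<n. m k * (\<bar>N (Suc k)\<bar> - \<bar>N k\<bar>)) \<le> 2 * m n * \<bar>N n\<bar>"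
    using running_max_pathwise[of "\<lambda>i. \<bar>N i\<bar>" n] unfolding m_def by simp
  moreover have "2 * m n * \<bar>N n\<bar> \<le> (m n)\<^sup>2 / 2 + 2 * (N n)\<^sup>2"
    using sum_squares_bound[of "m n" "2 * \<bar>N n\<bar>"] by (simp add: power_mult_distrib)
  ultimately show ?thesis by linarith
qed

lemma integrable_mult_of_squares:
  fixes f g :: "'a \<Rightarrow> real"
  assumes [measurable]: "f \<in> borel_measurable M" "g \<in> borel_measurable M"
    and "integrable M (\<lambda>x. (f x)\<^sup>2)" "integrable M (\<lambda>x. (g x)\<^sup>2)"
  shows "integrable M (\<lambda>x. f x * g x)"
proof (rule Bochner_Integration.integrable_bound)
  show "integrable M (\<lambda>x. (f x)\<^sup>2 + (g x)\<^sup>2)" using assms by simp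
  show "AE x in M. norm (f x * g x) \<le> norm ((f x)\<^sup>2 + (g x)\<^sup>2)"
  proof (intro AE_I2)
    fix x
    have "2 * \<bar>f x * g x\<bar> \<le> (f x)\<^sup>2 + (g x)\<^sup>2"
      using sum_squares_bound[of "\<bar>f x\<bar>" "\<bar>g x\<bar>"] by (simp add: abs_mult)
    then show "norm (f x * g x) \<le> norm ((f x)\<^sup>2 + (g x)\<^sup>2)" by simp
  qed
qed simp

lemma integrable_square_add:
  fixes f g :: "'a \<Rightarrow> real"
  assumes [measurable]: "f \<in> borel_measurable M" "g \<in> borel_measurable M"
    and "integrable M (\<lambda>x. (f x)\<^sup>2)" "integrable M (\<lambda>x. (g x)\<^sup>2)"
  shows "integrable M (\<lambda>x. (f x + g x)\<^sup>2)"
proof -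
  have "integrable M (\<lambda>x. (f x)\<^sup>2 + (g x)\<^sup>2 + 2 * (f x * g x))"
    using assms by (intro Bochner_Integration.integrable_add) (auto intro: integrable_mult_of_squares)
  then show ?thesis by (simp add: power2_sum mult.assoc)
qed

lemma integrable_square_sum:
  fixes f :: "'i \<Rightarrow> 'a \<Rightarrow> real"
  assumes "finite I" "\<And>i. i \<in> I \<Longrightarrow> f i \<in> borel_measurable M"
    and "\<And>i. i \<in> I \<Longrightarrow> integrable M (\<lambda>x. (f i x)\<^sup>2)"
  shows "integrable M (\<lambda>x. (\<Sum>i\<in>I. f i x)\<^sup>2)"
  using assms by (induction I rule: finite_induct) (auto intro!: integrable_square_add)

text \<open>The martingale property is stated as orthogonality of the increments to the square integrable
  variables of the past, which is the form in which it holds for elementary stochastic integrals. It annihilates the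
  sum in \<open>running_max_sq_pathwise\<close>, term by term.\<close>

lemma (in prob_space) doob_L2:
  fixes N :: "nat \<Rightarrow> 'a \<Rightarrow> real" and G :: "nat \<Rightarrow> 'a measure"
  assumes sub: "\<And>k. subalgebra M (G k)" and mono: "\<And>k l. k \<le> l \<Longrightarrow> sets (G k) \<subseteq> sets (G l)"
    and adapted: "\<And>k. N k \<in> borel_measurable (G k)"
    and L2: "\<And>k. integrable M (\<lambda>\<omega>. (N k \<omega>)\<^sup>2)"
    and orth: "\<And>k Z. Z \<in> borel_measurable (G k) \<Longrightarrow> integrable M (\<lambda>\<omega>. (Z \<omega>)\<^sup>2) \<Longrightarrow>
                 (\<integral>\<omega>. Z \<omega> * (N (Suc k) \<omega> - N k \<omega>) \<partial>M) = 0"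
  shows "(\<integral>\<^sup>+\<omega>. (SUP k\<in>{..n}. ennreal ((N k \<omega>)\<^sup>2)) \<partial>M) \<le> 4 * (\<integral>\<^sup>+\<omega>. ennreal ((N n \<omega>)\<^sup>2) \<partial>M)"
proof -
  define m where "m k \<omega> = (MAX i\<in>{..k}. \<bar>N i \<omega>\<bar>)" for k \<omega>
  define Z where "Z k \<omega> = m k \<omega> * sgn (N k \<omega>)" for k \<omega>
  have N[measurable]: "N k \<in> borel_measurable M" for k
    using adapted sub by (rule measurable_from_subalg[rotated])
  have mG: "m k \<in> borel_measurable (G k)" for k
  proof -
    have "N i \<in> borel_measurable (G k)" if "i \<le> k" for i
      using adapted[of i] mono[OF that] sub[of k] sub[of i]
      by (intro measurable_from_subalg[of "G k" "G i"]) (auto simp: subalgebra_def)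
    then show ?thesis unfolding m_def[abs_def] by (intro borel_measurable_Max) auto
  qed
  have m0: "0 \<le> m k \<omega>" for k \<omega>
    unfolding m_def by (rule order_trans[OF abs_ge_zero[of "N 0 \<omega>"]]) (auto intro!: Max_ge)
  have m_le: "(m k \<omega>)\<^sup>2 \<le> (\<Sum>i\<le>k. (N i \<omega>)\<^sup>2)" for k \<omega>
  proof -
    have "m k \<omega> \<in> (\<lambda>i. \<bar>N i \<omega>\<bar>) ` {..k}" unfolding m_def by (intro Max_in) auto
    then obtain i where "i \<le> k" "m k \<omega> = \<bar>N i \<omega>\<bar>" by auto
    then show ?thesis using member_le_sum[of i "{..k}" "\<lambda>i. (N i \<omega>)\<^sup>2"] by simp
  qed
  have m_L2: "integrable M (\<lambda>\<omega>. (m k \<omega>)\<^sup>2)" for k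
  proof (rule Bochner_Integration.integrable_bound)
    show "integrable M (\<lambda>\<omega>. \<Sum>i\<le>k. (N i \<omega>)\<^sup>2)" using L2 by simp
    show "(\<lambda>\<omega>. (m k \<omega>)\<^sup>2) \<in> borel_measurable M"
      using measurable_from_subalg[OF sub mG] by measurable
    show "AE \<omega> in M. norm ((m k \<omega>)\<^sup>2) \<le> norm (\<Sum>i\<le>k. (N i \<omega>)\<^sup>2)"
      using m_le by (intro AE_I2) (simp add: sum_nonneg)
  qed
  have ZG: "Z k \<in> borel_measurable (G k)" for k
    using mG adapted unfolding Z_def[abs_def] by measurable
  have Z_L2: "integrable M (\<lambda>\<omega>. (Z k \<omega>)\<^sup>2)" for k
  proof (rule Bochner_Integration.integrable_bound[OF m_L2])
    show "(\<lambda>\<omega>. (Z k \<omega>)\<^sup>2) \<in> borel_measurable M"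
      using measurable_from_subalg[OF sub ZG] by measurable
    show "AE \<omega> in M. norm ((Z k \<omega>)\<^sup>2) \<le> norm ((m k \<omega>)\<^sup>2)"
      by (intro AE_I2) (auto simp: Z_def sgn_if power_mult_distrib)
  qed
  have ZN: "integrable M (\<lambda>\<omega>. Z k \<omega> * (N (Suc k) \<omega> - N k \<omega>))" for k
  proof (rule integrable_mult_of_squares)
    show "Z k \<in> borel_measurable M" using sub ZG by (rule measurable_from_subalg)
    show "integrable M (\<lambda>x. (N (Suc k) x - N k x)\<^sup>2)"
      using integrable_square_add[of "N (Suc k)" M "\<lambda>x. - N k x"] L2 by simp
  qed (use Z_L2 in auto)
  have path: "(m n \<omega>)\<^sup>2 \<le> 4 * (N n \<omega>)\<^sup>2 - 4 * (\<Sum>k<n. Z k \<omega> * (N (Suc k) \<omega> - N k \<omega>))" for \<omega>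
    using running_max_sq_pathwise[of "\<lambda>k. N k \<omega>" n] unfolding m_def Z_def .
  have "(\<integral>\<omega>. (m n \<omega>)\<^sup>2 \<partial>M) \<le> (\<integral>\<omega>. 4 * (N n \<omega>)\<^sup>2 - 4 * (\<Sum>k<n. Z k \<omega> * (N (Suc k) \<omega> - N k \<omega>)) \<partial>M)"
    using path m_L2 L2 ZN by (intro integral_mono) auto
  also have "\<dots> = 4 * (\<integral>\<omega>. (N n \<omega>)\<^sup>2 \<partial>M)"
    using L2 ZN orth[OF ZG Z_L2] by simp
  finally have main: "(\<integral>\<omega>. (m n \<omega>)\<^sup>2 \<partial>M) \<le> 4 * (\<integral>\<omega>. (N n \<omega>)\<^sup>2 \<partial>M)" .
  have "(\<integral>\<^sup>+\<omega>. (SUP k\<in>{..n}. ennreal ((N k \<omega>)\<^sup>2)) \<partial>M) \<le> (\<integral>\<^sup>+\<omega>. ennreal ((m n \<omega>)\<^sup>2) \<partial>M)"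
  proof (intro nn_integral_mono SUP_least ennreal_leI)
    fix \<omega> k assume "k \<in> {..n}"
    then have "\<bar>N k \<omega>\<bar> \<le> m n \<omega>" unfolding m_def by (intro Max_ge) auto
    then show "(N k \<omega>)\<^sup>2 \<le> (m n \<omega>)\<^sup>2" using m0[of n \<omega>] by (simp add: abs_le_square_iff[symmetric])
  qed
  also have "\<dots> = ennreal (\<integral>\<omega>. (m n \<omega>)\<^sup>2 \<partial>M)" using m_L2 by (intro nn_integral_eq_integral) auto
  also have "\<dots> \<le> ennreal (4 * (\<integral>\<omega>. (N n \<omega>)\<^sup>2 \<partial>M))" using main by (rule ennreal_leI)
  also have "\<dots> = 4 * (\<integral>\<^sup>+\<omega>. ennreal ((N n \<omega>)\<^sup>2) \<partial>M)"
    using L2 by (subst nn_integral_eq_integral) (auto simp: ennreal_mult)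
  finally show ?thesis .
qed

section \<open>Increments of Brownian motion\<close>

lemma borel_measurable_nth[measurable]:
  "(\<lambda>x :: 'c::euclidean_space ^ 'n. x $ i) \<in> borel_measurable borel"
  by (intro borel_measurable_continuous_onI continuous_intros)

lemma borel_measurable_vecI:
  fixes f :: "'b \<Rightarrow> real ^ 'n"
  assumes "\<And>i. (\<lambda>x. f x $ i) \<in> borel_measurable N"
  shows "f \<in> borel_measurable N"
  using assms by (subst borel_measurable_euclidean_space) (auto simp: Basis_vec_def inner_axis)

lemma measurable_vec_nth[measurable (raw)]:
  fixes f :: "'b \<Rightarrow> 'c::euclidean_space ^ 'n"
  shows "f \<in> borel_measurable N \<Longrightarrow> (\<lambda>x. f x $ i) \<in> borel_measurable N"
  by (rule measurable_compose[OF _ borel_measurable_nth])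

locale brownian_space = prob_space M for M :: "'a measure" +
  fixes F :: "real \<Rightarrow> 'a measure" and B :: "real \<Rightarrow> 'a \<Rightarrow> real ^ 'm"
  assumes filtration: "usual_filtration M F" and brownian: "brownian_motion M F B"
begin

lemma F_subalgebra: "0 \<le> t \<Longrightarrow> subalgebra M (F t)"
  using filtration[unfolded usual_filtration_def, THEN conjunct1] by simp

lemma F_sets_mono: "0 \<le> s \<Longrightarrow> s \<le> t \<Longrightarrow> sets (F s) \<subseteq> sets (F t)"
  using filtration[unfolded usual_filtration_def, THEN conjunct2, THEN conjunct1] by simp

lemma F_measurable_mono:
  "f \<in> borel_measurable (F s) \<Longrightarrow> 0 \<le> s \<Longrightarrow> s \<le> t \<Longrightarrow> f \<in> borel_measurable (F t)"
  using F_subalgebra[of s] F_subalgebra[of t] F_sets_mono[of s t]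
  by (intro measurable_from_subalg[of "F t" "F s"]) (auto simp: subalgebra_def)

lemma F_measurable_M: "f \<in> borel_measurable (F s) \<Longrightarrow> 0 \<le> s \<Longrightarrow> f \<in> borel_measurable M"
  by (rule measurable_from_subalg[OF F_subalgebra])

lemma B_adapted: "0 \<le> t \<Longrightarrow> B t \<in> borel_measurable (F t)"
  using brownian[unfolded brownian_motion_def adapted_process_def, THEN conjunct1] by simp

lemma B_continuous: "AE \<omega> in M. continuous_on {0..} (\<lambda>t. B t \<omega>)"
  using brownian[unfolded brownian_motion_def continuous_process_def, THEN conjunct2, THEN conjunct1] .

lemma B_measurable: "0 \<le> t \<Longrightarrow> B t \<in> borel_measurable M"
  using B_adapted by (rule F_measurable_M)

definition dB :: "real \<Rightarrow> real \<Rightarrow> 'm \<Rightarrow> 'a \<Rightarrow> real" where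
  "dB s t j \<omega> = (B t \<omega> - B s \<omega>) $ j"

lemma dB_same: "dB s s j \<omega> = 0" by (simp add: dB_def)

lemma dB_add: "dB s u j \<omega> = dB s t j \<omega> + dB t u j \<omega>" by (simp add: dB_def)

lemma dB_adapted: "0 \<le> s \<Longrightarrow> s \<le> t \<Longrightarrow> dB s t j \<in> borel_measurable (F t)"
  using B_adapted[of t] F_measurable_mono[OF B_adapted, of s t]
  unfolding dB_def[abs_def] by measurable

lemma increment_laws:
  assumes "0 \<le> s" "s < t"
  shows "indep_set (sets (F s)) (sets (vimage_algebra (space M) (\<lambda>\<omega>. B t \<omega> - B s \<omega>) borel))"
    "indep_vars (\<lambda>_. borel) (dB s t) UNIV"
    "distributed M lborel (dB s t i) (normal_density 0 (sqrt (t - s)))"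
proof -
  note laws = brownian[unfolded brownian_motion_def, THEN conjunct2, THEN conjunct2, THEN conjunct2,
      THEN spec, THEN spec, THEN mp, OF conjI[OF assms]]
  show "indep_set (sets (F s)) (sets (vimage_algebra (space M) (\<lambda>\<omega>. B t \<omega> - B s \<omega>) borel))"
    by (rule laws[THEN conjunct1])
  show "indep_vars (\<lambda>_. borel) (dB s t) UNIV"
    unfolding dB_def[abs_def] by (rule laws[THEN conjunct2, THEN conjunct1])
  show "distributed M lborel (dB s t i) (normal_density 0 (sqrt (t - s)))"
    unfolding dB_def[abs_def] by (rule laws[THEN conjunct2, THEN conjunct2, THEN spec])
qed

lemma indep_increment:
  fixes Z :: "'a \<Rightarrow> real" and g :: "real ^ 'm \<Rightarrow> real"
  assumes st: "0 \<le> s" "s < t" and Z: "Z \<in> borel_measurable (F s)" and g: "g \<in> borel_measurable borel"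
  shows "indep_var borel Z borel (\<lambda>\<omega>. g (B t \<omega> - B s \<omega>))"
proof -
  have ind: "indep_set (sets (F s)) (sets (vimage_algebra (space M) (\<lambda>\<omega>. B t \<omega> - B s \<omega>) borel))"
    using st by (rule increment_laws)
  have ZM: "Z \<in> borel_measurable M" using Z st by (intro F_measurable_M)
  have Bm: "B t \<in> borel_measurable M" "B s \<in> borel_measurable M" using st by (auto intro!: B_measurable)
  have sp: "space (F s) = space M" using F_subalgebra[of s] st by (auto simp: subalgebra_def)
  have *: "indep_set {Z -` A \<inter> space M |A. A \<in> sets borel}
      {(\<lambda>\<omega>. g (B t \<omega> - B s \<omega>)) -` A \<inter> space M |A. A \<in> sets borel}"
    unfolding indep_sets2_eq
  proof (intro conjI ballI)
    show "{Z -` A \<inter> space M |A. A \<in> sets borel} \<subseteq> events"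
      using ZM by (auto intro: measurable_sets)
    show "{(\<lambda>\<omega>. g (B t \<omega> - B s \<omega>)) -` A \<inter> space M |A. A \<in> sets borel} \<subseteq> events"
      using Bm g by (auto intro!: measurable_sets)
    fix a b assume a: "a \<in> {Z -` A \<inter> space M |A. A \<in> sets borel}"
      and b: "b \<in> {(\<lambda>\<omega>. g (B t \<omega> - B s \<omega>)) -` A \<inter> space M |A. A \<in> sets borel}"
    have "a \<in> sets (F s)" using a Z sp by (auto dest: measurable_sets)
    moreover have "b \<in> sets (vimage_algebra (space M) (\<lambda>\<omega>. B t \<omega> - B s \<omega>) borel)"
    proof -
      obtain A where A: "A \<in> sets borel" "b = (\<lambda>\<omega>. g (B t \<omega> - B s \<omega>)) -` A \<inter> space M" using b by auto
      have "g -` A \<in> sets borel" using g A(1) by (auto dest: measurable_sets)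
      then have "(\<lambda>\<omega>. B t \<omega> - B s \<omega>) -` (g -` A) \<inter> space M
          \<in> sets (vimage_algebra (space M) (\<lambda>\<omega>. B t \<omega> - B s \<omega>) borel)"
        by (rule in_vimage_algebra)
      then show ?thesis using A(2) by (simp add: vimage_def)
    qed
    ultimately show "prob (a \<inter> b) = prob a * prob b"
      using ind unfolding indep_sets2_eq by blast
  qed
  have Int_stable: "Int_stable {X -` A \<inter> space M |A. A \<in> sets borel}" for X :: "'a \<Rightarrow> real"
  proof (safe intro!: Int_stableI)
    fix A B :: "real set" assume "A \<in> sets borel" "B \<in> sets borel"
    then show "\<exists>C. (X -` A \<inter> space M) \<inter> (X -` B \<inter> space M) = (X -` C \<inter> space M) \<and> C \<in> sets borel"
      by (intro exI[of _ "A \<inter> B"]) auto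
  qed
  show ?thesis
    unfolding indep_var_eq
  proof (intro conjI)
    show "indep_set (sigma_sets (space M) {Z -` A \<inter> space M |A. A \<in> sets borel})
       (sigma_sets (space M) {(\<lambda>\<omega>. g (B t \<omega> - B s \<omega>)) -` A \<inter> space M |A. A \<in> sets borel})"
      by (intro indep_set_sigma_sets * Int_stable)
  qed (use ZM Bm g in auto)
qed

lemma dB_moments:
  assumes st: "0 \<le> s" "s < t"
  shows "integrable M (dB s t i)" "expectation (dB s t i) = 0"
    "integrable M (\<lambda>\<omega>. dB s t i \<omega> * dB s t j \<omega>)"
    "expectation (\<lambda>\<omega>. dB s t i \<omega> * dB s t j \<omega>) = (if i = j then t - s else 0)"
proof -
  have sd: "0 < sqrt (t - s)" using st by simp
  note D = increment_laws(3)[OF st]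
  show int: "integrable M (dB s t i)" for i
    using integrable_normal_moment_nz_1[OF sd, of 0] distributed_integrable[OF D, of "\<lambda>x. x" i] by simp
  show E: "expectation (dB s t i) = 0" for i
    using normal_distributed_expectation[OF sd D] .
  have int2: "integrable M (\<lambda>\<omega>. (dB s t i \<omega>)\<^sup>2)"
    using integrable_normal_moment[OF sd, of 0 2] distributed_integrable[OF D, of "\<lambda>x. x\<^sup>2" i] by simp
  have E2: "expectation (\<lambda>\<omega>. (dB s t i \<omega>)\<^sup>2) = t - s"
    using normal_distributed_variance[OF sd D, of i] E st by simp
  have ind: "indep_vars (\<lambda>_. borel) (dB s t) {i, j}"
    by (rule indep_vars_subset[OF increment_laws(2)[OF st]]) simp
  show "integrable M (\<lambda>\<omega>. dB s t i \<omega> * dB s t j \<omega>)"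
  proof (cases "i = j")
    case True then show ?thesis using int2 by (simp add: power2_eq_square)
  next
    case False then show ?thesis using indep_vars_integrable[OF _ ind int] by simp
  qed
  show "expectation (\<lambda>\<omega>. dB s t i \<omega> * dB s t j \<omega>) = (if i = j then t - s else 0)"
  proof (cases "i = j")
    case True then show ?thesis using E2 by (simp add: power2_eq_square)
  next
    case False then show ?thesis using indep_vars_lebesgue_integral[OF _ ind int] E by simp
  qed
qed

lemma expectation_mult_dB:
  assumes st: "0 \<le> s" "s \<le> t" and Z: "Z \<in> borel_measurable (F s)" "integrable M Z"
  shows "expectation (\<lambda>\<omega>. Z \<omega> * dB s t i \<omega>) = 0"
proof (cases "s = t")
  case False
  then have "s < t" using st by simp
  have "indep_var borel Z borel (\<lambda>\<omega>. (B t \<omega> - B s \<omega>) $ i)"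
    using st \<open>s < t\<close> Z by (intro indep_increment borel_measurable_times borel_measurable_nth)
  then have ind: "indep_var borel Z borel (dB s t i)" by (simp add: dB_def[abs_def])
  show ?thesis
    using indep_var_lebesgue_integral[OF ind Z(2) dB_moments(1)] dB_moments(2) st \<open>s < t\<close> by simp
qed (simp add: dB_same)

lemma expectation_mult_dB_dB:
  assumes st: "0 \<le> s" "s \<le> t" and Z: "Z \<in> borel_measurable (F s)" "integrable M Z"
  shows "integrable M (\<lambda>\<omega>. Z \<omega> * (dB s t i \<omega> * dB s t j \<omega>))"
    "expectation (\<lambda>\<omega>. Z \<omega> * (dB s t i \<omega> * dB s t j \<omega>)) = (if i = j then expectation Z * (t - s) else 0)"
proof -
  have "integrable M (\<lambda>\<omega>. Z \<omega> * (dB s t i \<omega> * dB s t j \<omega>)) \<and>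
    expectation (\<lambda>\<omega>. Z \<omega> * (dB s t i \<omega> * dB s t j \<omega>)) = (if i = j then expectation Z * (t - s) else 0)"
  proof (cases "s = t")
    case False
    then have "s < t" using st by simp
    have "indep_var borel Z borel (\<lambda>\<omega>. (B t \<omega> - B s \<omega>) $ i * (B t \<omega> - B s \<omega>) $ j)"
      using st \<open>s < t\<close> Z by (intro indep_increment borel_measurable_times borel_measurable_nth)
    then have ind: "indep_var borel Z borel (\<lambda>\<omega>. dB s t i \<omega> * dB s t j \<omega>)" by (simp add: dB_def[abs_def])
    show ?thesis
      using indep_var_lebesgue_integral[OF ind Z(2) dB_moments(3)[OF st(1) \<open>s < t\<close>]]
        indep_var_integrable[OF ind Z(2) dB_moments(3)[OF st(1) \<open>s < t\<close>]]
        dB_moments(4)[OF st(1) \<open>s < t\<close>, of i j] by simp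
  qed (simp add: dB_same)
  then show "integrable M (\<lambda>\<omega>. Z \<omega> * (dB s t i \<omega> * dB s t j \<omega>))"
    "expectation (\<lambda>\<omega>. Z \<omega> * (dB s t i \<omega> * dB s t j \<omega>)) = (if i = j then expectation Z * (t - s) else 0)"
    by auto
qed

lemma dB_term_L2:
  assumes st: "0 \<le> s" "s \<le> t" and Z: "Z \<in> borel_measurable (F s)" "integrable M (\<lambda>\<omega>. (Z \<omega>)\<^sup>2)"
  shows "integrable M (\<lambda>\<omega>. (Z \<omega> * dB s t i \<omega>)\<^sup>2)"
    "(\<lambda>\<omega>. Z \<omega> * dB s t i \<omega>) \<in> borel_measurable (F t)"
proof -
  have "(\<lambda>\<omega>. (Z \<omega>)\<^sup>2) \<in> borel_measurable (F s)" using Z by measurable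
  from expectation_mult_dB_dB(1)[OF st this Z(2), of i i]
  show "integrable M (\<lambda>\<omega>. (Z \<omega> * dB s t i \<omega>)\<^sup>2)" by (simp add: power2_eq_square ac_simps)
  show "(\<lambda>\<omega>. Z \<omega> * dB s t i \<omega>) \<in> borel_measurable (F t)"
    using F_measurable_mono[OF Z(1) st] dB_adapted[OF st] by measurable
qed

text \<open>The later increment is centred and independent of everything else in the product.\<close>

lemma expectation_dB_terms_disjoint:
  assumes pq: "0 \<le> p" "p \<le> q" "q \<le> p'" "p' \<le> q'"
    and Z: "Z \<in> borel_measurable (F p)" "integrable M (\<lambda>\<omega>. (Z \<omega>)\<^sup>2)"
    and W: "W \<in> borel_measurable (F p')" "integrable M (\<lambda>\<omega>. (W \<omega>)\<^sup>2)"
  shows "expectation (\<lambda>\<omega>. (Z \<omega> * dB p q i \<omega>) * (W \<omega> * dB p' q' j \<omega>)) = 0"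
proof -
  note T = dB_term_L2[OF pq(1,2) Z, of i]
  have T': "(\<lambda>\<omega>. Z \<omega> * dB p q i \<omega>) \<in> borel_measurable (F p')"
    using pq by (intro F_measurable_mono[OF T(2)]) auto
  have "expectation (\<lambda>\<omega>. ((Z \<omega> * dB p q i \<omega>) * W \<omega>) * dB p' q' j \<omega>) = 0"
  proof (rule expectation_mult_dB)
    show "(\<lambda>\<omega>. (Z \<omega> * dB p q i \<omega>) * W \<omega>) \<in> borel_measurable (F p')"
      using T' W by measurable
    show "integrable M (\<lambda>\<omega>. (Z \<omega> * dB p q i \<omega>) * W \<omega>)"
      using T T' W pq by (intro integrable_mult_of_squares) (auto intro: F_measurable_M)
  qed (use pq in auto)
  then show ?thesis by (simp add: mult.assoc)
qed

text \<open>The longer increment is the shorter one plus an increment over a later interval, whose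
  contribution vanishes.\<close>

lemma expectation_dB_terms_same_start:
  assumes p: "0 \<le> p" "p \<le> q" "q \<le> q'"
    and Z: "Z \<in> borel_measurable (F p)" "integrable M (\<lambda>\<omega>. (Z \<omega>)\<^sup>2)"
    and W: "W \<in> borel_measurable (F p)" "integrable M (\<lambda>\<omega>. (W \<omega>)\<^sup>2)"
  shows "expectation (\<lambda>\<omega>. (Z \<omega> * dB p q i \<omega>) * (W \<omega> * dB p q' j \<omega>))
           = (if i = j then expectation (\<lambda>\<omega>. Z \<omega> * W \<omega>) * (q - p) else 0)"
proof -
  have W': "W \<in> borel_measurable (F q)" using p by (intro F_measurable_mono[OF W(1)]) auto
  have ZM: "Z \<in> borel_measurable M" "W \<in> borel_measurable M" using Z W p by (auto intro: F_measurable_M)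
  have ZW: "integrable M (\<lambda>\<omega>. Z \<omega> * W \<omega>)" using Z W ZM by (intro integrable_mult_of_squares)
  have ZWF: "(\<lambda>\<omega>. Z \<omega> * W \<omega>) \<in> borel_measurable (F p)" using Z W by measurable
  note E = expectation_mult_dB_dB[OF p(1,2) ZWF ZW, of i j]
  have int: "integrable M (\<lambda>\<omega>. (Z \<omega> * dB p q i \<omega>) * (W \<omega> * dB q q' j \<omega>))"
    using p Z W W' by (intro integrable_mult_of_squares dB_term_L2 F_measurable_M[OF dB_term_L2(2)]) auto
  have "expectation (\<lambda>\<omega>. (Z \<omega> * dB p q i \<omega>) * (W \<omega> * dB p q' j \<omega>))
      = expectation (\<lambda>\<omega>. Z \<omega> * W \<omega> * (dB p q i \<omega> * dB p q j \<omega>) + (Z \<omega> * dB p q i \<omega>) * (W \<omega> * dB q q' j \<omega>))"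
    by (intro Bochner_Integration.integral_cong refl) (simp add: dB_add[of p q' _ _ q] algebra_simps)
  also have "\<dots> = expectation (\<lambda>\<omega>. Z \<omega> * W \<omega> * (dB p q i \<omega> * dB p q j \<omega>))"
    using E(1) int expectation_dB_terms_disjoint[OF p(1,2) order_refl p(3) Z W' W(2), of i j] by simp
  finally show ?thesis using E(2) by simp
qed

text \<open>The length of the intersection of the intervals from \<open>p\<close> to \<open>q\<close> and from \<open>p'\<close> to \<open>q'\<close>.\<close>

definition overlap :: "real \<Rightarrow> real \<Rightarrow> real \<Rightarrow> real \<Rightarrow> real" where
  "overlap p q p' q' = max 0 (min q q' - max p p')"

text \<open>Cut the first interval at \<open>p'\<close>: the part before \<open>p'\<close> contributes nothing, and the part
  after it starts together with the second interval.\<close>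

lemma expectation_dB_terms_le:
  assumes pq: "0 \<le> p" "p \<le> q" "p \<le> p'" "p' \<le> q'"
    and Z: "Z \<in> borel_measurable (F p)" "integrable M (\<lambda>\<omega>. (Z \<omega>)\<^sup>2)"
    and W: "W \<in> borel_measurable (F p')" "integrable M (\<lambda>\<omega>. (W \<omega>)\<^sup>2)"
  shows "expectation (\<lambda>\<omega>. (Z \<omega> * dB p q i \<omega>) * (W \<omega> * dB p' q' j \<omega>))
           = (if i = j then expectation (\<lambda>\<omega>. Z \<omega> * W \<omega>) * overlap p q p' q' else 0)"
proof (cases "q \<le> p'")
  case True
  then have "overlap p q p' q' = 0" using pq by (auto simp: overlap_def)
  then show ?thesis using expectation_dB_terms_disjoint[OF pq(1,2) True pq(4) Z W] by simp
next
  case False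
  then have ov: "overlap p q p' q' = min q q' - p'" using pq by (auto simp: overlap_def)
  have Z': "Z \<in> borel_measurable (F p')" using pq by (intro F_measurable_mono[OF Z(1)]) auto
  have p': "0 \<le> p'" "p' \<le> q" using pq False by auto
  have int: "integrable M (\<lambda>\<omega>. (Z \<omega> * dB p p' i \<omega>) * (W \<omega> * dB p' q' j \<omega>))"
    "integrable M (\<lambda>\<omega>. (Z \<omega> * dB p' q i \<omega>) * (W \<omega> * dB p' q' j \<omega>))"
    using pq p' Z W Z' by (intro integrable_mult_of_squares dB_term_L2 F_measurable_M[OF dB_term_L2(2)]; simp)+
  have "expectation (\<lambda>\<omega>. (Z \<omega> * dB p q i \<omega>) * (W \<omega> * dB p' q' j \<omega>))
      = expectation (\<lambda>\<omega>. (Z \<omega> * dB p p' i \<omega>) * (W \<omega> * dB p' q' j \<omega>) + (Z \<omega> * dB p' q i \<omega>) * (W \<omega> * dB p' q' j \<omega>))"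
    by (intro Bochner_Integration.integral_cong refl) (simp add: dB_add[of p q _ _ p'] algebra_simps)
  also have "\<dots> = expectation (\<lambda>\<omega>. (Z \<omega> * dB p' q i \<omega>) * (W \<omega> * dB p' q' j \<omega>))"
    using int expectation_dB_terms_disjoint[OF pq(1,3) order_refl pq(4) Z W, of i j] by simp
  also have "\<dots> = (if i = j then expectation (\<lambda>\<omega>. Z \<omega> * W \<omega>) * (min q q' - p') else 0)"
  proof (cases "q \<le> q'")
    case True
    then show ?thesis
      using expectation_dB_terms_same_start[OF p' True Z' Z(2) W, of i j] by simp
  next
    case False
    then show ?thesis
      using expectation_dB_terms_same_start[OF p'(1) pq(4) _ W Z' Z(2), of q j i] by (auto simp: mult.commute)
  qed
  finally show ?thesis using ov by simp
qed

text \<open>The polarized Ito isometry for two single-interval integrands on arbitrary intervals. Treating all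
  pairs of intervals at once avoids common refinements of partitions later.\<close>

lemma expectation_dB_terms:
  assumes pq: "0 \<le> p" "p \<le> q" "0 \<le> p'" "p' \<le> q'"
    and Z: "Z \<in> borel_measurable (F p)" "integrable M (\<lambda>\<omega>. (Z \<omega>)\<^sup>2)"
    and W: "W \<in> borel_measurable (F p')" "integrable M (\<lambda>\<omega>. (W \<omega>)\<^sup>2)"
  shows "integrable M (\<lambda>\<omega>. (Z \<omega> * dB p q i \<omega>) * (W \<omega> * dB p' q' j \<omega>))"
    "expectation (\<lambda>\<omega>. (Z \<omega> * dB p q i \<omega>) * (W \<omega> * dB p' q' j \<omega>))
           = (if i = j then expectation (\<lambda>\<omega>. Z \<omega> * W \<omega>) * overlap p q p' q' else 0)"
proof -
  show "integrable M (\<lambda>\<omega>. (Z \<omega> * dB p q i \<omega>) * (W \<omega> * dB p' q' j \<omega>))"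
    using pq Z W by (intro integrable_mult_of_squares dB_term_L2 F_measurable_M[OF dB_term_L2(2)]; simp)
  show "expectation (\<lambda>\<omega>. (Z \<omega> * dB p q i \<omega>) * (W \<omega> * dB p' q' j \<omega>))
           = (if i = j then expectation (\<lambda>\<omega>. Z \<omega> * W \<omega>) * overlap p q p' q' else 0)"
  proof (cases "p \<le> p'")
    case True
    then show ?thesis using expectation_dB_terms_le[OF pq(1,2) True pq(4) Z W] by simp
  next
    case False
    then have "p' \<le> p" by simp
    have "overlap p q p' q' = overlap p' q' p q" by (auto simp: overlap_def)
    then show ?thesis
      using expectation_dB_terms_le[OF pq(3,4) \<open>p' \<le> p\<close> pq(2) W Z, of j i] by (auto simp: mult.commute)
  qed
qed

end

section \<open>Elementary stochastic integrals\<close>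

lemma norm_vec_sq: "(norm (x :: real ^ 'n))\<^sup>2 = (\<Sum>i\<in>UNIV. (x $ i)\<^sup>2)"
  unfolding power2_norm_eq_inner inner_vec_def by (simp add: power2_eq_square)

lemma norm_matrix_sq: "(norm (A :: real ^ 'm ^ 'd))\<^sup>2 = (\<Sum>i\<in>UNIV. \<Sum>j\<in>UNIV. (A $ i $ j)\<^sup>2)"
  unfolding power2_norm_eq_inner inner_vec_def by (simp add: power2_eq_square)

lemma norm_add3_sq_le: "(norm (a + b + c))\<^sup>2 \<le> 2 * (norm a)\<^sup>2 + 4 * (norm b)\<^sup>2 + 4 * (norm c)\<^sup>2"
proof -
  have "norm (a + b + c) \<le> norm a + norm b + norm c"
    by (meson norm_triangle_ineq add_right_mono order_trans)
  then have "(norm (a + b + c))\<^sup>2 \<le> (norm a + norm b + norm c)\<^sup>2" by (intro power_mono) auto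
  also have "\<dots> \<le> 2 * (norm a)\<^sup>2 + 2 * (norm b + norm c)\<^sup>2"
    using sum_squares_bound[of "norm a" "norm b + norm c"] by (simp add: power2_sum[of "norm a" "norm b + norm c"] add.assoc)
  also have "(norm b + norm c)\<^sup>2 \<le> 2 * (norm b)\<^sup>2 + 2 * (norm c)\<^sup>2"
    using sum_squares_bound[of "norm b" "norm c"] by (simp add: power2_sum)
  finally show ?thesis by simp
qed

lemma norm_add_sq_le: "(norm (a + b))\<^sup>2 \<le> 2 * (norm a)\<^sup>2 + 2 * (norm b)\<^sup>2"
proof -
  have "(norm (a + b))\<^sup>2 \<le> (norm a + norm b)\<^sup>2" by (intro power_mono norm_triangle_ineq) auto
  also have "\<dots> \<le> 2 * (norm a)\<^sup>2 + 2 * (norm b)\<^sup>2"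
    using sum_squares_bound[of "norm a" "norm b"] by (simp add: power2_sum)
  finally show ?thesis .
qed

text \<open>The projection of the real line onto \<open>[s, t]\<close>.\<close>

definition clip :: "real \<Rightarrow> real \<Rightarrow> real \<Rightarrow> real" where
  "clip s t x = max s (min t x)"

context brownian_space
begin

text \<open>Elementary integrands differ from simple integrands in two ways. The coefficients are only square
  integrable, since those of the Euler--Maruyama process are unbounded. The intervals are indexed by any
  finite set and may overlap, so that the difference of two elementary integrands on different partitions
  is again elementary, with the disjoint union as index set.\<close>

definition elementary ::
    "'k set \<Rightarrow> ('k \<Rightarrow> real) \<Rightarrow> ('k \<Rightarrow> real) \<Rightarrow> ('k \<Rightarrow> 'a \<Rightarrow> real ^ 'm ^ 'd) \<Rightarrow> bool" where
  "elementary K p q \<xi> \<longleftrightarrow> finite K \<and>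
     (\<forall>k\<in>K. 0 \<le> p k \<and> p k \<le> q k \<and> \<xi> k \<in> borel_measurable (F (p k)) \<and>
        integrable M (\<lambda>\<omega>. (norm (\<xi> k \<omega>))\<^sup>2))"

definition elem_process ::
    "'k set \<Rightarrow> ('k \<Rightarrow> real) \<Rightarrow> ('k \<Rightarrow> real) \<Rightarrow> ('k \<Rightarrow> 'a \<Rightarrow> real ^ 'm ^ 'd) \<Rightarrow> real \<Rightarrow> 'a \<Rightarrow> real ^ 'm ^ 'd" where
  "elem_process K p q \<xi> t \<omega> = (\<Sum>k\<in>K. indicat_real {p k<..q k} t *\<^sub>R \<xi> k \<omega>)"

definition elem_integral ::
    "'k set \<Rightarrow> ('k \<Rightarrow> real) \<Rightarrow> ('k \<Rightarrow> real) \<Rightarrow> ('k \<Rightarrow> 'a \<Rightarrow> real ^ 'm ^ 'd) \<Rightarrow> real \<Rightarrow> 'a \<Rightarrow> real ^ 'd" where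
  "elem_integral K p q \<xi> t \<omega> = (\<Sum>k\<in>K. \<xi> k \<omega> *v (B (min t (q k)) \<omega> - B (min t (p k)) \<omega>))"

text \<open>The increment of an integral over \<open>[s, t]\<close> arises by clipping all intervals to \<open>[s, t]\<close>. A
  coefficient whose interval starts at \<open>t\<close> or later multiplies a zero increment; it is replaced by zero so
  that every coefficient is measurable at the clipped starting time (\<open>elementary_coeff\<close>).\<close>

lemma elem_integral_increment:
  assumes "s \<le> t" "elementary K p q \<xi>"
  shows "(elem_integral K p q \<xi> t \<omega> - elem_integral K p q \<xi> s \<omega>) $ i
    = (\<Sum>(k, j)\<in>K \<times> UNIV. (if p k < t then \<xi> k \<omega> $ i $ j else 0) * dB (clip s t (p k)) (clip s t (q k)) j \<omega>)"
proof -
  have B: "B (min t x) \<omega> - B (min s x) \<omega> = B (clip s t x) \<omega> - B s \<omega>" for x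
    using assms by (auto simp: clip_def min_def max_def)
  have "elem_integral K p q \<xi> t \<omega> - elem_integral K p q \<xi> s \<omega>
      = (\<Sum>k\<in>K. \<xi> k \<omega> *v ((B (min t (q k)) \<omega> - B (min t (p k)) \<omega>) - (B (min s (q k)) \<omega> - B (min s (p k)) \<omega>)))"
    by (simp only: elem_integral_def sum_subtractf matrix_vector_mult_diff_distrib)
  also have "\<dots> = (\<Sum>k\<in>K. \<xi> k \<omega> *v (B (clip s t (q k)) \<omega> - B (clip s t (p k)) \<omega>))"
  proof (intro sum.cong refl arg_cong[where f="\<lambda>x. _ *v x"])
    fix k
    show "(B (min t (q k)) \<omega> - B (min t (p k)) \<omega>) - (B (min s (q k)) \<omega> - B (min s (p k)) \<omega>)
       = B (clip s t (q k)) \<omega> - B (clip s t (p k)) \<omega>"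
    proof -
      have "(B (min t (q k)) \<omega> - B (min t (p k)) \<omega>) - (B (min s (q k)) \<omega> - B (min s (p k)) \<omega>)
          = (B (min t (q k)) \<omega> - B (min s (q k)) \<omega>) - (B (min t (p k)) \<omega> - B (min s (p k)) \<omega>)"
        by simp
      then show ?thesis unfolding B by simp
    qed
  qed
  also have "\<dots> $ i = (\<Sum>k\<in>K. \<Sum>j\<in>UNIV. \<xi> k \<omega> $ i $ j * dB (clip s t (p k)) (clip s t (q k)) j \<omega>)"
    by (simp add: matrix_vector_mult_def dB_def)
  also have "\<dots> = (\<Sum>k\<in>K. \<Sum>j\<in>UNIV. (if p k < t then \<xi> k \<omega> $ i $ j else 0) * dB (clip s t (p k)) (clip s t (q k)) j \<omega>)"
  proof (intro sum.cong refl)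
    fix k and j :: 'm assume "k \<in> K"
    then have "clip s t (p k) = clip s t (q k)" if "\<not> p k < t"
      using that assms by (auto simp: elementary_def clip_def)
    then show "\<xi> k \<omega> $ i $ j * dB (clip s t (p k)) (clip s t (q k)) j \<omega>
        = (if p k < t then \<xi> k \<omega> $ i $ j else 0) * dB (clip s t (p k)) (clip s t (q k)) j \<omega>"
      by (auto simp: dB_same)
  qed
  finally show ?thesis by (simp add: sum.cartesian_product)
qed

lemma elem_integral_0: "elementary K p q \<xi> \<Longrightarrow> elem_integral K p q \<xi> 0 \<omega> = 0"
  unfolding elem_integral_def
proof (intro sum.neutral ballI)
  fix k assume "elementary K p q \<xi>" "k \<in> K"
  then have "0 \<le> p k" "0 \<le> q k" by (auto simp: elementary_def)
  then show "\<xi> k \<omega> *v (B (min 0 (q k)) \<omega> - B (min 0 (p k)) \<omega>) = 0" by simp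
qed

lemma elementary_coeff:
  assumes "elementary K p q \<xi>" "k \<in> K" "0 \<le> s" "s \<le> t"
  shows "(\<lambda>\<omega>. if p k < t then \<xi> k \<omega> $ i $ j else 0) \<in> borel_measurable (F (clip s t (p k)))"
    "integrable M (\<lambda>\<omega>. (if p k < t then \<xi> k \<omega> $ i $ j else 0)\<^sup>2)"
proof -
  have k: "0 \<le> p k" "p k \<le> q k" "\<xi> k \<in> borel_measurable (F (p k))" "integrable M (\<lambda>\<omega>. (norm (\<xi> k \<omega>))\<^sup>2)"
    using assms by (auto simp: elementary_def)
  have "p k < t \<Longrightarrow> \<xi> k \<in> borel_measurable (F (clip s t (p k)))"
    using k by (intro F_measurable_mono[OF k(3)]) (auto simp: clip_def)
  then show "(\<lambda>\<omega>. if p k < t then \<xi> k \<omega> $ i $ j else 0) \<in> borel_measurable (F (clip s t (p k)))"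
    by (cases "p k < t") auto
  have [measurable]: "\<xi> k \<in> borel_measurable M" using k by (intro F_measurable_M[OF k(3)])
  show "integrable M (\<lambda>\<omega>. (if p k < t then \<xi> k \<omega> $ i $ j else 0)\<^sup>2)"
  proof (rule Bochner_Integration.integrable_bound[OF k(4)])
    have "\<bar>A $ i $ j\<bar> \<le> norm A" for A :: "real ^ 'm ^ 'e" and i j
      using Finite_Cartesian_Product.norm_nth_le[of "A $ i" j] Finite_Cartesian_Product.norm_nth_le[of A i] by simp
    then show "AE \<omega> in M. norm ((if p k < t then \<xi> k \<omega> $ i $ j else 0)\<^sup>2) \<le> norm ((norm (\<xi> k \<omega>))\<^sup>2)"
      by (intro AE_I2) (auto simp: abs_le_square_iff[symmetric])
  qed simp
qed

lemma elementary_clip: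
  assumes "elementary K p q \<xi>" "k \<in> K" "0 \<le> s" "s \<le> t"
  shows "0 \<le> clip s t (p k)" "clip s t (p k) \<le> clip s t (q k)" "s \<le> clip s t (p k)" "clip s t (q k) \<le> t"
  using assms by (auto simp: clip_def elementary_def)

text \<open>Elementary integrals are square integrable martingales, with the martingale property in the form
  required by \<open>doob_L2\<close>.\<close>

lemma elem_integral_increment_L2:
  fixes \<xi> :: "'k \<Rightarrow> 'a \<Rightarrow> real ^ 'm ^ 'd"
  assumes K: "elementary K p q \<xi>" and st: "0 \<le> s" "s \<le> t"
  shows "(\<lambda>\<omega>. (elem_integral K p q \<xi> t \<omega> - elem_integral K p q \<xi> s \<omega>) $ i) \<in> borel_measurable (F t)"
    "integrable M (\<lambda>\<omega>. ((elem_integral K p q \<xi> t \<omega> - elem_integral K p q \<xi> s \<omega>) $ i)\<^sup>2)"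
    "\<And>Z. Z \<in> borel_measurable (F s) \<Longrightarrow> integrable M (\<lambda>\<omega>. (Z \<omega>)\<^sup>2) \<Longrightarrow>
       expectation (\<lambda>\<omega>. Z \<omega> * (elem_integral K p q \<xi> t \<omega> - elem_integral K p q \<xi> s \<omega>) $ i) = 0"
proof -
  let ?c = "clip s t"
  let ?Z = "\<lambda>k j \<omega>. (if p k < t then \<xi> k \<omega> $ i $ j else 0)"
  let ?T = "\<lambda>(k, j) \<omega>. ?Z k j \<omega> * dB (?c (p k)) (?c (q k)) j \<omega>"
  have fin: "finite (K \<times> (UNIV :: 'm set))" using K by (auto simp: elementary_def)
  note coeff = elementary_coeff[OF K _ st, where i=i] and cl = elementary_clip[OF K _ st]
  have T: "?T x \<in> borel_measurable (F t)" "integrable M (\<lambda>\<omega>. (?T x \<omega>)\<^sup>2)" if xK: "x \<in> K \<times> UNIV" for x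
  proof -
    obtain k j where x: "x = (k, j)" "k \<in> K" using xK by auto
    show "?T x \<in> borel_measurable (F t)"
    proof -
      have "?T x \<in> borel_measurable (F (?c (q k)))"
        unfolding x using coeff[OF x(2), where j=j] cl[OF x(2)] by (auto intro!: dB_term_L2(2))
      then show ?thesis
        using cl[OF x(2)] by (intro F_measurable_mono[of _ "?c (q k)" t]) auto
    qed
    show "integrable M (\<lambda>\<omega>. (?T x \<omega>)\<^sup>2)"
      unfolding x using coeff[OF x(2), where j=j] cl[OF x(2)] by (auto intro!: dB_term_L2(1))
  qed
  have TM: "?T x \<in> borel_measurable M" if "x \<in> K \<times> UNIV" for x
    using T(1)[OF that] st by (intro F_measurable_M[of _ t]) auto
  have eq: "(elem_integral K p q \<xi> t \<omega> - elem_integral K p q \<xi> s \<omega>) $ i = (\<Sum>x\<in>K \<times> UNIV. ?T x \<omega>)" for \<omega>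
    unfolding elem_integral_increment[OF st(2) K] by (intro sum.cong) auto
  show "(\<lambda>\<omega>. (elem_integral K p q \<xi> t \<omega> - elem_integral K p q \<xi> s \<omega>) $ i) \<in> borel_measurable (F t)"
    unfolding eq using T by (intro borel_measurable_sum) blast
  show "integrable M (\<lambda>\<omega>. ((elem_integral K p q \<xi> t \<omega> - elem_integral K p q \<xi> s \<omega>) $ i)\<^sup>2)"
    unfolding eq using fin T TM by (intro integrable_square_sum) blast+
  fix Z :: "'a \<Rightarrow> real" assume Z: "Z \<in> borel_measurable (F s)" "integrable M (\<lambda>\<omega>. (Z \<omega>)\<^sup>2)"
  have ZM: "Z \<in> borel_measurable M" using Z(1) st by (intro F_measurable_M[of _ s]) auto
  have "expectation (\<lambda>\<omega>. Z \<omega> * (elem_integral K p q \<xi> t \<omega> - elem_integral K p q \<xi> s \<omega>) $ i)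
      = expectation (\<lambda>\<omega>. \<Sum>x\<in>K \<times> UNIV. Z \<omega> * ?T x \<omega>)"
    unfolding eq by (simp add: sum_distrib_left)
  also have "\<dots> = (\<Sum>x\<in>K \<times> UNIV. expectation (\<lambda>\<omega>. Z \<omega> * ?T x \<omega>))"
    using T TM Z ZM by (intro Bochner_Integration.integral_sum integrable_mult_of_squares) blast+
  also have "\<dots> = 0"
  proof (intro sum.neutral ballI)
    fix x :: "'k \<times> 'm" assume "x \<in> K \<times> UNIV"
    then obtain k j where x: "x = (k, j)" "k \<in> K" by auto
    note c = coeff[OF x(2), where j=j]
    note cl' = cl[OF x(2)]
    have ZcM: "?Z k j \<in> borel_measurable M" using cl' by (intro F_measurable_M[OF c(1)])
    have "expectation (\<lambda>\<omega>. (Z \<omega> * ?Z k j \<omega>) * dB (?c (p k)) (?c (q k)) j \<omega>) = 0"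
    proof (rule expectation_mult_dB)
      show "(\<lambda>\<omega>. Z \<omega> * ?Z k j \<omega>) \<in> borel_measurable (F (?c (p k)))"
        using c F_measurable_mono[OF Z(1) st(1) cl'(3)] by (intro borel_measurable_times)
      show "integrable M (\<lambda>\<omega>. Z \<omega> * ?Z k j \<omega>)"
        using Z ZM ZcM c by (intro integrable_mult_of_squares)
    qed (use cl' in auto)
    then show "expectation (\<lambda>\<omega>. Z \<omega> * ?T x \<omega>) = 0" unfolding x by (simp add: mult.assoc)
  qed
  finally show "expectation (\<lambda>\<omega>. Z \<omega> * (elem_integral K p q \<xi> t \<omega> - elem_integral K p q \<xi> s \<omega>) $ i) = 0" .
qed

text \<open>Expand both sides into sums over pairs of intervals and over the matrix entries. On the left the
  expectation of each product is given by \<open>expectation_dB_terms\<close>; on the right the integral of the product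
  of two indicators is the same overlap. Only equal columns survive because different coordinates of \<open>B\<close> are
  uncorrelated.\<close>

lemma elem_integral_isometry:
  fixes \<xi> :: "'k \<Rightarrow> 'a \<Rightarrow> real ^ 'm ^ 'd"
  assumes K: "elementary K p q \<xi>" and st: "0 \<le> s" "s \<le> t"
  shows "(\<integral>\<^sup>+\<omega>. sqn (elem_integral K p q \<xi> t \<omega> - elem_integral K p q \<xi> s \<omega>) \<partial>M)
       = (\<integral>\<^sup>+\<omega>. (\<integral>\<^sup>+r\<in>{s<..t}. sqn (elem_process K p q \<xi> r \<omega>) \<partial>lborel) \<partial>M)"
proof -
  let ?c = "clip s t"
  let ?Z = "\<lambda>k i j \<omega>. (if p k < t then \<xi> k \<omega> $ i $ j else 0)"
  let ?J = "\<lambda>\<omega>. elem_integral K p q \<xi> t \<omega> - elem_integral K p q \<xi> s \<omega>"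
  let ?ov = "\<lambda>k l. overlap (?c (p k)) (?c (q k)) (?c (p l)) (?c (q l))"
  let ?Q = "\<lambda>\<omega>. \<Sum>i\<in>UNIV. \<Sum>j\<in>UNIV. \<Sum>k\<in>K. \<Sum>l\<in>K. ?Z k i j \<omega> * ?Z l i j \<omega> * ?ov k l"
  have fin: "finite K" using K by (auto simp: elementary_def)
  note coeff = elementary_coeff[OF K _ st] and cl = elementary_clip[OF K _ st]
  have ZM: "?Z k i j \<in> borel_measurable M" if "k \<in> K" for k i j
    using cl[OF that] by (intro F_measurable_M[OF coeff(1)[OF that]])
  have ZZ: "integrable M (\<lambda>\<omega>. ?Z k i j \<omega> * ?Z l i j \<omega>)" if "k \<in> K" "l \<in> K" for k l i j
    using coeff(2)[OF that(1)] coeff(2)[OF that(2)] ZM that by (intro integrable_mult_of_squares)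
  have Qint: "integrable M ?Q" using ZZ by (intro Bochner_Integration.integrable_sum integrable_mult_left) auto
  have JM: "integrable M (\<lambda>\<omega>. (?J \<omega> $ i)\<^sup>2)" for i using elem_integral_increment_L2(2)[OF K st] .
  have comp: "expectation (\<lambda>\<omega>. (?J \<omega> $ i)\<^sup>2) = expectation (\<lambda>\<omega>. \<Sum>j\<in>UNIV. \<Sum>k\<in>K. \<Sum>l\<in>K. ?Z k i j \<omega> * ?Z l i j \<omega> * ?ov k l)" for i
  proof -
    let ?T = "\<lambda>k j \<omega>. ?Z k i j \<omega> * dB (?c (p k)) (?c (q k)) j \<omega>"
    have TT: "integrable M (\<lambda>\<omega>. ?T k j \<omega> * ?T l j' \<omega>)"
        "expectation (\<lambda>\<omega>. ?T k j \<omega> * ?T l j' \<omega>) = (if j = j' then expectation (\<lambda>\<omega>. ?Z k i j \<omega> * ?Z l i j' \<omega>) * ?ov k l else 0)"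
      if "k \<in> K" "l \<in> K" for k l j j'
      using coeff[OF that(1), of i j] coeff[OF that(2), of i j'] cl[OF that(1)] cl[OF that(2)]
      by (intro expectation_dB_terms; simp)+
    have sq: "(?J \<omega> $ i)\<^sup>2 = (\<Sum>k\<in>K. \<Sum>j\<in>UNIV. \<Sum>l\<in>K. \<Sum>j'\<in>UNIV. ?T k j \<omega> * ?T l j' \<omega>)" for \<omega>
      unfolding elem_integral_increment[OF st(2) K] sum.cartesian_product[symmetric]
      by (simp only: power2_eq_square sum_distrib_left sum_distrib_right prod.case)
        (intro sum.cong refl mult.commute)
    have "expectation (\<lambda>\<omega>. (?J \<omega> $ i)\<^sup>2)
        = (\<Sum>k\<in>K. \<Sum>j\<in>UNIV. \<Sum>l\<in>K. \<Sum>j'\<in>UNIV. expectation (\<lambda>\<omega>. ?T k j \<omega> * ?T l j' \<omega>))"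
      unfolding sq using TT(1) by (simp add: Bochner_Integration.integral_sum Bochner_Integration.integrable_sum)
    also have "\<dots> = (\<Sum>k\<in>K. \<Sum>j\<in>UNIV. \<Sum>l\<in>K. \<Sum>j'\<in>UNIV. if j = j' then expectation (\<lambda>\<omega>. ?Z k i j \<omega> * ?Z l i j' \<omega>) * ?ov k l else 0)"
      using TT(2) by (intro sum.cong refl) blast
    also have "\<dots> = (\<Sum>k\<in>K. \<Sum>j\<in>UNIV. \<Sum>l\<in>K. expectation (\<lambda>\<omega>. ?Z k i j \<omega> * ?Z l i j \<omega>) * ?ov k l)"
      by (simp only: sum.delta' finite_class.finite_UNIV UNIV_I if_True)
    also have "\<dots> = (\<Sum>j\<in>UNIV. \<Sum>k\<in>K. \<Sum>l\<in>K. expectation (\<lambda>\<omega>. ?Z k i j \<omega> * ?Z l i j \<omega>) * ?ov k l)"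
      by (rule sum.swap)
    also have "\<dots> = (\<Sum>j\<in>UNIV. \<Sum>k\<in>K. \<Sum>l\<in>K. expectation (\<lambda>\<omega>. ?Z k i j \<omega> * ?Z l i j \<omega> * ?ov k l))"
      by (simp only: integral_mult_left_zero)
    also have "\<dots> = expectation (\<lambda>\<omega>. \<Sum>j\<in>UNIV. \<Sum>k\<in>K. \<Sum>l\<in>K. ?Z k i j \<omega> * ?Z l i j \<omega> * ?ov k l)"
      using ZZ by (simp add: Bochner_Integration.integral_sum Bochner_Integration.integrable_sum)
    finally show ?thesis .
  qed
  have "expectation (\<lambda>\<omega>. (norm (?J \<omega>))\<^sup>2) = (\<Sum>i\<in>UNIV. expectation (\<lambda>\<omega>. (?J \<omega> $ i)\<^sup>2))"
    unfolding norm_vec_sq using JM by (intro Bochner_Integration.integral_sum)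
  also have "\<dots> = expectation ?Q"
    unfolding comp using ZZ by (subst Bochner_Integration.integral_sum) (auto intro!: Bochner_Integration.integrable_sum integrable_mult_left)
  finally have EJ: "expectation (\<lambda>\<omega>. (norm (?J \<omega>))\<^sup>2) = expectation ?Q" .
  have inner: "(\<integral>\<^sup>+r\<in>{s<..t}. sqn (elem_process K p q \<xi> r \<omega>) \<partial>lborel) = ennreal (?Q \<omega>)"
    "0 \<le> ?Q \<omega>" for \<omega>
  proof -
    let ?A = "\<lambda>k. {?c (p k)<..?c (q k)}"
    have ind: "indicat_real {s<..t} r * (elem_process K p q \<xi> r \<omega> $ i $ j) = (\<Sum>k\<in>K. indicat_real (?A k) r * ?Z k i j \<omega>)" for r i j
    proof -
      have "indicat_real {s<..t} r * (elem_process K p q \<xi> r \<omega> $ i $ j) = (\<Sum>k\<in>K. indicat_real {s<..t} r * (indicat_real {p k<..q k} r * \<xi> k \<omega> $ i $ j))"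
        by (simp add: elem_process_def sum_distrib_left)
      also have "\<dots> = (\<Sum>k\<in>K. indicat_real (?A k) r * ?Z k i j \<omega>)"
      proof (intro sum.cong refl)
        fix k
        show "indicat_real {s<..t} r * (indicat_real {p k<..q k} r * \<xi> k \<omega> $ i $ j) = indicat_real (?A k) r * ?Z k i j \<omega>"
          using st by (auto simp: clip_def indicator_def)
      qed
      finally show ?thesis .
    qed
    have sq: "(norm (elem_process K p q \<xi> r \<omega>))\<^sup>2 * indicat_real {s<..t} r
        = (\<Sum>i\<in>UNIV. \<Sum>j\<in>UNIV. \<Sum>k\<in>K. \<Sum>l\<in>K. ?Z k i j \<omega> * ?Z l i j \<omega> * indicat_real (?A k \<inter> ?A l) r)" for r
    proof -
      have "(norm (elem_process K p q \<xi> r \<omega>))\<^sup>2 * indicat_real {s<..t} r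
         = (\<Sum>i\<in>UNIV. \<Sum>j\<in>UNIV. (indicat_real {s<..t} r * (elem_process K p q \<xi> r \<omega> $ i $ j))\<^sup>2)"
        unfolding norm_matrix_sq by (simp add: indicator_def)
      also have "\<dots> = (\<Sum>i\<in>UNIV. \<Sum>j\<in>UNIV. \<Sum>k\<in>K. \<Sum>l\<in>K. (indicat_real (?A k) r * ?Z k i j \<omega>) * (indicat_real (?A l) r * ?Z l i j \<omega>))"
        unfolding ind by (simp only: power2_eq_square sum_distrib_left sum_distrib_right)
          (intro sum.cong refl mult.commute)
      also have "\<dots> = (\<Sum>i\<in>UNIV. \<Sum>j\<in>UNIV. \<Sum>k\<in>K. \<Sum>l\<in>K. ?Z k i j \<omega> * ?Z l i j \<omega> * indicat_real (?A k \<inter> ?A l) r)"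
        by (intro sum.cong refl) (simp only: indicator_inter_arith ac_simps)
      finally show ?thesis .
    qed
    have ov: "has_bochner_integral lborel (indicat_real (?A k \<inter> ?A l)) (?ov k l)" for k l
    proof -
      have eq: "?A k \<inter> ?A l = {max (?c (p k)) (?c (p l))<..min (?c (q k)) (?c (q l))}" by auto
      have "measure lborel (?A k \<inter> ?A l) = ?ov k l"
        unfolding eq by (cases "max (?c (p k)) (?c (p l)) \<le> min (?c (q k)) (?c (q l))") (auto simp: overlap_def)
      moreover have "has_bochner_integral lborel (indicat_real (?A k \<inter> ?A l)) (measure lborel (?A k \<inter> ?A l))"
        unfolding eq by (intro has_bochner_integral_real_indicator)
          (auto intro: le_less_trans[OF emeasure_mono[of _ "{max (?c (p k)) (?c (p l))..min (?c (q k)) (?c (q l))}"]] simp: emeasure_lborel_Icc_eq)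
      ultimately show ?thesis by simp
    qed
    have hb: "has_bochner_integral lborel (\<lambda>r. (norm (elem_process K p q \<xi> r \<omega>))\<^sup>2 * indicat_real {s<..t} r) (?Q \<omega>)"
      unfolding sq using ov by (intro has_bochner_integral_sum has_bochner_integral_mult_right) auto
    have "(\<integral>\<^sup>+r\<in>{s<..t}. sqn (elem_process K p q \<xi> r \<omega>) \<partial>lborel)
        = (\<integral>\<^sup>+r. ennreal ((norm (elem_process K p q \<xi> r \<omega>))\<^sup>2 * indicat_real {s<..t} r) \<partial>lborel)"
      by (intro nn_integral_cong) (auto split: split_indicator)
    also have "\<dots> = ennreal (?Q \<omega>)"
      using hb by (subst nn_integral_eq_integral) (auto simp: has_bochner_integral_iff)
    finally show "(\<integral>\<^sup>+r\<in>{s<..t}. sqn (elem_process K p q \<xi> r \<omega>) \<partial>lborel) = ennreal (?Q \<omega>)" .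
    have "?Q \<omega> = (\<integral>r. (norm (elem_process K p q \<xi> r \<omega>))\<^sup>2 * indicat_real {s<..t} r \<partial>lborel)"
      using hb by (simp add: has_bochner_integral_iff)
    then show "0 \<le> ?Q \<omega>" by simp
  qed
  have "(\<integral>\<^sup>+\<omega>. sqn (?J \<omega>) \<partial>M) = ennreal (expectation (\<lambda>\<omega>. (norm (?J \<omega>))\<^sup>2))"
    using JM by (intro nn_integral_eq_integral) (auto simp: norm_vec_sq intro!: sum_nonneg)
  also have "\<dots> = (\<integral>\<^sup>+\<omega>. ennreal (?Q \<omega>) \<partial>M)"
    unfolding EJ using Qint inner(2) by (intro nn_integral_eq_integral[symmetric]) auto
  finally show ?thesis unfolding inner(1) .
qed

text \<open>Doob's inequality for each coordinate, followed by the isometry at the final time.\<close>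

lemma elem_integral_doob:
  fixes \<xi> :: "'k \<Rightarrow> 'a \<Rightarrow> real ^ 'm ^ 'd"
  assumes K: "elementary K p q \<xi>" and u: "incseq u" and s: "0 \<le> s" "s \<le> u 0"
  shows "(\<integral>\<^sup>+\<omega>. (SUP k\<in>{..n}. sqn (elem_integral K p q \<xi> (u k) \<omega> - elem_integral K p q \<xi> s \<omega>)) \<partial>M)
       \<le> 4 * (\<integral>\<^sup>+\<omega>. (\<integral>\<^sup>+r\<in>{s<..u n}. sqn (elem_process K p q \<xi> r \<omega>) \<partial>lborel) \<partial>M)"
proof -
  let ?N = "\<lambda>i k \<omega>. (elem_integral K p q \<xi> (u k) \<omega> - elem_integral K p q \<xi> s \<omega>) $ i"
  have su: "s \<le> u k" "0 \<le> u k" for k using s incseqD[OF u, of 0 k] by auto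
  note L2 = elem_integral_increment_L2[OF K s(1) su(1)]
  have NM[measurable]: "?N i k \<in> borel_measurable M" for i k using L2(1) su(2) by (rule F_measurable_M)
  have doob: "(\<integral>\<^sup>+\<omega>. (SUP k\<in>{..n}. ennreal ((?N i k \<omega>)\<^sup>2)) \<partial>M) \<le> 4 * (\<integral>\<^sup>+\<omega>. ennreal ((?N i n \<omega>)\<^sup>2) \<partial>M)" for i
  proof (rule doob_L2[where G="\<lambda>k. F (u k)"])
    fix k l and Z :: "'a \<Rightarrow> real"
    show "subalgebra M (F (u k))" using su by (intro F_subalgebra)
    show "?N i k \<in> borel_measurable (F (u k))" by (rule L2(1))
    show "integrable M (\<lambda>\<omega>. (?N i k \<omega>)\<^sup>2)" by (rule L2(2))
    show "sets (F (u k)) \<subseteq> sets (F (u l))" if "k \<le> l" using su incseqD[OF u that] by (intro F_sets_mono)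
    assume "Z \<in> borel_measurable (F (u k))" "integrable M (\<lambda>\<omega>. (Z \<omega>)\<^sup>2)"
    then have "expectation (\<lambda>\<omega>. Z \<omega> * (elem_integral K p q \<xi> (u (Suc k)) \<omega> - elem_integral K p q \<xi> (u k) \<omega>) $ i) = 0"
      using su incseq_SucD[OF u, of k] by (intro elem_integral_increment_L2(3)[OF K])
    then show "expectation (\<lambda>\<omega>. Z \<omega> * (?N i (Suc k) \<omega> - ?N i k \<omega>)) = 0" by simp
  qed
  have "(\<integral>\<^sup>+\<omega>. (SUP k\<in>{..n}. sqn (elem_integral K p q \<xi> (u k) \<omega> - elem_integral K p q \<xi> s \<omega>)) \<partial>M)
      \<le> (\<integral>\<^sup>+\<omega>. (\<Sum>i\<in>UNIV. SUP k\<in>{..n}. ennreal ((?N i k \<omega>)\<^sup>2)) \<partial>M)"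
  proof (intro nn_integral_mono SUP_least)
    fix \<omega> k assume k: "k \<in> {..n}"
    have "sqn (elem_integral K p q \<xi> (u k) \<omega> - elem_integral K p q \<xi> s \<omega>) = (\<Sum>i\<in>UNIV. ennreal ((?N i k \<omega>)\<^sup>2))"
      unfolding norm_vec_sq by (subst sum_ennreal) auto
    also have "\<dots> \<le> (\<Sum>i\<in>UNIV. SUP k\<in>{..n}. ennreal ((?N i k \<omega>)\<^sup>2))"
      using k by (intro sum_mono SUP_upper)
    finally show "sqn (elem_integral K p q \<xi> (u k) \<omega> - elem_integral K p q \<xi> s \<omega>) \<le> \<dots>" .
  qed
  also have "\<dots> = (\<Sum>i\<in>UNIV. \<integral>\<^sup>+\<omega>. (SUP k\<in>{..n}. ennreal ((?N i k \<omega>)\<^sup>2)) \<partial>M)"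
    by (intro nn_integral_sum) measurable
  also have "\<dots> \<le> (\<Sum>i\<in>UNIV. 4 * (\<integral>\<^sup>+\<omega>. ennreal ((?N i n \<omega>)\<^sup>2) \<partial>M))"
    by (intro sum_mono doob)
  also have "\<dots> = 4 * (\<Sum>i\<in>UNIV. (\<integral>\<^sup>+\<omega>. ennreal ((?N i n \<omega>)\<^sup>2) \<partial>M))"
    by (simp add: sum_distrib_left)
  also have "(\<Sum>i\<in>UNIV. (\<integral>\<^sup>+\<omega>. ennreal ((?N i n \<omega>)\<^sup>2) \<partial>M)) = (\<integral>\<^sup>+\<omega>. (\<Sum>i\<in>UNIV. ennreal ((?N i n \<omega>)\<^sup>2)) \<partial>M)"
    by (intro nn_integral_sum[symmetric]) measurable
  also have "\<dots> = (\<integral>\<^sup>+\<omega>. sqn (elem_integral K p q \<xi> (u n) \<omega> - elem_integral K p q \<xi> s \<omega>) \<partial>M)"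
    unfolding norm_vec_sq by (subst sum_ennreal) auto
  also have "\<dots> = (\<integral>\<^sup>+\<omega>. (\<integral>\<^sup>+r\<in>{s<..u n}. sqn (elem_process K p q \<xi> r \<omega>) \<partial>lborel) \<partial>M)"
    using su s by (intro elem_integral_isometry K)
  finally show ?thesis .
qed

end

section \<open>Maximal estimates for Ito integrals\<close>

text \<open>A bound on maxima over equidistant grids carries over to the whole interval: by continuity the value
  at \<open>u\<close> is the limit of the values at grid points next to \<open>u\<close>, hence it is at most the limit inferior \<open>W\<close> of
  the maxima, and Fatou's lemma bounds the expectation of \<open>W\<close>. The conclusion is stated
  with the measurable majorant \<open>W\<close> in place of the supremum, which depends on uncountably many
  times and on the exceptional paths.\<close>

lemma grid_sup_dominated:
  fixes Y :: "real \<Rightarrow> 'a \<Rightarrow> 'b :: euclidean_space"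
  assumes meas: "\<And>u. s \<le> u \<Longrightarrow> u \<le> T \<Longrightarrow> Y u \<in> borel_measurable M"
    and cont: "AE \<omega> in M. continuous_on {s..T} (\<lambda>u. Y u \<omega>)" and "s \<le> T"
    and bound: "\<And>n. (\<integral>\<^sup>+\<omega>. (SUP k\<in>{..Suc n}. sqn (Y (s + (T - s) * (real k / real (Suc n))) \<omega>)) \<partial>M) \<le> c"
  obtains W :: "'a \<Rightarrow> ennreal" where "W \<in> borel_measurable M"
    "AE \<omega> in M. \<forall>u\<in>{s..T}. sqn (Y u \<omega>) \<le> W \<omega>" "(\<integral>\<^sup>+\<omega>. W \<omega> \<partial>M) \<le> c"
proof -
  let ?g = "\<lambda>n k. s + (T - s) * (real k / real (Suc n))"
  have g: "s \<le> ?g n k" "?g n k \<le> T" if "k \<le> Suc n" for n k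
  proof -
    have "real k / real (Suc n) \<le> 1" using that by simp
    then show "s \<le> ?g n k" "?g n k \<le> T"
      using \<open>s \<le> T\<close> mult_left_mono[of "real k / real (Suc n)" 1 "T - s"] by auto
  qed
  define V where "V n \<omega> = (SUP k\<in>{..Suc n}. sqn (Y (?g n k) \<omega>))" for n \<omega>
  define W where "W \<omega> = liminf (\<lambda>n. V n \<omega>)" for \<omega>
  have VM[measurable]: "V n \<in> borel_measurable M" for n
  proof -
    have "(\<lambda>\<omega>. sqn (Y (?g n k) \<omega>)) \<in> borel_measurable M" if "k \<le> Suc n" for k
      using meas[OF g[OF that]] by measurable
    then show ?thesis
      unfolding V_def[abs_def] by (intro borel_measurable_SUP) (auto intro: countable_finite)
  qed
  show ?thesis
  proof
    show "W \<in> borel_measurable M" unfolding W_def[abs_def] by measurable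
    have "(\<integral>\<^sup>+\<omega>. W \<omega> \<partial>M) \<le> liminf (\<lambda>n. \<integral>\<^sup>+\<omega>. V n \<omega> \<partial>M)"
      unfolding W_def by (intro nn_integral_liminf) measurable
    also have "\<dots> \<le> liminf (\<lambda>n. c)"
      using bound unfolding V_def by (intro Liminf_mono) auto
    finally show "(\<integral>\<^sup>+\<omega>. W \<omega> \<partial>M) \<le> c" by (simp add: Liminf_const)
    show "AE \<omega> in M. \<forall>u\<in>{s..T}. sqn (Y u \<omega>) \<le> W \<omega>"
      using cont
    proof (eventually_elim, intro ballI)
      fix \<omega> u assume c: "continuous_on {s..T} (\<lambda>u. Y u \<omega>)" and u: "u \<in> {s..T}"
      define x where "x = (u - s) / (T - s)"
      have x: "0 \<le> x" "x \<le> 1" "u = s + (T - s) * x" using u by (auto simp: x_def divide_le_eq_1)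
      \<comment> \<open>\<open>x\<close> is the relative position of \<open>u\<close>, and \<open>k n\<close> the index of the grid point below \<open>u\<close>\<close>
      define k where "k n = nat \<lfloor>x * real (Suc n)\<rfloor>" for n
      have k: "k n \<le> Suc n" for n
      proof -
        have "x * real (Suc n) \<le> 1 * real (Suc n)" using x by (intro mult_right_mono) auto
        then have "\<lfloor>x * real (Suc n)\<rfloor> \<le> \<lfloor>real (Suc n)\<rfloor>" by (intro floor_mono) simp
        then show ?thesis unfolding k_def by (simp add: nat_le_iff del: of_nat_Suc)
      qed
      have k2: "real (k n) \<le> x * real (Suc n)" "x * real (Suc n) - 1 \<le> real (k n)" for n
        using x unfolding k_def by auto
      have "(\<lambda>n. real (k n) / real (Suc n)) \<longlonglongrightarrow> x"
      proof (rule tendsto_sandwich)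
        show "(\<lambda>n. x - 1 / real (Suc n)) \<longlonglongrightarrow> x"
          using tendsto_diff[OF tendsto_const LIMSEQ_inverse_real_of_nat, of x] by (simp add: inverse_eq_divide)
        show "\<forall>\<^sub>F n in sequentially. x - 1 / real (Suc n) \<le> real (k n) / real (Suc n)"
          using k2(2)
          by (intro always_eventually allI) (simp add: pos_le_divide_eq left_diff_distrib del: of_nat_Suc)
        show "\<forall>\<^sub>F n in sequentially. real (k n) / real (Suc n) \<le> x"
          using k2(1) by (intro always_eventually allI) (simp add: pos_divide_le_eq del: of_nat_Suc)
      qed simp
      then have "(\<lambda>n. ?g n (k n)) \<longlonglongrightarrow> u"
        unfolding x(3) by (intro tendsto_intros)
      then have "(\<lambda>n. Y (?g n (k n)) \<omega>) \<longlonglongrightarrow> Y u \<omega>"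
        using u g[OF k] by (intro continuous_on_tendsto_compose[OF c]) auto
      then have lim: "(\<lambda>n. sqn (Y (?g n (k n)) \<omega>)) \<longlonglongrightarrow> sqn (Y u \<omega>)"
        by (intro tendsto_intros tendsto_ennrealI)
      have "sqn (Y u \<omega>) = liminf (\<lambda>n. sqn (Y (?g n (k n)) \<omega>))"
        using lim by (intro lim_imp_Liminf[symmetric]) auto
      also have "\<dots> \<le> W \<omega>"
        unfolding W_def V_def using k by (intro Liminf_mono always_eventually allI SUP_upper) auto
      finally show "sqn (Y u \<omega>) \<le> W \<omega>" .
    qed
  qed
qed

context brownian_space
begin

lemma simple_elementary:
  assumes "simple_integrand M F N p \<xi>"
  shows "elementary {..<N} p (\<lambda>k. p (Suc k)) \<xi>"
proof -
  have step: "p k \<le> p (Suc k)" "\<xi> k \<in> borel_measurable (F (p k))" "bounded (\<xi> k ` space M)" if "k < N" for k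
    using assms that by (auto simp: simple_integrand_def)
  have p0: "k \<le> N \<Longrightarrow> 0 \<le> p k" for k
  proof (induction k)
    case 0 then show ?case using assms by (simp add: simple_integrand_def)
  next
    case (Suc k) then show ?case using step(1)[of k] by simp
  qed
  have "integrable M (\<lambda>\<omega>. (norm (\<xi> k \<omega>))\<^sup>2)" if kN: "k < N" for k
  proof -
    obtain b where b: "\<And>\<omega>. \<omega> \<in> space M \<Longrightarrow> norm (\<xi> k \<omega>) \<le> b"
      using step(3)[OF kN] unfolding bounded_iff by auto
    have [measurable]: "\<xi> k \<in> borel_measurable M"
      using step(2)[OF kN] p0[of k] kN by (intro F_measurable_M) auto
    show ?thesis
      using b by (intro integrable_const_bound[of _ "b\<^sup>2"] AE_I2) (auto intro!: power_mono)
  qed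
  then show ?thesis using step p0 by (auto simp: elementary_def)
qed

lemma simple_process_elem: "simple_process N p \<xi> = elem_process {..<N} p (\<lambda>k. p (Suc k)) \<xi>"
  by (intro ext) (simp add: simple_process_def elem_process_def)

lemma simple_ito_integral_elem: "simple_ito_integral B N p \<xi> = elem_integral {..<N} p (\<lambda>k. p (Suc k)) \<xi>"
  by (intro ext) (simp add: simple_ito_integral_def elem_integral_def)

text \<open>Negated coefficients on the second summand of the disjoint union express the difference.\<close>

lemma elementary_diff:
  assumes "elementary K p q \<xi>" "elementary K' p' q' \<xi>'"
  defines "P \<equiv> case_sum p p'" and "Q \<equiv> case_sum q q'" and "\<Xi> \<equiv> case_sum \<xi> (\<lambda>k \<omega>. - \<xi>' k \<omega>)"
  shows "elementary (K <+> K') P Q \<Xi>"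
    "elem_process (K <+> K') P Q \<Xi> t \<omega> = elem_process K p q \<xi> t \<omega> - elem_process K' p' q' \<xi>' t \<omega>"
    "elem_integral (K <+> K') P Q \<Xi> t \<omega> = elem_integral K p q \<xi> t \<omega> - elem_integral K' p' q' \<xi>' t \<omega>"
proof -
  have fin: "finite K" "finite K'" using assms by (auto simp: elementary_def)
  show "elementary (K <+> K') P Q \<Xi>"
    using assms(1,2) unfolding elementary_def P_def Q_def \<Xi>_def by (auto simp: Plus_def)
  have neg: "(- A) *v x = - (A *v x)" for A :: "real ^ 'n ^ 'e" and x
    by (simp add: matrix_vector_mult_def vec_eq_iff sum_negf)
  show "elem_process (K <+> K') P Q \<Xi> t \<omega> = elem_process K p q \<xi> t \<omega> - elem_process K' p' q' \<xi>' t \<omega>"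
    unfolding elem_process_def sum.Plus[OF fin] P_def Q_def \<Xi>_def by (simp add: sum_negf)
  show "elem_integral (K <+> K') P Q \<Xi> t \<omega> = elem_integral K p q \<xi> t \<omega> - elem_integral K' p' q' \<xi>' t \<omega>"
    unfolding elem_integral_def sum.Plus[OF fin] P_def Q_def \<Xi>_def by (simp add: sum_negf neg)
qed

lemma elem_process_joint_measurable:
  assumes "elementary K p q \<xi>"
  shows "(\<lambda>(r, \<omega>). elem_process K p q \<xi> r \<omega>) \<in> borel_measurable (borel \<Otimes>\<^sub>M M)"
proof -
  have [measurable]: "\<xi> k \<in> borel_measurable M" if "k \<in> K" for k
    using assms that by (auto simp: elementary_def intro: F_measurable_M)
  show ?thesis
    unfolding elem_process_def[abs_def] split_def by measurable
qed

lemma elem_integral_measurable: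
  assumes K: "elementary K p q \<xi>" and t: "0 \<le> t"
  shows "elem_integral K p q \<xi> t \<in> borel_measurable M"
proof -
  have "(\<lambda>\<omega>. elem_integral K p q \<xi> t \<omega> $ i) \<in> borel_measurable M" for i
    using elem_integral_increment_L2(1)[OF K order_refl t, of i] elem_integral_0[OF K] t
    by (auto intro: F_measurable_M)
  then show ?thesis by (rule borel_measurable_vecI)
qed

lemma elem_integral_continuous:
  assumes K: "elementary K p q \<xi>"
  shows "AE \<omega> in M. continuous_on {0..} (\<lambda>t. elem_integral K p q \<xi> t \<omega>)"
  using B_continuous
proof eventually_elim
  fix \<omega> assume B: "continuous_on {0..} (\<lambda>t. B t \<omega>)"
  have "continuous_on {0..} (\<lambda>t. B (min t x) \<omega>)" if "0 \<le> x" for x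
    using that by (intro continuous_on_compose2[OF B]) (auto intro!: continuous_intros)
  then show "continuous_on {0..} (\<lambda>t. elem_integral K p q \<xi> t \<omega>)"
    unfolding elem_integral_def using K
    by (intro continuous_on_sum continuous_on_compose2[OF matrix_vector_mult_linear_continuous_on[of UNIV]] continuous_on_diff)
       (auto simp: elementary_def intro: order_trans)
qed

text \<open>Progressive measurability concerns times up to \<open>T\<close> only; clipping the time to \<open>[0, T]\<close> gives a process
  that is measurable on the whole line and unchanged on \<open>[0, T]\<close>.\<close>

lemma progressive_joint_measurable:
  assumes H: "progressive_process F H" and T: "0 \<le> T"
  shows "(\<lambda>(r, \<omega>). H (clip 0 T r) \<omega>) \<in> borel_measurable (borel \<Otimes>\<^sub>M M)"
proof -
  have H': "(\<lambda>(s, \<omega>). H s \<omega>) \<in> borel_measurable (restrict_space borel {0..T} \<Otimes>\<^sub>M F T)"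
    using H T by (auto simp: progressive_process_def)
  have id: "(\<lambda>x. x) \<in> measurable M (F T)"
    using F_subalgebra[OF T] by (intro measurableI) (auto simp: subalgebra_def dest: sets.sets_into_space)
  have "(\<lambda>(r, \<omega>). (clip 0 T r, \<omega>)) \<in> measurable (borel \<Otimes>\<^sub>M M) (restrict_space borel {0..T} \<Otimes>\<^sub>M F T)"
    unfolding split_def
  proof (intro measurable_Pair measurable_restrict_space2)
    show "(\<lambda>x. clip 0 T (fst x)) \<in> space (borel \<Otimes>\<^sub>M M) \<rightarrow> {0..T}" using T by (auto simp: clip_def)
    show "(\<lambda>x. clip 0 T (fst x)) \<in> borel \<Otimes>\<^sub>M M \<rightarrow>\<^sub>M borel" unfolding clip_def by measurable
    show "snd \<in> borel \<Otimes>\<^sub>M M \<rightarrow>\<^sub>M F T" by (rule measurable_compose[OF measurable_snd id])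
  qed
  from measurable_compose[OF this H'] show ?thesis by (simp add: split_def)
qed

definition energy :: "real \<Rightarrow> real \<Rightarrow> (real \<Rightarrow> 'a \<Rightarrow> 'b::real_normed_vector) \<Rightarrow> ennreal" where
  "energy s t H = (\<integral>\<^sup>+\<omega>. (\<integral>\<^sup>+r\<in>{s<..t}. sqn (H r \<omega>) \<partial>lborel) \<partial>M)"

lemma path_energy_measurable:
  fixes H :: "real \<Rightarrow> 'a \<Rightarrow> 'b::euclidean_space"
  assumes "(\<lambda>(r, \<omega>). H r \<omega>) \<in> borel_measurable (borel \<Otimes>\<^sub>M M)"
  shows "(\<lambda>\<omega>. \<integral>\<^sup>+r\<in>{s<..t}. sqn (H r \<omega>) \<partial>lborel) \<in> borel_measurable M"
    "\<omega> \<in> space M \<Longrightarrow> (\<lambda>r. sqn (H r \<omega>) * indicator {s<..t} r) \<in> borel_measurable lborel"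
proof -
  have *: "(\<lambda>x. H (snd x) (fst x)) \<in> borel_measurable (M \<Otimes>\<^sub>M lborel)"
    using measurable_compose[OF measurable_pair_swap' assms] 
    by (simp add: split_def cong: measurable_cong_sets) 
  have "(\<lambda>x. sqn (H (snd x) (fst x)) * indicator {s<..t} (snd x)) \<in> borel_measurable (M \<Otimes>\<^sub>M lborel)"
    using * by measurable
  from lborel.borel_measurable_nn_integral_fst[OF this]
  show "(\<lambda>\<omega>. \<integral>\<^sup>+r\<in>{s<..t}. sqn (H r \<omega>) \<partial>lborel) \<in> borel_measurable M" by simp
  assume "\<omega> \<in> space M"
  then have "(\<lambda>r. H r \<omega>) \<in> borel_measurable lborel"
    using measurable_compose[OF measurable_Pair1' *] by (simp add: comp_def)
  then show "(\<lambda>r. sqn (H r \<omega>) * indicator {s<..t} r) \<in> borel_measurable lborel"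
    by measurable
qed

lemma energy_add_le:
  fixes f g :: "real \<Rightarrow> 'a \<Rightarrow> 'b::euclidean_space"
  assumes f: "(\<lambda>(r, \<omega>). f r \<omega>) \<in> borel_measurable (borel \<Otimes>\<^sub>M M)"
    and g: "(\<lambda>(r, \<omega>). g r \<omega>) \<in> borel_measurable (borel \<Otimes>\<^sub>M M)"
  shows "energy s t (\<lambda>r \<omega>. f r \<omega> + g r \<omega>) \<le> 2 * energy s t f + 2 * energy s t g"
proof -
  note mf = path_energy_measurable[OF f] and mg = path_energy_measurable[OF g]
  have "energy s t (\<lambda>r \<omega>. f r \<omega> + g r \<omega>)
      \<le> (\<integral>\<^sup>+\<omega>. 2 * (\<integral>\<^sup>+r\<in>{s<..t}. sqn (f r \<omega>) \<partial>lborel)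
             + 2 * (\<integral>\<^sup>+r\<in>{s<..t}. sqn (g r \<omega>) \<partial>lborel) \<partial>M)"
    unfolding energy_def
  proof (intro nn_integral_mono)
    fix \<omega> assume \<omega>: "\<omega> \<in> space M"
    have "(\<integral>\<^sup>+r\<in>{s<..t}. sqn (f r \<omega> + g r \<omega>) \<partial>lborel)
        \<le> (\<integral>\<^sup>+r. 2 * (sqn (f r \<omega>) * indicator {s<..t} r) + 2 * (sqn (g r \<omega>) * indicator {s<..t} r) \<partial>lborel)"
    proof (intro nn_integral_mono)
      fix r
      have "sqn (f r \<omega> + g r \<omega>) \<le> ennreal (2 * (norm (f r \<omega>))\<^sup>2 + 2 * (norm (g r \<omega>))\<^sup>2)"
        by (intro ennreal_leI norm_add_sq_le)
      also have "\<dots> = 2 * sqn (f r \<omega>) + 2 * sqn (g r \<omega>)"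
        by (simp add: ennreal_mult)
      finally show "sqn (f r \<omega> + g r \<omega>) * indicator {s<..t} r
         \<le> 2 * (sqn (f r \<omega>) * indicator {s<..t} r) + 2 * (sqn (g r \<omega>) * indicator {s<..t} r)"
        by (auto split: split_indicator)
    qed
    also have "\<dots> = 2 * (\<integral>\<^sup>+r\<in>{s<..t}. sqn (f r \<omega>) \<partial>lborel)
             + 2 * (\<integral>\<^sup>+r\<in>{s<..t}. sqn (g r \<omega>) \<partial>lborel)"
      using mf(2)[OF \<omega>] mg(2)[OF \<omega>] by (subst nn_integral_add) (auto simp: nn_integral_cmult)
    finally show "(\<integral>\<^sup>+r\<in>{s<..t}. sqn (f r \<omega> + g r \<omega>) \<partial>lborel) \<le> \<dots>" .
  qed
  also have "\<dots> = 2 * energy s t f + 2 * energy s t g"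
    unfolding energy_def using mf(1) mg(1) by (subst nn_integral_add) (auto simp: nn_integral_cmult)
  finally show ?thesis .
qed

lemma energy_cong:
  assumes "\<And>r \<omega>. s < r \<Longrightarrow> r \<le> t \<Longrightarrow> \<omega> \<in> space M \<Longrightarrow> norm (f r \<omega>) = norm (g r \<omega>)"
  shows "energy s t f = energy s t g"
  unfolding energy_def using assms by (intro nn_integral_cong) (auto split: split_indicator)

text \<open>With \<open>S\<close> the integral of a simple integrand \<open>R\<close> near \<open>H\<close>, the process \<open>S - J\<close> is an elementary integral,
  to which Doob's inequality applies. The errors \<open>S - I\<close> at the finitely many grid times and \<open>R - H\<close> in
  energy vanish in the limit. The constant \<open>16 = 2 \<cdot> 4 \<cdot> 2\<close> collects the two splittings of squares
  and Doob's constant.\<close>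

lemma ito_L2_grid:
  assumes ito: "ito_integral_L2 M F B H I" and K: "elementary K p q \<xi>"
    and u: "incseq u" and s: "0 \<le> u 0"
  defines "G \<equiv> elem_process K p q \<xi>" and "J \<equiv> elem_integral K p q \<xi>"
  shows "(\<integral>\<^sup>+\<omega>. (SUP k\<in>{..n}. sqn ((I (u k) \<omega> - J (u k) \<omega>) - (I (u 0) \<omega> - J (u 0) \<omega>))) \<partial>M)
       \<le> 16 * energy (u 0) (u n) (\<lambda>r \<omega>. H r \<omega> - G r \<omega>)"
proof -
  obtain N P \<Xi> where simple: "\<And>m. simple_integrand M F (N m) (P m) (\<Xi> m)"
    and H_lim: "\<And>T. 0 \<le> T \<Longrightarrow> (\<lambda>m. \<integral>\<^sup>+\<omega>. (\<integral>\<^sup>+r\<in>{0..T}.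
                   sqn (simple_process (N m) (P m) (\<Xi> m) r \<omega> - H r \<omega>)
                 \<partial>lborel) \<partial>M) \<longlonglongrightarrow> 0"
    and I_lim: "\<And>t. 0 \<le> t \<Longrightarrow> (\<lambda>m. \<integral>\<^sup>+\<omega>.
                   sqn (simple_ito_integral B (N m) (P m) (\<Xi> m) t \<omega> - I t \<omega>)
                 \<partial>M) \<longlonglongrightarrow> 0"
    using ito unfolding ito_integral_L2_def by blast
  have prog: "progressive_process F H" and adI: "adapted_process F I"
    using ito by (auto simp: ito_integral_L2_def)
  let ?T = "u n"
  have su: "u 0 \<le> u k" "0 \<le> u k" for k using s incseqD[OF u, of 0 k] by auto
  have IM[measurable]: "I (u k) \<in> borel_measurable M" for k
    using adI su by (auto simp: adapted_process_def intro!: F_measurable_M[of _ "u k"])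
  define S where "S m = elem_integral {..<N m} (P m) (\<lambda>k. P m (Suc k)) (\<Xi> m)" for m
  define R where "R m = elem_process {..<N m} (P m) (\<lambda>k. P m (Suc k)) (\<Xi> m)" for m
  note el = simple_elementary[OF simple]
  have SM[measurable]: "S m (u k) \<in> borel_measurable M" for m k
    unfolding S_def by (intro elem_integral_measurable[OF el] su)
  have JM[measurable]: "J (u k) \<in> borel_measurable M" for k
    unfolding J_def by (intro elem_integral_measurable[OF K] su)
  let ?X = "\<integral>\<^sup>+\<omega>. (SUP k\<in>{..n}. sqn ((I (u k) \<omega> - J (u k) \<omega>) - (I (u 0) \<omega> - J (u 0) \<omega>))) \<partial>M"
  let ?e = "\<lambda>m k. \<integral>\<^sup>+\<omega>. sqn (S m (u k) \<omega> - I (u k) \<omega>) \<partial>M"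
  let ?a = "\<lambda>m. energy (u 0) ?T (\<lambda>r \<omega>. R m r \<omega> - H r \<omega>)"
  let ?Y = "energy (u 0) ?T (\<lambda>r \<omega>. H r \<omega> - G r \<omega>)"
  have step: "?X \<le> 8 * (2 * ?a m + 2 * ?Y) + 8 * (\<Sum>k\<le>n. ?e m k)" for m
  proof -
    let ?D = "\<lambda>k \<omega>. (S m (u k) \<omega> - J (u k) \<omega>) - (S m (u 0) \<omega> - J (u 0) \<omega>)"
    let ?err = "\<lambda>k \<omega>. sqn (S m (u k) \<omega> - I (u k) \<omega>)"
    have "?X \<le> (\<integral>\<^sup>+\<omega>. 2 * (SUP k\<in>{..n}. sqn (?D k \<omega>)) + 8 * (\<Sum>k\<le>n. ?err k \<omega>) \<partial>M)"
    proof (intro nn_integral_mono SUP_least)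
      fix \<omega> k assume k: "k \<in> {..n}"
      have "(norm ((I (u k) \<omega> - J (u k) \<omega>) - (I (u 0) \<omega> - J (u 0) \<omega>)))\<^sup>2
         = (norm (?D k \<omega> + (I (u k) \<omega> - S m (u k) \<omega>) + (S m (u 0) \<omega> - I (u 0) \<omega>)))\<^sup>2"
        by (simp add: algebra_simps)
      also have "\<dots> \<le> 2 * (norm (?D k \<omega>))\<^sup>2 + 4 * (norm (S m (u k) \<omega> - I (u k) \<omega>))\<^sup>2 + 4 * (norm (S m (u 0) \<omega> - I (u 0) \<omega>))\<^sup>2"
        using norm_add3_sq_le[of "?D k \<omega>" "I (u k) \<omega> - S m (u k) \<omega>" "S m (u 0) \<omega> - I (u 0) \<omega>"]
        by (simp add: norm_minus_commute)
      finally have "sqn ((I (u k) \<omega> - J (u k) \<omega>) - (I (u 0) \<omega> - J (u 0) \<omega>))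
          \<le> ennreal (2 * (norm (?D k \<omega>))\<^sup>2 + 4 * (norm (S m (u k) \<omega> - I (u k) \<omega>))\<^sup>2 + 4 * (norm (S m (u 0) \<omega> - I (u 0) \<omega>))\<^sup>2)"
        by (rule ennreal_leI)
      also have "\<dots> = 2 * sqn (?D k \<omega>) + 4 * ?err k \<omega> + 4 * ?err 0 \<omega>"
        by (simp add: ennreal_mult)
      also have "\<dots> \<le> 2 * (SUP k\<in>{..n}. sqn (?D k \<omega>)) + 4 * (\<Sum>k\<le>n. ?err k \<omega>) + 4 * (\<Sum>k\<le>n. ?err k \<omega>)"
        using k by (intro add_mono mult_left_mono SUP_upper member_le_sum) auto
      also have "\<dots> = 2 * (SUP k\<in>{..n}. sqn (?D k \<omega>)) + 8 * (\<Sum>k\<le>n. ?err k \<omega>)"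
        by (simp add: add.assoc distrib_right[symmetric])
      finally show "sqn ((I (u k) \<omega> - J (u k) \<omega>) - (I (u 0) \<omega> - J (u 0) \<omega>)) \<le> \<dots>" .
    qed
    also have "\<dots> = 2 * (\<integral>\<^sup>+\<omega>. (SUP k\<in>{..n}. sqn (?D k \<omega>)) \<partial>M) + 8 * (\<Sum>k\<le>n. ?e m k)"
      by (subst nn_integral_add, measurable) (simp add: nn_integral_cmult nn_integral_sum del: sum_ennreal)
    also have "(\<integral>\<^sup>+\<omega>. (SUP k\<in>{..n}. sqn (?D k \<omega>)) \<partial>M) \<le> 4 * energy (u 0) ?T (\<lambda>r \<omega>. R m r \<omega> - G r \<omega>)"
      unfolding energy_def R_def G_def S_def J_def elementary_diff(2,3)[OF el K, symmetric]
      by (intro elem_integral_doob elementary_diff el K u s order_refl)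
    also have "energy (u 0) ?T (\<lambda>r \<omega>. R m r \<omega> - G r \<omega>) \<le> 2 * ?a m + 2 * ?Y"
    proof -
      let ?H = "\<lambda>r. H (clip 0 ?T r)"
      note meas = progressive_joint_measurable[OF prog su(2), of n] elem_process_joint_measurable[OF K, folded G_def]
        elem_process_joint_measurable[OF el, of m, folded R_def]
      have cl: "clip 0 ?T r = r" if "u 0 < r" "r \<le> ?T" for r using that s by (auto simp: clip_def)
      have "energy (u 0) ?T (\<lambda>r \<omega>. R m r \<omega> - G r \<omega>) = energy (u 0) ?T (\<lambda>r \<omega>. (R m r \<omega> - ?H r \<omega>) + (?H r \<omega> - G r \<omega>))"
        by simp
      also have "\<dots> \<le> 2 * energy (u 0) ?T (\<lambda>r \<omega>. R m r \<omega> - ?H r \<omega>) + 2 * energy (u 0) ?T (\<lambda>r \<omega>. ?H r \<omega> - G r \<omega>)"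
        using meas by (intro energy_add_le) (auto simp: split_def)
      also have "energy (u 0) ?T (\<lambda>r \<omega>. R m r \<omega> - ?H r \<omega>) = ?a m"
        by (intro energy_cong) (simp add: cl)
      also have "energy (u 0) ?T (\<lambda>r \<omega>. ?H r \<omega> - G r \<omega>) = ?Y"
        by (intro energy_cong) (simp add: cl)
      finally show ?thesis .
    qed
    finally show ?thesis
      by (simp add: add_right_mono mult_left_mono mult.assoc[symmetric])
  qed
  have a_lim: "?a \<longlonglongrightarrow> 0"
  proof (rule tendsto_sandwich[OF _ _ tendsto_const H_lim[OF su(2)[of n]]])
    show "\<forall>\<^sub>F m in sequentially. ?a m \<le> (\<integral>\<^sup>+\<omega>. (\<integral>\<^sup>+r\<in>{0..u n}.
                   sqn (simple_process (N m) (P m) (\<Xi> m) r \<omega> - H r \<omega>) \<partial>lborel) \<partial>M)"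
      unfolding energy_def R_def simple_process_elem using s
      by (intro always_eventually allI nn_integral_mono) (auto split: split_indicator)
  qed simp
  have e_lim: "(\<lambda>m. ?e m k) \<longlonglongrightarrow> 0" for k
    using I_lim[OF su(2)[of k]] unfolding simple_ito_integral_elem S_def .
  have "(\<lambda>m. 8 * (2 * ?a m + 2 * ?Y) + 8 * (\<Sum>k\<le>n. ?e m k)) \<longlonglongrightarrow> 8 * (2 * 0 + 2 * ?Y) + 8 * (\<Sum>k\<le>n. 0)"
    by (intro tendsto_add ennreal_tendsto_cmult tendsto_sum tendsto_const a_lim e_lim) auto
  then have "?X \<le> 8 * (2 * 0 + 2 * ?Y) + 8 * (\<Sum>k\<le>n. 0)"
    by (rule LIMSEQ_le_const) (use step in blast)
  then show ?thesis by (simp add: mult.assoc[symmetric])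
qed


lemma nonneg_stopping_time_measurable:
  assumes "nonneg_stopping_time M F \<tau>"
  shows "\<tau> \<in> borel_measurable M"
proof (rule borel_measurableI_le)
  fix y
  have nn: "\<And>\<omega>. \<omega> \<in> space M \<Longrightarrow> 0 \<le> \<tau> \<omega>" using assms by (auto simp: nonneg_stopping_time_def)
  show "{\<omega> \<in> space M. \<tau> \<omega> \<le> y} \<in> sets M"
  proof (cases "0 \<le> y")
    case True
    then have "Measurable.pred (F y) (\<lambda>\<omega>. \<tau> \<omega> \<le> y)" using assms by (auto simp: nonneg_stopping_time_def)
    then have "{\<omega> \<in> space (F y). \<tau> \<omega> \<le> y} \<in> sets (F y)" by simp
    then show ?thesis using F_subalgebra[OF True] by (auto simp: subalgebra_def)
  next
    case False
    then have "{\<omega> \<in> space M. \<tau> \<omega> \<le> y} = {}" using nn by force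
    then show ?thesis by (simp only: sets.empty_sets)
  qed
qed

text \<open>Up to time \<open>\<tau>\<close> the stopped integrand agrees with \<open>H\<close>, and afterwards it is zero, so that the
  difference to \<open>G\<close> exceeds \<open>H - G\<close> by at most \<open>G\<close>. Charging the excess to \<open>G\<close> rather than to \<open>H\<close> is what
  allows a limit in \<open>\<tau>\<close> without knowing that \<open>H\<close> is square integrable.\<close>

lemma energy_stopped_le:
  fixes H G :: "real \<Rightarrow> 'a \<Rightarrow> 'b::euclidean_space"
  assumes H: "(\<lambda>(r, \<omega>). H r \<omega>) \<in> borel_measurable (borel \<Otimes>\<^sub>M M)"
    and G: "(\<lambda>(r, \<omega>). G r \<omega>) \<in> borel_measurable (borel \<Otimes>\<^sub>M M)"
    and \<tau>: "\<tau> \<in> borel_measurable M" and s: "0 \<le> s"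
  shows "energy s t (\<lambda>r \<omega>. indicat_real {0..\<tau> \<omega>} r *\<^sub>R H r \<omega> - G r \<omega>)
    \<le> energy s t (\<lambda>r \<omega>. H r \<omega> - G r \<omega>)
      + (\<integral>\<^sup>+\<omega>. indicator {\<omega> \<in> space M. \<tau> \<omega> < t} \<omega> * (\<integral>\<^sup>+r\<in>{s<..t}. sqn (G r \<omega>) \<partial>lborel) \<partial>M)"
proof -
  have HG: "(\<lambda>(r, \<omega>). H r \<omega> - G r \<omega>) \<in> borel_measurable (borel \<Otimes>\<^sub>M M)"
    using H G by (simp add: split_def)
  note mHG = path_energy_measurable[OF HG] and mG = path_energy_measurable[OF G]
  let ?e = "\<lambda>\<omega>. \<integral>\<^sup>+r\<in>{s<..t}. sqn (H r \<omega> - G r \<omega>) \<partial>lborel"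
  let ?g = "\<lambda>\<omega>. \<integral>\<^sup>+r\<in>{s<..t}. sqn (G r \<omega>) \<partial>lborel"
  have "energy s t (\<lambda>r \<omega>. indicat_real {0..\<tau> \<omega>} r *\<^sub>R H r \<omega> - G r \<omega>)
     \<le> (\<integral>\<^sup>+\<omega>. ?e \<omega> + indicator {\<omega> \<in> space M. \<tau> \<omega> < t} \<omega> * ?g \<omega> \<partial>M)"
    unfolding energy_def
  proof (intro nn_integral_mono)
    fix \<omega> assume \<omega>: "\<omega> \<in> space M"
    show "(\<integral>\<^sup>+r\<in>{s<..t}. sqn (indicat_real {0..\<tau> \<omega>} r *\<^sub>R H r \<omega> - G r \<omega>) \<partial>lborel)
        \<le> ?e \<omega> + indicator {\<omega> \<in> space M. \<tau> \<omega> < t} \<omega> * ?g \<omega>"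
    proof (cases "\<tau> \<omega> < t")
      case True
      have "(\<integral>\<^sup>+r\<in>{s<..t}. sqn (indicat_real {0..\<tau> \<omega>} r *\<^sub>R H r \<omega> - G r \<omega>) \<partial>lborel)
          \<le> (\<integral>\<^sup>+r. sqn (H r \<omega> - G r \<omega>) * indicator {s<..t} r + sqn (G r \<omega>) * indicator {s<..t} r \<partial>lborel)"
        by (intro nn_integral_mono) (auto split: split_indicator)
      also have "\<dots> = ?e \<omega> + ?g \<omega>"
        using mHG(2)[OF \<omega>] mG(2)[OF \<omega>] by (rule nn_integral_add)
      finally show ?thesis using True \<omega> by simp
    next
      case False
      then have "(\<integral>\<^sup>+r\<in>{s<..t}. sqn (indicat_real {0..\<tau> \<omega>} r *\<^sub>R H r \<omega> - G r \<omega>) \<partial>lborel) = ?e \<omega>"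
        using s by (intro nn_integral_cong) (auto split: split_indicator)
      then show ?thesis by simp
    qed
  qed
  also have "\<dots> = (\<integral>\<^sup>+\<omega>. ?e \<omega> \<partial>M) + (\<integral>\<^sup>+\<omega>. indicator {\<omega> \<in> space M. \<tau> \<omega> < t} \<omega> * ?g \<omega> \<partial>M)"
  proof -
    define e g where "e = ?e" and "g = ?g"
    have [measurable]: "e \<in> borel_measurable M" "g \<in> borel_measurable M"
      using mHG(1) mG(1) by (simp_all add: e_def g_def)
    have [measurable]: "{\<omega> \<in> space M. \<tau> \<omega> < t} \<in> sets M" using \<tau> by simp
    have "(\<lambda>\<omega>. indicator {\<omega> \<in> space M. \<tau> \<omega> < t} \<omega> * g \<omega>) \<in> borel_measurable M" by simp
    then have "(\<integral>\<^sup>+\<omega>. e \<omega> + indicator {\<omega> \<in> space M. \<tau> \<omega> < t} \<omega> * g \<omega> \<partial>M)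
        = (\<integral>\<^sup>+\<omega>. e \<omega> \<partial>M) + (\<integral>\<^sup>+\<omega>. indicator {\<omega> \<in> space M. \<tau> \<omega> < t} \<omega> * g \<omega> \<partial>M)"
      by (intro nn_integral_add) simp
    then show ?thesis by (simp add: e_def g_def)
  qed
  finally show ?thesis by (simp add: energy_def)
qed

lemma elementary_energy_finite:
  assumes K: "elementary K p q \<xi>" and st: "0 \<le> s" "s \<le> t"
  shows "energy s t (elem_process K p q \<xi>) < \<infinity>"
proof -
  have "integrable M (\<lambda>\<omega>. (norm (elem_integral K p q \<xi> t \<omega> - elem_integral K p q \<xi> s \<omega>))\<^sup>2)"
    unfolding norm_vec_sq by (intro Bochner_Integration.integrable_sum elem_integral_increment_L2(2)[OF K st])
  then have "(\<integral>\<^sup>+\<omega>. sqn (elem_integral K p q \<xi> t \<omega> - elem_integral K p q \<xi> s \<omega>) \<partial>M) < \<infinity>"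
    by (subst nn_integral_eq_integral) auto
  then show ?thesis unfolding energy_def elem_integral_isometry[OF K st] .
qed

text \<open>The elementary process \<open>J\<close> is not stopped. The stopped integrals satisfy the bound up to the term of
  \<open>energy_stopped_le\<close>, which tends to zero by dominated convergence because elementary integrands have finite
  energy; the maxima over the grid are eventually those of the unstopped process, and Fatou's lemma applies.\<close>

lemma ito_grid:
  assumes ito: "ito_integral M F B H I" and K: "elementary K p q \<xi>"
    and u: "incseq u" and s: "0 \<le> u 0"
  defines "G \<equiv> elem_process K p q \<xi>" and "J \<equiv> elem_integral K p q \<xi>"
  shows "(\<integral>\<^sup>+\<omega>. (SUP k\<in>{..n}. sqn ((I (u k) \<omega> - J (u k) \<omega>) - (I (u 0) \<omega> - J (u 0) \<omega>))) \<partial>M)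
       \<le> 16 * energy (u 0) (u n) (\<lambda>r \<omega>. H r \<omega> - G r \<omega>)"
proof -
  obtain \<tau> where stop: "\<And>n. nonneg_stopping_time M F (\<tau> n)"
    and \<tau>_lim: "AE \<omega> in M. incseq (\<lambda>n. \<tau> n \<omega>) \<and> filterlim (\<lambda>n. \<tau> n \<omega>) at_top sequentially"
    and L2: "\<And>n. ito_integral_L2 M F B (\<lambda>r \<omega>. indicat_real {0..\<tau> n \<omega>} r *\<^sub>R H r \<omega>) (\<lambda>t \<omega>. I (min t (\<tau> n \<omega>)) \<omega>)"
    using ito unfolding ito_integral_def by blast
  have su: "u 0 \<le> u k" "0 \<le> u k" for k using s incseqD[OF u, of 0 k] by auto
  let ?T = "u n"
  have prog: "progressive_process F H" using ito by (simp add: ito_integral_def)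
  have \<tau>M[measurable]: "\<tau> m \<in> borel_measurable M" for m by (rule nonneg_stopping_time_measurable[OF stop])
  have JM[measurable]: "J (u k) \<in> borel_measurable M" for k
    unfolding J_def by (intro elem_integral_measurable[OF K] su)
  have IM[measurable]: "(\<lambda>\<omega>. I (min (u k) (\<tau> m \<omega>)) \<omega>) \<in> borel_measurable M" for k m
    using L2[of m] su(2)[of k] unfolding ito_integral_L2_def adapted_process_def
    by (intro F_measurable_M[of _ "u k"]) auto
  let ?V = "\<lambda>m \<omega>. (SUP k\<in>{..n}. sqn ((I (min (u k) (\<tau> m \<omega>)) \<omega> - J (u k) \<omega>) - (I (min (u 0) (\<tau> m \<omega>)) \<omega> - J (u 0) \<omega>)))"
  let ?V' = "\<lambda>\<omega>. (SUP k\<in>{..n}. sqn ((I (u k) \<omega> - J (u k) \<omega>) - (I (u 0) \<omega> - J (u 0) \<omega>)))"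
  let ?Y = "energy (u 0) ?T (\<lambda>r \<omega>. H r \<omega> - G r \<omega>)"
  define g where "g \<omega> = (\<integral>\<^sup>+r\<in>{u 0<..?T}. sqn (G r \<omega>) \<partial>lborel)" for \<omega>
  let ?b = "\<lambda>m. \<integral>\<^sup>+\<omega>. indicator {\<omega> \<in> space M. \<tau> m \<omega> < ?T} \<omega> * g \<omega> \<partial>M"
  have Gm: "(\<lambda>(r, \<omega>). G r \<omega>) \<in> borel_measurable (borel \<Otimes>\<^sub>M M)"
    unfolding G_def by (rule elem_process_joint_measurable[OF K])
  have gM[measurable]: "g \<in> borel_measurable M" unfolding g_def[abs_def] by (rule path_energy_measurable(1)[OF Gm])
  have V: "(\<integral>\<^sup>+\<omega>. ?V m \<omega> \<partial>M) \<le> 16 * (?Y + ?b m)" for m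
  proof -
    let ?H = "\<lambda>r. H (clip 0 ?T r)"
    have cl: "clip 0 ?T r = r" if "u 0 < r" "r \<le> ?T" for r using that s by (auto simp: clip_def)
    have "(\<integral>\<^sup>+\<omega>. ?V m \<omega> \<partial>M) \<le> 16 * energy (u 0) ?T (\<lambda>r \<omega>. indicat_real {0..\<tau> m \<omega>} r *\<^sub>R H r \<omega> - G r \<omega>)"
      unfolding G_def J_def by (rule ito_L2_grid[OF L2 K u s])
    also have "energy (u 0) ?T (\<lambda>r \<omega>. indicat_real {0..\<tau> m \<omega>} r *\<^sub>R H r \<omega> - G r \<omega>)
        = energy (u 0) ?T (\<lambda>r \<omega>. indicat_real {0..\<tau> m \<omega>} r *\<^sub>R ?H r \<omega> - G r \<omega>)"
      by (intro energy_cong) (simp add: cl)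
    also have "\<dots> \<le> energy (u 0) ?T (\<lambda>r \<omega>. ?H r \<omega> - G r \<omega>) + ?b m"
      unfolding g_def by (intro energy_stopped_le progressive_joint_measurable prog Gm \<tau>M s su)
    also have "energy (u 0) ?T (\<lambda>r \<omega>. ?H r \<omega> - G r \<omega>) = ?Y"
      by (intro energy_cong) (simp add: cl)
    finally show ?thesis by (simp add: mult_left_mono)
  qed
  have b_lim: "?b \<longlonglongrightarrow> 0"
  proof -
    have "?b \<longlonglongrightarrow> (\<integral>\<^sup>+\<omega>. 0 \<partial>M)"
    proof (rule nn_integral_dominated_convergence[where w=g])
      show "(\<integral>\<^sup>+\<omega>. g \<omega> \<partial>M) < \<infinity>"
        using elementary_energy_finite[OF K s su(1)] unfolding energy_def g_def G_def .
      show "AE \<omega> in M. indicator {\<omega> \<in> space M. \<tau> m \<omega> < ?T} \<omega> * g \<omega> \<le> g \<omega>" for m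
        by (intro AE_I2) (auto split: split_indicator)
      show "AE \<omega> in M. (\<lambda>m. indicator {\<omega> \<in> space M. \<tau> m \<omega> < ?T} \<omega> * g \<omega>) \<longlonglongrightarrow> 0"
        using \<tau>_lim
      proof eventually_elim
        case (elim \<omega>)
        then have "\<forall>\<^sub>F m in sequentially. ?T \<le> \<tau> m \<omega>" by (simp add: filterlim_at_top)
        then have "\<forall>\<^sub>F m in sequentially. indicator {\<omega> \<in> space M. \<tau> m \<omega> < ?T} \<omega> * g \<omega> = 0"
          by eventually_elim simp
        then show ?case by (rule tendsto_eventually)
      qed
    qed measurable
    then show ?thesis by simp
  qed
  have "(\<integral>\<^sup>+\<omega>. ?V' \<omega> \<partial>M) \<le> (\<integral>\<^sup>+\<omega>. liminf (\<lambda>m. ?V m \<omega>) \<partial>M)"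
  proof (intro nn_integral_mono_AE)
    show "AE \<omega> in M. ?V' \<omega> \<le> liminf (\<lambda>m. ?V m \<omega>)"
      using \<tau>_lim
    proof eventually_elim
      case (elim \<omega>)
      then have "\<forall>\<^sub>F m in sequentially. ?T \<le> \<tau> m \<omega>" by (simp add: filterlim_at_top)
      then have "\<forall>\<^sub>F m in sequentially. ?V' \<omega> \<le> ?V m \<omega>"
      proof eventually_elim
        case (elim m)
        then have "min (u k) (\<tau> m \<omega>) = u k" if "k \<le> n" for k
          using incseqD[OF u that] by simp
        then show ?case by (intro SUP_mono) auto
      qed
      then show ?case by (rule Liminf_bounded)
    qed
  qed
  also have "\<dots> \<le> liminf (\<lambda>m. \<integral>\<^sup>+\<omega>. ?V m \<omega> \<partial>M)"
    by (intro nn_integral_liminf) measurable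
  also have "\<dots> \<le> liminf (\<lambda>m. 16 * (?Y + ?b m))"
    using V by (intro Liminf_mono) auto
  also have "\<dots> = 16 * (?Y + 0)"
    by (intro lim_imp_Liminf ennreal_tendsto_cmult tendsto_add tendsto_const b_lim) auto
  finally show ?thesis by simp
qed

lemma incseq_grid:
  assumes "s \<le> (T::real)" shows "incseq (\<lambda>k. s + (T - s) * (real k / real (Suc n)))"
  using assms by (intro incseq_SucI add_left_mono mult_left_mono divide_right_mono) auto

lemma process_adapted_measurable: "adapted_process F X \<Longrightarrow> 0 \<le> t \<Longrightarrow> X t \<in> borel_measurable M"
  by (auto simp: adapted_process_def intro: F_measurable_M)

text \<open>The maximal inequality for locally square integrable integrands, with an elementary integral
  subtracted. The right-hand side may be infinite.\<close>

lemma ito_sup: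
  assumes ito: "ito_integral M F B H I" and K: "elementary K p q \<xi>" and st: "0 \<le> s" "s \<le> T"
  defines "G \<equiv> elem_process K p q \<xi>" and "J \<equiv> elem_integral K p q \<xi>"
  obtains W :: "'a \<Rightarrow> ennreal" where "W \<in> borel_measurable M"
    "AE \<omega> in M. \<forall>u\<in>{s..T}. sqn ((I u \<omega> - J u \<omega>) - (I s \<omega> - J s \<omega>)) \<le> W \<omega>"
    "(\<integral>\<^sup>+\<omega>. W \<omega> \<partial>M) \<le> 16 * energy s T (\<lambda>r \<omega>. H r \<omega> - G r \<omega>)"
proof -
  have ad: "adapted_process F I" and cont: "continuous_process M I"
    using ito by (auto simp: ito_integral_def)
  show ?thesis
  proof (rule grid_sup_dominated[of s T "\<lambda>u \<omega>. (I u \<omega> - J u \<omega>) - (I s \<omega> - J s \<omega>)" M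
      "16 * energy s T (\<lambda>r \<omega>. H r \<omega> - G r \<omega>)"])
    fix u assume "s \<le> u" "u \<le> T"
    then show "(\<lambda>\<omega>. (I u \<omega> - J u \<omega>) - (I s \<omega> - J s \<omega>)) \<in> borel_measurable M"
      using st unfolding J_def
      by (intro borel_measurable_diff process_adapted_measurable[OF ad] elem_integral_measurable[OF K]) auto
  next
    show "AE \<omega> in M. continuous_on {s..T} (\<lambda>u. (I u \<omega> - J u \<omega>) - (I s \<omega> - J s \<omega>))"
      using cont[unfolded continuous_process_def] elem_integral_continuous[OF K]
    proof eventually_elim
      case (elim \<omega>)
      then show ?case unfolding J_def using st
        by (intro continuous_intros) (auto elim!: continuous_on_subset)
    qed
  next
    fix n
    show "(\<integral>\<^sup>+\<omega>. (SUP k\<in>{..Suc n}. sqn ((I (s + (T - s) * (real k / real (Suc n))) \<omega> - J (s + (T - s) * (real k / real (Suc n))) \<omega>) - (I s \<omega> - J s \<omega>))) \<partial>M)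
        \<le> 16 * energy s T (\<lambda>r \<omega>. H r \<omega> - G r \<omega>)"
      using ito_grid[OF ito K incseq_grid[OF st(2), of n], of "Suc n"] st
      unfolding J_def G_def by simp
  qed (fact st(2), rule that)
qed

text \<open>Simple integrals vanish at time zero and converge to \<open>I 0\<close> in mean square.\<close>

lemma ito_L2_0:
  assumes ito: "ito_integral_L2 M F B H I"
  shows "AE \<omega> in M. I 0 \<omega> = 0"
proof -
  have ad: "adapted_process F I"
    using ito unfolding ito_integral_L2_def by blast
  obtain N p \<xi> where simple: "\<And>n. simple_integrand M F (N n) (p n) (\<xi> n)"
    and lim: "\<And>t. 0 \<le> t \<Longrightarrow> (\<lambda>n. \<integral>\<^sup>+\<omega>. sqn (simple_ito_integral B (N n) (p n) (\<xi> n) t \<omega> - I t \<omega>) \<partial>M) \<longlonglongrightarrow> 0"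
    using ito unfolding ito_integral_L2_def by blast
  have "(\<lambda>n. \<integral>\<^sup>+\<omega>. sqn (I 0 \<omega>) \<partial>M) \<longlonglongrightarrow> 0"
    using lim[of 0] by (simp add: simple_ito_integral_elem elem_integral_0[OF simple_elementary[OF simple]])
  then have "(\<integral>\<^sup>+\<omega>. sqn (I 0 \<omega>) \<partial>M) = 0"
    using LIMSEQ_unique tendsto_const by blast
  then show ?thesis
    using process_adapted_measurable[OF ad, of 0]
    by (subst (asm) nn_integral_0_iff_AE) (auto simp: ennreal_eq_0_iff)
qed

lemma ito_0:
  assumes ito: "ito_integral M F B H I"
  shows "AE \<omega> in M. I 0 \<omega> = 0"
proof -
  obtain \<tau> where stop: "nonneg_stopping_time M F \<tau>"
    and L2: "ito_integral_L2 M F B (\<lambda>r \<omega>. indicat_real {0..\<tau> \<omega>} r *\<^sub>R H r \<omega>) (\<lambda>t \<omega>. I (min t (\<tau> \<omega>)) \<omega>)"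
    using ito unfolding ito_integral_def by blast
  have "AE \<omega> in M. min 0 (\<tau> \<omega>) = 0"
    using stop by (intro AE_I2) (auto simp: nonneg_stopping_time_def)
  then show ?thesis
    using ito_L2_0[OF L2] by eventually_elim simp
qed

lemma ito_L2_sup:
  assumes ito: "ito_integral_L2 M F B H I" and T: "0 \<le> T"
  obtains W :: "'a \<Rightarrow> ennreal" where "W \<in> borel_measurable M"
    "AE \<omega> in M. \<forall>u\<in>{0..T}. sqn (I u \<omega>) \<le> W \<omega>"
    "(\<integral>\<^sup>+\<omega>. W \<omega> \<partial>M) \<le> 16 * energy 0 T H"
proof -
  have ad: "adapted_process F I" and cont: "continuous_process M I"
    using ito unfolding ito_integral_L2_def by blast+
  have K: "elementary ({} :: nat set) (\<lambda>_. 0) (\<lambda>_. 0) (\<lambda>_ _. 0 :: real ^ 'm ^ 'd)"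
    by (simp add: elementary_def)
  note I0 = ito_L2_0[OF ito]
  obtain W :: "'a \<Rightarrow> ennreal" where W: "W \<in> borel_measurable M"
    "AE \<omega> in M. \<forall>u\<in>{0..T}. sqn (I u \<omega> - I 0 \<omega>) \<le> W \<omega>"
    "(\<integral>\<^sup>+\<omega>. W \<omega> \<partial>M) \<le> 16 * energy 0 T H"
  proof (rule grid_sup_dominated[of 0 T "\<lambda>u \<omega>. I u \<omega> - I 0 \<omega>" M "16 * energy 0 T H"])
    fix u assume "0 \<le> u" "u \<le> T"
    then show "(\<lambda>\<omega>. I u \<omega> - I 0 \<omega>) \<in> borel_measurable M"
      by (intro borel_measurable_diff process_adapted_measurable[OF ad]) auto
  next
    show "AE \<omega> in M. continuous_on {0..T} (\<lambda>u. I u \<omega> - I 0 \<omega>)"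
      using cont[unfolded continuous_process_def]
      by eventually_elim (intro continuous_intros, auto elim!: continuous_on_subset)
  next
    fix n
    show "(\<integral>\<^sup>+\<omega>. (SUP k\<in>{..Suc n}. sqn (I (0 + (T - 0) * (real k / real (Suc n))) \<omega> - I 0 \<omega>)) \<partial>M)
        \<le> 16 * energy 0 T H"
      using ito_L2_grid[OF ito K incseq_grid[OF T, of n], of "Suc n"] T
      by (simp add: elem_process_def elem_integral_def)
  qed (use T in simp, blast)
  show ?thesis
  proof (rule that[OF W(1) _ W(3)])
    show "AE \<omega> in M. \<forall>u\<in>{0..T}. sqn (I u \<omega>) \<le> W \<omega>"
      using W(2) I0 by eventually_elim simp
  qed
qed

lemma ito_increment:
  assumes ito: "ito_integral M F B H I" and st: "0 \<le> s" "s \<le> t"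
  shows "(\<integral>\<^sup>+\<omega>. sqn (I t \<omega> - I s \<omega>) \<partial>M) \<le> 16 * energy s t H"
proof -
  have K: "elementary ({} :: nat set) (\<lambda>_. 0) (\<lambda>_. 0) (\<lambda>_ _. 0 :: real ^ 'm ^ 'd)"
    by (simp add: elementary_def)
  obtain W :: "'a \<Rightarrow> ennreal" where W: "W \<in> borel_measurable M"
    "AE \<omega> in M. \<forall>u\<in>{s..t}. sqn (I u \<omega> - I s \<omega>) \<le> W \<omega>"
    "(\<integral>\<^sup>+\<omega>. W \<omega> \<partial>M) \<le> 16 * energy s t H"
    using ito_sup[OF ito K st] by (auto simp: elem_process_def elem_integral_def)
  have "(\<integral>\<^sup>+\<omega>. sqn (I t \<omega> - I s \<omega>) \<partial>M) \<le> (\<integral>\<^sup>+\<omega>. W \<omega> \<partial>M)"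
    using W(2) st by (intro nn_integral_mono_AE) auto
  then show ?thesis using W(3) by (rule order_trans)
qed

end

section \<open>Drift terms and second moments\<close>

lemma ennreal_square_add_le: "(x + y)\<^sup>2 \<le> 2 * x\<^sup>2 + 2 * (y::ennreal)\<^sup>2"
proof -
  have "(x + y)\<^sup>2 = x\<^sup>2 + 2 * (x * y) + y\<^sup>2"
    unfolding power2_eq_square mult_2 ring_distribs by (simp only: ac_simps)
  also have "\<dots> \<le> x\<^sup>2 + (x\<^sup>2 + y\<^sup>2) + y\<^sup>2"
    by (intro add_mono ennreal_sum_squares_bound order_refl)
  finally show ?thesis by (simp add: mult_2 ac_simps)
qed

lemma ennreal_square_add3_le: "(x + y + z)\<^sup>2 \<le> 2 * x\<^sup>2 + 4 * y\<^sup>2 + 4 * (z::ennreal)\<^sup>2"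
proof -
  have "(x + y + z)\<^sup>2 \<le> 2 * x\<^sup>2 + 2 * (y + z)\<^sup>2"
    using ennreal_square_add_le[of x "y + z"] by (simp add: add.assoc)
  also have "\<dots> \<le> 2 * x\<^sup>2 + 2 * (2 * y\<^sup>2 + 2 * z\<^sup>2)"
    by (intro add_mono mult_left_mono ennreal_square_add_le) auto
  finally show ?thesis by (simp add: ring_distribs mult.assoc[symmetric] add.assoc)
qed

text \<open>The set \<open>A\<close> is \<open>[s, t]\<close> or \<open>(s, t]\<close> in the applications; the endpoint \<open>s\<close> is a null set.\<close>

lemma norm_drift_le:
  fixes f :: "real \<Rightarrow> 'b::euclidean_space"
  assumes int: "set_integrable lborel A f" and A: "A \<subseteq> {s..t}"
    and [measurable]: "D \<in> borel_measurable borel" and K: "0 \<le> K"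
    and le: "\<And>r. s < r \<Longrightarrow> r \<le> t \<Longrightarrow> norm (f r) \<le> K * D r"
  shows "ennreal (norm (LINT r:A|lborel. f r)) \<le> ennreal K * (\<integral>\<^sup>+r\<in>{s<..t}. ennreal (D r) \<partial>lborel)"
proof -
  have "ennreal (norm (LINT r:A|lborel. f r)) \<le> (\<integral>\<^sup>+r. ennreal (norm (indicat_real A r *\<^sub>R f r)) \<partial>lborel)"
    using int unfolding set_lebesgue_integral_def set_integrable_def by (rule integral_norm_bound_ennreal)
  also have "\<dots> \<le> (\<integral>\<^sup>+r. ennreal K * (ennreal (D r) * indicator {s<..t} r) \<partial>lborel)"
  proof (rule nn_integral_mono_AE)
    show "AE r in lborel. ennreal (norm (indicat_real A r *\<^sub>R f r)) \<le> ennreal K * (ennreal (D r) * indicator {s<..t} r)"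
      using AE_lborel_singleton[of s]
    proof eventually_elim
      case (elim r)
      then have "ennreal (norm (f r)) \<le> ennreal K * ennreal (D r)" if "r \<in> A"
        using that A le[of r] K by (subst ennreal_mult'[symmetric]) (auto intro!: ennreal_leI)
      then show ?case using elim A by (auto split: split_indicator)
    qed
  qed
  also have "\<dots> = ennreal K * (\<integral>\<^sup>+r\<in>{s<..t}. ennreal (D r) \<partial>lborel)"
    by (intro nn_integral_cmult) simp
  finally show ?thesis .
qed

lemma nn_integral_drift_noise:
  assumes [measurable]: "d \<in> borel_measurable M" "i \<in> borel_measurable M"
  shows "(\<integral>\<^sup>+x. 2 * (k * (d x)\<^sup>2) + 2 * i x \<partial>M) = 2 * (k * (\<integral>\<^sup>+x. (d x)\<^sup>2 \<partial>M)) + 2 * (\<integral>\<^sup>+x. i x \<partial>M)"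
  by (simp add: nn_integral_add nn_integral_cmult)

text \<open>Continuous paths are limits of their values at the points of finer and finer grids, and a process that is
  constant in time on the cells of a countable partition is jointly measurable.\<close>

lemma joint_measurable_of_continuous:
  fixes Y :: "real \<Rightarrow> 'a \<Rightarrow> 'b::euclidean_space"
  assumes meas: "\<And>t. Y t \<in> borel_measurable M"
    and cont: "\<And>\<omega>. continuous_on UNIV (\<lambda>t. Y t \<omega>)"
  shows "(\<lambda>(r, \<omega>). Y r \<omega>) \<in> borel_measurable (borel \<Otimes>\<^sub>M M)"
proof (rule borel_measurable_LIMSEQ_metric)
  fix n
  have "(\<lambda>x. Y (real_of_int \<lfloor>fst x * real (Suc n)\<rfloor> / real (Suc n)) (snd x)) \<in> borel_measurable (borel \<Otimes>\<^sub>M M)"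
  proof (rule measurable_compose_countable[where f="\<lambda>i x. Y (real_of_int i / real (Suc n)) (snd x)"])
    fix i :: int
    show "(\<lambda>x. Y (real_of_int i / real (Suc n)) (snd x)) \<in> borel_measurable (borel \<Otimes>\<^sub>M M)"
      by (rule measurable_compose[OF measurable_snd meas])
    show "(\<lambda>x. \<lfloor>fst x * real (Suc n)\<rfloor>) \<in> measurable (borel \<Otimes>\<^sub>M M) (count_space UNIV)"
      by measurable
  qed
  then show "(\<lambda>(r, \<omega>). Y (real_of_int \<lfloor>r * real (Suc n)\<rfloor> / real (Suc n)) \<omega>) \<in> borel_measurable (borel \<Otimes>\<^sub>M M)"
    by (simp add: split_def)
next
  fix x :: "real \<times> 'a" assume "x \<in> space (borel \<Otimes>\<^sub>M M)"
  obtain r \<omega> where x: "x = (r, \<omega>)" by (cases x)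
  have "(\<lambda>n. real_of_int \<lfloor>r * real (Suc n)\<rfloor> / real (Suc n)) \<longlonglongrightarrow> r"
  proof (rule tendsto_sandwich)
    show "(\<lambda>n. r - 1 / real (Suc n)) \<longlonglongrightarrow> r"
      using tendsto_diff[OF tendsto_const LIMSEQ_inverse_real_of_nat, of r] by (simp add: inverse_eq_divide)
    show "\<forall>\<^sub>F n in sequentially. r - 1 / real (Suc n) \<le> real_of_int \<lfloor>r * real (Suc n)\<rfloor> / real (Suc n)"
    proof (intro always_eventually allI)
      fix n
      have "r * real (Suc n) - 1 \<le> real_of_int \<lfloor>r * real (Suc n)\<rfloor>" by linarith
      then show "r - 1 / real (Suc n) \<le> real_of_int \<lfloor>r * real (Suc n)\<rfloor> / real (Suc n)"
        by (simp add: pos_le_divide_eq left_diff_distrib del: of_nat_Suc)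
    qed
    show "\<forall>\<^sub>F n in sequentially. real_of_int \<lfloor>r * real (Suc n)\<rfloor> / real (Suc n) \<le> r"
      by (intro always_eventually allI) (simp add: pos_divide_le_eq del: of_nat_Suc)
  qed simp
  then have "(\<lambda>n. Y (real_of_int \<lfloor>r * real (Suc n)\<rfloor> / real (Suc n)) \<omega>) \<longlonglongrightarrow> Y r \<omega>"
    by (intro continuous_on_tendsto_compose[OF cont]) auto
  then show "(\<lambda>n. case x of (r, \<omega>) \<Rightarrow> Y (real_of_int \<lfloor>r * real (Suc n)\<rfloor> / real (Suc n)) \<omega>)
      \<longlonglongrightarrow> (case x of (r, \<omega>) \<Rightarrow> Y r \<omega>)"
    by (simp add: x)
qed

lemma nn_integral_exp_conv_exp:
  assumes "2 \<le> l" "0 \<le> t"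
  shows "(exp_conv (\<lambda>r. ennreal (exp (l * r))) t) \<le> ennreal (exp (l * t))"
proof -
  have "(exp_conv (\<lambda>r. ennreal (exp (l * r))) t)
      = (\<integral>\<^sup>+r. ennreal (exp t) * (ennreal (exp ((l - 1) * r)) * indicator {0<..t} r) \<partial>lborel)"
    by (intro nn_integral_cong)
       (auto split: split_indicator simp: ennreal_mult[symmetric] exp_add[symmetric] algebra_simps)
  also have "\<dots> \<le> ennreal (exp t) * ennreal (exp ((l - 1) * t) / (l - 1))"
    using assms by (subst nn_integral_cmult) (auto intro!: mult_left_mono nn_integral_exp_Ioc)
  also have "\<dots> = ennreal (exp (l * t) / (l - 1))"
    using assms by (simp add: ennreal_mult[symmetric] exp_add[symmetric] algebra_simps)
  also have "\<dots> \<le> ennreal (exp (l * t))"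
    using assms by (intro ennreal_leI) (auto simp: pos_divide_le_eq)
  finally show ?thesis .
qed

text \<open>Bounds under the weighted integral: exponentials of rate at least \<open>2\<close> reproduce themselves
  (\<open>nn_integral_exp_conv_exp\<close>), which is why the same rate serves for the inhomogeneity and for the conclusion
  of \<open>gronwall_exp\<close>.\<close>

lemma nn_integral_exp_conv_le:
  fixes g h :: "real \<Rightarrow> ennreal"
  assumes "2 \<le> l" "0 \<le> t" and [measurable]: "h \<in> borel_measurable borel"
    and le: "\<And>r. 0 < r \<Longrightarrow> r \<le> t \<Longrightarrow> g r \<le> a * ennreal (exp (l * r)) + c * h r"
  shows "(exp_conv g t)
    \<le> a * ennreal (exp (l * t)) + c * exp_conv h t"
proof -
  have "(exp_conv g t)
     \<le> (\<integral>\<^sup>+r. a * (ennreal (exp (t - r)) * ennreal (exp (l * r)) * indicator {0<..t} r)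
            + c * (ennreal (exp (t - r)) * h r * indicator {0<..t} r) \<partial>lborel)"
  proof (intro nn_integral_mono)
    fix r
    have "ennreal (exp (t - r)) * g r \<le> ennreal (exp (t - r)) * (a * ennreal (exp (l * r)) + c * h r)"
      if "r \<in> {0<..t}" using that by (intro mult_left_mono le) auto
    then show "ennreal (exp (t - r)) * g r * indicator {0<..t} r
       \<le> a * (ennreal (exp (t - r)) * ennreal (exp (l * r)) * indicator {0<..t} r)
            + c * (ennreal (exp (t - r)) * h r * indicator {0<..t} r)"
      by (simp add: ring_distribs ac_simps split: split_indicator)
  qed
  also have "\<dots> = a * (exp_conv (\<lambda>r. ennreal (exp (l * r))) t)
      + c * exp_conv h t"
    by (subst nn_integral_add, simp, simp, subst nn_integral_cmult, simp, subst nn_integral_cmult) auto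
  also have "\<dots> \<le> a * ennreal (exp (l * t)) + c * exp_conv h t"
    using assms by (intro add_right_mono mult_left_mono nn_integral_exp_conv_exp) auto
  finally show ?thesis .
qed

lemma nn_integral_le_exp_conv:
  "(\<integral>\<^sup>+r\<in>{0<..t}. h r \<partial>lborel) \<le> (exp_conv h t)"
proof (intro nn_integral_mono)
  fix r
  have "1 * h r \<le> ennreal (exp (t - r)) * h r" if "r \<le> t"
    using that by (intro mult_right_mono) (auto simp: ennreal_1[symmetric] simp del: ennreal_1)
  then show "h r * indicator {0<..t} r \<le> ennreal (exp (t - r)) * h r * indicator {0<..t} r"
    by (auto split: split_indicator)
qed

context brownian_space
begin

text \<open>Set the process to zero on a measurable null set that contains all discontinuous paths, and freeze
  it at negative times. A process that is continuous everywhere is jointly measurable, so that Fubini's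
  theorem applies.\<close>

lemma continuous_modification:
  fixes X :: "real \<Rightarrow> 'a \<Rightarrow> 'b::euclidean_space"
  assumes ad: "adapted_process F X" and cont: "continuous_process M X"
  obtains Y :: "real \<Rightarrow> 'a \<Rightarrow> 'b" where "\<And>t. Y t \<in> borel_measurable M"
    "\<And>\<omega>. continuous_on UNIV (\<lambda>t. Y t \<omega>)" "AE \<omega> in M. \<forall>t\<ge>0. Y t \<omega> = X t \<omega>"
proof -
  obtain N where N: "{\<omega> \<in> space M. \<not> continuous_on {0..} (\<lambda>t. X t \<omega>)} \<subseteq> N" "N \<in> null_sets M"
    using cont unfolding continuous_process_def eventually_ae_filter by auto
  define Y where "Y t \<omega> = indicat_real (space M - N) \<omega> *\<^sub>R X (max 0 t) \<omega>" for t \<omega>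
  show ?thesis
  proof
    fix t
    have "X (max 0 t) \<in> borel_measurable M" using ad by (intro process_adapted_measurable) auto
    moreover have "space M - N \<in> sets M" using N(2) by auto
    ultimately show "Y t \<in> borel_measurable M" unfolding Y_def[abs_def] by measurable
  next
    fix \<omega>
    show "continuous_on UNIV (\<lambda>t. Y t \<omega>)"
    proof (cases "\<omega> \<in> space M - N")
      case True
      then have "continuous_on {0..} (\<lambda>t. X t \<omega>)" using N(1) by auto
      then have "continuous_on UNIV (\<lambda>t. X (max 0 t) \<omega>)"
        by (rule continuous_on_compose2) (auto intro!: continuous_intros)
      then show ?thesis using True by (simp add: Y_def)
    next
      case False
      then show ?thesis by (simp add: Y_def)
    qed
  next
    show "AE \<omega> in M. \<forall>t\<ge>0. Y t \<omega> = X t \<omega>"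
      using AE_not_in[OF N(2)] AE_space by eventually_elim (simp add: Y_def)
  qed
qed

definition second_moment :: "(real \<Rightarrow> 'a \<Rightarrow> real) \<Rightarrow> real \<Rightarrow> ennreal" where
  "second_moment D r = (\<integral>\<^sup>+\<omega>. ennreal ((D r \<omega>)\<^sup>2) \<partial>M)"

lemma Fubini_second_moment:
  assumes D: "(\<lambda>(r, \<omega>). D r \<omega>) \<in> borel_measurable (borel \<Otimes>\<^sub>M M)" and w: "w \<in> borel_measurable borel"
  shows "(\<integral>\<^sup>+\<omega>. (\<integral>\<^sup>+r\<in>{s<..t}. w r * ennreal ((D r \<omega>)\<^sup>2) \<partial>lborel) \<partial>M)
       = (\<integral>\<^sup>+r\<in>{s<..t}. w r * second_moment D r \<partial>lborel)"
    "second_moment D \<in> borel_measurable borel"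
proof -
  interpret P: pair_sigma_finite lborel M ..
  have D': "(\<lambda>x. D (fst x) (snd x)) \<in> borel_measurable (lborel \<Otimes>\<^sub>M M)"
    using D by (simp add: split_def cong: measurable_cong_sets)
  then have f: "(\<lambda>x. w (fst x) * ennreal ((D (fst x) (snd x))\<^sup>2) * indicator {s<..t} (fst x)) \<in> borel_measurable (lborel \<Otimes>\<^sub>M M)"
    using w by measurable
  have sec: "(\<lambda>\<omega>. ennreal ((D r \<omega>)\<^sup>2)) \<in> borel_measurable M" for r
  proof -
    have "(\<lambda>\<omega>. D r \<omega>) \<in> borel_measurable M"
      using measurable_compose[OF measurable_Pair1' D', of r] by simp
    then show ?thesis by measurable
  qed
  have "(\<integral>\<^sup>+\<omega>. (\<integral>\<^sup>+r\<in>{s<..t}. w r * ennreal ((D r \<omega>)\<^sup>2) \<partial>lborel) \<partial>M)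
      = (\<integral>\<^sup>+r. (\<integral>\<^sup>+\<omega>. w r * ennreal ((D r \<omega>)\<^sup>2) * indicator {s<..t} r \<partial>M) \<partial>lborel)"
    using P.Fubini[OF f] by simp
  also have "\<dots> = (\<integral>\<^sup>+r\<in>{s<..t}. w r * second_moment D r \<partial>lborel)"
    unfolding second_moment_def using sec
    by (intro nn_integral_cong) (simp add: nn_integral_multc nn_integral_cmult)
  finally show "(\<integral>\<^sup>+\<omega>. (\<integral>\<^sup>+r\<in>{s<..t}. w r * ennreal ((D r \<omega>)\<^sup>2) \<partial>lborel) \<partial>M)
       = (\<integral>\<^sup>+r\<in>{s<..t}. w r * second_moment D r \<partial>lborel)" .
  have "(\<lambda>x. ennreal ((D (fst x) (snd x))\<^sup>2)) \<in> borel_measurable (lborel \<Otimes>\<^sub>M M)"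
    using D' by measurable
  from borel_measurable_nn_integral_fst[OF this]
  show "second_moment D \<in> borel_measurable borel"
    unfolding second_moment_def[abs_def] by simp
qed

lemma joint_section_measurable:
  fixes D :: "real \<Rightarrow> 'a \<Rightarrow> 'b::euclidean_space"
  assumes D: "(\<lambda>(r, \<omega>). D r \<omega>) \<in> borel_measurable (borel \<Otimes>\<^sub>M M)"
  shows "D r \<in> borel_measurable M" "\<omega> \<in> space M \<Longrightarrow> (\<lambda>r. D r \<omega>) \<in> borel_measurable borel"
proof -
  show "D r \<in> borel_measurable M"
    using measurable_compose[OF measurable_Pair1' D, of r] by simp
  assume "\<omega> \<in> space M"
  then show "(\<lambda>r. D r \<omega>) \<in> borel_measurable borel"
    using measurable_compose[OF measurable_Pair2' D] by simp
qed

lemma path_integral_measurable: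
  fixes f :: "real \<Rightarrow> 'a \<Rightarrow> ennreal"
  assumes f: "(\<lambda>(r, \<omega>). f r \<omega>) \<in> borel_measurable (borel \<Otimes>\<^sub>M M)"
  shows "(\<lambda>\<omega>. \<integral>\<^sup>+r\<in>{s<..t}. f r \<omega> \<partial>lborel) \<in> borel_measurable M"
proof -
  have "(\<lambda>x. f (snd x) (fst x)) \<in> borel_measurable (M \<Otimes>\<^sub>M lborel)"
    using measurable_compose[OF measurable_pair_swap' f]
    by (simp add: split_def cong: measurable_cong_sets)
  then have "(\<lambda>x. f (snd x) (fst x) * indicator {s<..t} (snd x)) \<in> borel_measurable (M \<Otimes>\<^sub>M lborel)"
    by measurable
  from lborel.borel_measurable_nn_integral_fst[OF this] show ?thesis by simp
qed

lemma energy_le_second_moment: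
  assumes D: "(\<lambda>(r, \<omega>). D r \<omega>) \<in> borel_measurable (borel \<Otimes>\<^sub>M M)"
    and le: "AE \<omega> in M. \<forall>r\<in>{s<..t}. norm (H r \<omega>) \<le> K * D r \<omega>"
  shows "energy s t H \<le> ennreal (K\<^sup>2) * (\<integral>\<^sup>+r\<in>{s<..t}. second_moment D r \<partial>lborel)"
proof -
  have "energy s t H \<le> (\<integral>\<^sup>+\<omega>. (\<integral>\<^sup>+r\<in>{s<..t}. ennreal (K\<^sup>2) * ennreal ((D r \<omega>)\<^sup>2) \<partial>lborel) \<partial>M)"
    unfolding energy_def
  proof (rule nn_integral_mono_AE)
    show "AE \<omega> in M. (\<integral>\<^sup>+r\<in>{s<..t}. sqn (H r \<omega>) \<partial>lborel)
        \<le> (\<integral>\<^sup>+r\<in>{s<..t}. ennreal (K\<^sup>2) * ennreal ((D r \<omega>)\<^sup>2) \<partial>lborel)"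
      using le
    proof eventually_elim
      case (elim \<omega>)
      show ?case
      proof (intro nn_integral_mono)
        fix r
        have "sqn (H r \<omega>) \<le> ennreal (K\<^sup>2) * ennreal ((D r \<omega>)\<^sup>2)" if "r \<in> {s<..t}"
        proof -
          have "(norm (H r \<omega>))\<^sup>2 \<le> (K * D r \<omega>)\<^sup>2" using elim that by (intro power_mono) auto
          then show ?thesis by (simp add: ennreal_mult[symmetric] power_mult_distrib ennreal_leI)
        qed
        then show "sqn (H r \<omega>) * indicator {s<..t} r \<le> ennreal (K\<^sup>2) * ennreal ((D r \<omega>)\<^sup>2) * indicator {s<..t} r"
          by (auto split: split_indicator)
      qed
    qed
  qed
  also have "\<dots> = (\<integral>\<^sup>+r\<in>{s<..t}. ennreal (K\<^sup>2) * second_moment D r \<partial>lborel)"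
    by (rule Fubini_second_moment(1)[OF D]) simp
  also have "\<dots> = ennreal (K\<^sup>2) * (\<integral>\<^sup>+r\<in>{s<..t}. second_moment D r \<partial>lborel)"
    using Fubini_second_moment(2)[OF D, of "\<lambda>_. 0"] by (simp add: mult.assoc nn_integral_cmult)
  finally show ?thesis .
qed

text \<open>The expected square of a drift, in the weighted form that \<open>gronwall_exp\<close> expects.\<close>

lemma drift_square_le_exp:
  assumes D: "(\<lambda>(r, \<omega>). D r \<omega>) \<in> borel_measurable (borel \<Otimes>\<^sub>M M)"
    and D0: "\<And>r \<omega>. 0 \<le> D r \<omega>" and t: "0 \<le> t"
  shows "(\<integral>\<^sup>+\<omega>. (\<integral>\<^sup>+r\<in>{0<..t}. ennreal (D r \<omega>) \<partial>lborel)\<^sup>2 \<partial>M)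
    \<le> (exp_conv (second_moment D) t)"
proof -
  have "(\<integral>\<^sup>+\<omega>. (\<integral>\<^sup>+r\<in>{0<..t}. ennreal (D r \<omega>) \<partial>lborel)\<^sup>2 \<partial>M)
      \<le> (\<integral>\<^sup>+\<omega>. (exp_conv (\<lambda>r. ennreal ((D r \<omega>)\<^sup>2)) t) \<partial>M)"
  proof (intro nn_integral_mono)
    fix \<omega> assume "\<omega> \<in> space M"
    then have "(\<lambda>r. ennreal (D r \<omega>)) \<in> borel_measurable borel"
      using joint_section_measurable(2)[OF D] by measurable
    from nn_integral_square_le_exp[OF this t]
    show "(\<integral>\<^sup>+r\<in>{0<..t}. ennreal (D r \<omega>) \<partial>lborel)\<^sup>2
        \<le> (exp_conv (\<lambda>r. ennreal ((D r \<omega>)\<^sup>2)) t)"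
      by (simp add: ennreal_power D0)
  qed
  also have "\<dots> = (exp_conv (second_moment D) t)"
    by (intro Fubini_second_moment(1) D) measurable
  finally show ?thesis .
qed

text \<open>For increments over short intervals the factor \<open>t - s\<close> is an advantage, so here the unweighted
  inequality is the right one.\<close>

lemma drift_square_le_length:
  assumes D: "(\<lambda>(r, \<omega>). D r \<omega>) \<in> borel_measurable (borel \<Otimes>\<^sub>M M)"
    and D0: "\<And>r \<omega>. 0 \<le> D r \<omega>" and st: "s \<le> t"
  shows "(\<integral>\<^sup>+\<omega>. (\<integral>\<^sup>+r\<in>{s<..t}. ennreal (D r \<omega>) \<partial>lborel)\<^sup>2 \<partial>M)
    \<le> ennreal (t - s) * (\<integral>\<^sup>+r\<in>{s<..t}. second_moment D r \<partial>lborel)"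
proof -
  have "(\<integral>\<^sup>+\<omega>. (\<integral>\<^sup>+r\<in>{s<..t}. ennreal (D r \<omega>) \<partial>lborel)\<^sup>2 \<partial>M)
      \<le> (\<integral>\<^sup>+\<omega>. (\<integral>\<^sup>+r\<in>{s<..t}. ennreal (t - s) * ennreal ((D r \<omega>)\<^sup>2) \<partial>lborel) \<partial>M)"
  proof (intro nn_integral_mono)
    fix \<omega> assume "\<omega> \<in> space M"
    then have m: "(\<lambda>r. ennreal (D r \<omega>)) \<in> borel_measurable borel"
      using joint_section_measurable(2)[OF D] by measurable
    have "(\<integral>\<^sup>+r\<in>{s<..t}. ennreal (D r \<omega>) \<partial>lborel)\<^sup>2
        \<le> ennreal (t - s) * (\<integral>\<^sup>+r\<in>{s<..t}. ennreal ((D r \<omega>)\<^sup>2) \<partial>lborel)"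
      using nn_integral_square_le_length[OF m st] by (simp add: ennreal_power D0)
    also have "\<dots> = (\<integral>\<^sup>+r\<in>{s<..t}. ennreal (t - s) * ennreal ((D r \<omega>)\<^sup>2) \<partial>lborel)"
    proof -
      have "(\<lambda>r. ennreal ((D r \<omega>)\<^sup>2) * indicator {s<..t} r) \<in> borel_measurable lborel"
        using joint_section_measurable(2)[OF D \<open>\<omega> \<in> space M\<close>] by measurable
      then show ?thesis by (simp add: nn_integral_cmult mult.assoc)
    qed
    finally show "(\<integral>\<^sup>+r\<in>{s<..t}. ennreal (D r \<omega>) \<partial>lborel)\<^sup>2
        \<le> (\<integral>\<^sup>+r\<in>{s<..t}. ennreal (t - s) * ennreal ((D r \<omega>)\<^sup>2) \<partial>lborel)" .
  qed
  also have "\<dots> = (\<integral>\<^sup>+r\<in>{s<..t}. ennreal (t - s) * second_moment D r \<partial>lborel)"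
    by (intro Fubini_second_moment(1) D) measurable
  also have "\<dots> = ennreal (t - s) * (\<integral>\<^sup>+r\<in>{s<..t}. second_moment D r \<partial>lborel)"
    using Fubini_second_moment(2)[OF D, of "\<lambda>_. 0"] by (simp add: mult.assoc nn_integral_cmult)
  finally show ?thesis .
qed

end

section \<open>Moments of the solution\<close>

text \<open>The equation for a continuous modification \<open>Y\<close> of the solution. The integrand \<open>H\<close> of the noise \<open>I\<close>
  is kept apart from \<open>\<sigma>(r, Y(r))\<close> because the Ito integral is given for the original solution, which agrees
  with \<open>Y\<close> only almost surely.\<close>

locale ito_equation = brownian_space M F B
  for M :: "'a measure" and F and B :: "real \<Rightarrow> 'a \<Rightarrow> real ^ 'm" +
  fixes b :: "real \<Rightarrow> real ^ 'd \<Rightarrow> real ^ 'd" and \<sigma> :: "real \<Rightarrow> real ^ 'd \<Rightarrow> real ^ 'm ^ 'd"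
    and y0 :: "real ^ 'd" and K \<gamma> :: real
    and Y I :: "real \<Rightarrow> 'a \<Rightarrow> real ^ 'd" and H :: "real \<Rightarrow> 'a \<Rightarrow> real ^ 'm ^ 'd"
  assumes K_pos: "K > 0" and \<gamma>_pos: "\<gamma> > 0"
    and lipschitz: "\<And>t x y. t \<ge> 0 \<Longrightarrow> norm (b t x - b t y) + norm (\<sigma> t x - \<sigma> t y) \<le> K * norm (x - y)"
    and growth: "\<And>t x. t \<ge> 0 \<Longrightarrow> norm (b t x) + norm (\<sigma> t x) \<le> K * (1 + norm x)"
    and hoelder: "\<And>s t x. s \<ge> 0 \<Longrightarrow> t \<ge> 0 \<Longrightarrow>
           norm (b s x - b t x) + norm (\<sigma> s x - \<sigma> t x) \<le> K * (1 + norm x) * \<bar>s - t\<bar> powr \<gamma>"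
    and Y_measurable: "\<And>t. Y t \<in> borel_measurable M"
    and Y_continuous: "\<And>\<omega>. continuous_on UNIV (\<lambda>t. Y t \<omega>)"
    and ito: "ito_integral M F B H I"
    and H_eq: "AE \<omega> in M. \<forall>r\<ge>0. H r \<omega> = \<sigma> r (Y r \<omega>)"
    and drift_integrable: "AE \<omega> in M. \<forall>t\<ge>0. set_integrable lborel {0..t} (\<lambda>r. b r (Y r \<omega>))"
    and equation: "AE \<omega> in M. \<forall>t\<ge>0. Y t \<omega> = y0 + (LINT r:{0..t}|lborel. b r (Y r \<omega>)) + I t \<omega>"
begin

lemma norm_b_le: "0 \<le> t \<Longrightarrow> norm (b t x) \<le> K * (1 + norm x)"
  using growth[of t x] norm_ge_zero[of "\<sigma> t x"] by linarith

lemma norm_\<sigma>_le: "0 \<le> t \<Longrightarrow> norm (\<sigma> t x) \<le> K * (1 + norm x)"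
  using growth[of t x] norm_ge_zero[of "b t x"] by linarith

lemma Y_joint[measurable]: "(\<lambda>(r, \<omega>). Y r \<omega>) \<in> borel_measurable (borel \<Otimes>\<^sub>M M)"
  using Y_measurable Y_continuous by (rule joint_measurable_of_continuous)

text \<open>The exponential rate of all bounds below: at least \<open>2\<close>, and at least \<open>2 C + 1\<close> for each constant \<open>C\<close>
  to which \<open>gronwall_exp\<close> is applied, the largest being \<open>136 K\<^sup>2\<close>.\<close>

definition rate :: real where "rate = 272 * K\<^sup>2 + 2"

definition moment_const :: real where "moment_const = 2 * (norm y0)\<^sup>2 + 136 * K\<^sup>2"

lemma rate_ge: "2 \<le> rate" "2 * (8 * K\<^sup>2) + 1 \<le> rate" "2 * (136 * K\<^sup>2) + 1 \<le> rate"
  by (auto simp: rate_def)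

lemma one_plus_square_le: "ennreal ((1 + x)\<^sup>2) \<le> 2 + 2 * ennreal (x\<^sup>2)"
proof -
  have "(1 + x)\<^sup>2 \<le> 2 + 2 * x\<^sup>2" using sum_squares_bound[of 1 x] by (simp add: power2_sum)
  then have "ennreal ((1 + x)\<^sup>2) \<le> ennreal (2 + 2 * x\<^sup>2)" by (rule ennreal_leI)
  also have "\<dots> = 2 + 2 * ennreal (x\<^sup>2)" by (simp add: ennreal_mult)
  finally show ?thesis .
qed

abbreviation exp_rate :: "real \<Rightarrow> ennreal" where
  "exp_rate t \<equiv> ennreal (exp (rate * t))"

lemma one_le_exp: "0 \<le> t \<Longrightarrow> 1 \<le> exp_rate t"
  using rate_ge(1) by (auto simp: ennreal_1[symmetric] simp del: ennreal_1)

lemma two_le_exp: "0 \<le> t \<Longrightarrow> 2 \<le> 2 * exp_rate t"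
  using mult_left_mono[OF one_le_exp, of t 2] by simp

text \<open>Second moments up to a stopping time \<open>\<tau>\<close> from a localizing sequence. Before \<open>\<tau>\<close> the noise is a
  square integrable Ito integral, so that all quantities in the Gronwall argument are finite. The resulting
  bound does not depend on \<open>\<tau>\<close>.\<close>

context
  fixes \<tau> :: "'a \<Rightarrow> real"
  assumes stop: "nonneg_stopping_time M F \<tau>"
    and stopped_ito: "ito_integral_L2 M F B (\<lambda>r \<omega>. indicat_real {0..\<tau> \<omega>} r *\<^sub>R H r \<omega>) (\<lambda>t \<omega>. I (min t (\<tau> \<omega>)) \<omega>)"
begin

definition stopped_norm :: "real \<Rightarrow> 'a \<Rightarrow> real" where
  "stopped_norm r \<omega> = indicat_real {0..\<tau> \<omega>} r * norm (Y r \<omega>)"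

definition stopped_growth :: "real \<Rightarrow> 'a \<Rightarrow> real" where
  "stopped_growth r \<omega> = indicat_real {0..\<tau> \<omega>} r * (1 + norm (Y r \<omega>))"

abbreviation stopped_noise :: "real \<Rightarrow> 'a \<Rightarrow> ennreal" where
  "stopped_noise t \<omega> \<equiv> sqn (I (min t (\<tau> \<omega>)) \<omega>)"

abbreviation stopped_energy :: "real \<Rightarrow> ennreal" where
  "stopped_energy t \<equiv> energy 0 t (\<lambda>r \<omega>. indicat_real {0..\<tau> \<omega>} r *\<^sub>R H r \<omega>)"

abbreviation path_conv :: "real \<Rightarrow> 'a \<Rightarrow> ennreal" where
  "path_conv t \<omega> \<equiv> exp_conv (\<lambda>r. ennreal ((stopped_growth r \<omega>)\<^sup>2)) t"

lemma stopped_joint: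
  "(\<lambda>(r, \<omega>). stopped_norm r \<omega>) \<in> borel_measurable (borel \<Otimes>\<^sub>M M)"
  "(\<lambda>(r, \<omega>). stopped_growth r \<omega>) \<in> borel_measurable (borel \<Otimes>\<^sub>M M)"
proof -
  have [measurable]: "\<tau> \<in> borel_measurable M" by (rule nonneg_stopping_time_measurable[OF stop])
  have [measurable]: "(\<lambda>x. indicat_real {0..\<tau> (snd x)} (fst x)) \<in> borel_measurable (borel \<Otimes>\<^sub>M M)"
    unfolding indicator_def atLeastAtMost_iff by measurable
  have [measurable]: "(\<lambda>x. Y (fst x) (snd x)) \<in> borel_measurable (borel \<Otimes>\<^sub>M M)"
    using Y_joint by (simp add: split_def)
  show "(\<lambda>(r, \<omega>). stopped_norm r \<omega>) \<in> borel_measurable (borel \<Otimes>\<^sub>M M)"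
    "(\<lambda>(r, \<omega>). stopped_growth r \<omega>) \<in> borel_measurable (borel \<Otimes>\<^sub>M M)"
    unfolding stopped_norm_def stopped_growth_def split_def by measurable
qed

lemma stopped_growth_sq_le: "ennreal ((stopped_growth r \<omega>)\<^sup>2) \<le> 2 + 2 * ennreal ((stopped_norm r \<omega>)\<^sup>2)"
  using one_plus_square_le[of "norm (Y r \<omega>)"]
  by (auto simp: stopped_growth_def stopped_norm_def split: split_indicator)

lemma stopped_noise_measurable: "0 \<le> t \<Longrightarrow> stopped_noise t \<in> borel_measurable M"
proof -
  assume t: "0 \<le> t"
  have "adapted_process F (\<lambda>t \<omega>. I (min t (\<tau> \<omega>)) \<omega>)" using stopped_ito unfolding ito_integral_L2_def by blast
  from process_adapted_measurable[OF this t] show ?thesis by measurable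
qed

text \<open>The equation at a time before \<open>\<tau>\<close>, where stopping changes neither the drift up to that time nor the
  noise; after \<open>\<tau>\<close> the left-hand side is zero.\<close>

lemma stopped_path_bound:
  "AE \<omega> in M. \<forall>t\<ge>0. ennreal ((stopped_norm t \<omega>)\<^sup>2)
     \<le> 2 * sqn y0 + 4 * (ennreal (K\<^sup>2) * path_conv t \<omega>) + 4 * stopped_noise t \<omega>"
  using drift_integrable equation AE_space
proof (eventually_elim, intro allI impI)
  fix \<omega> t
  assume int: "\<forall>t\<ge>0. set_integrable lborel {0..t} (\<lambda>r. b r (Y r \<omega>))"
    and eq: "\<forall>t\<ge>0. Y t \<omega> = y0 + (LINT r:{0..t}|lborel. b r (Y r \<omega>)) + I t \<omega>"
    and \<omega>: "\<omega> \<in> space M" and t: "0 \<le> (t::real)"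
  let ?k = "ennreal (K\<^sup>2)"
  show "ennreal ((stopped_norm t \<omega>)\<^sup>2) \<le> 2 * sqn y0 + 4 * (?k * path_conv t \<omega>) + 4 * stopped_noise t \<omega>"
  proof (cases "t \<le> \<tau> \<omega>")
    case False
    then show ?thesis by (simp add: stopped_norm_def)
  next
    case True
    let ?d = "\<integral>\<^sup>+r\<in>{0<..t}. ennreal (stopped_growth r \<omega>) \<partial>lborel"
    let ?L = "LINT r:{0..t}|lborel. b r (Y r \<omega>)"
    have D[measurable]: "(\<lambda>r. stopped_growth r \<omega>) \<in> borel_measurable borel"
      by (rule joint_section_measurable(2)[OF stopped_joint(2) \<omega>])
    have nn: "0 \<le> stopped_growth r \<omega>" for r by (simp add: stopped_growth_def)
    have "norm (b r (Y r \<omega>)) \<le> K * stopped_growth r \<omega>" if "0 < r" "r \<le> t" for r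
      using that True norm_b_le[of r "Y r \<omega>"] by (simp add: stopped_growth_def)
    then have drift: "ennreal (norm ?L) \<le> ennreal K * ?d"
      using K_pos int t by (intro norm_drift_le D) auto
    have "norm (Y t \<omega>) \<le> norm y0 + norm ?L + norm (I t \<omega>)"
      using eq t order_trans[OF norm_triangle_ineq add_right_mono[OF norm_triangle_ineq]] by simp
    then have "ennreal (norm (Y t \<omega>)) \<le> ennreal (norm y0 + norm ?L + norm (I t \<omega>))" by (rule ennreal_leI)
    also have "\<dots> = ennreal (norm y0) + ennreal (norm ?L) + ennreal (norm (I t \<omega>))" by simp
    also have "\<dots> \<le> ennreal (norm y0) + ennreal K * ?d + ennreal (norm (I t \<omega>))"
      by (intro add_mono drift order_refl)
    finally have le: "ennreal (norm (Y t \<omega>)) \<le> ennreal (norm y0) + ennreal K * ?d + ennreal (norm (I t \<omega>))" .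
    have "ennreal ((stopped_norm t \<omega>)\<^sup>2) = (ennreal (norm (Y t \<omega>)))\<^sup>2"
      using True t by (simp add: stopped_norm_def ennreal_power)
    also have "\<dots> \<le> (ennreal (norm y0) + ennreal K * ?d + ennreal (norm (I t \<omega>)))\<^sup>2"
      using le by (rule power_mono) simp
    also have "\<dots> \<le> 2 * (ennreal (norm y0))\<^sup>2 + 4 * (ennreal K * ?d)\<^sup>2 + 4 * (ennreal (norm (I t \<omega>)))\<^sup>2"
      by (rule ennreal_square_add3_le)
    also have "\<dots> = 2 * sqn y0 + 4 * (?k * ?d\<^sup>2) + 4 * stopped_noise t \<omega>"
      using True K_pos by (simp add: power_mult_distrib ennreal_power)
    also have "\<dots> \<le> 2 * sqn y0 + 4 * (?k * path_conv t \<omega>) + 4 * stopped_noise t \<omega>"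
      using nn_integral_square_le_exp[of "\<lambda>r. ennreal (stopped_growth r \<omega>)" t] t
      by (intro add_mono mult_left_mono order_refl) (auto simp: ennreal_power nn)
    finally show ?thesis .
  qed
qed

lemma stopped_energy_le: "stopped_energy t \<le> ennreal (K\<^sup>2) * (\<integral>\<^sup>+r\<in>{0<..t}. second_moment stopped_growth r \<partial>lborel)"
proof (rule energy_le_second_moment[OF stopped_joint(2)])
  show "AE \<omega> in M. \<forall>r\<in>{0<..t}. norm (indicat_real {0..\<tau> \<omega>} r *\<^sub>R H r \<omega>) \<le> K * stopped_growth r \<omega>"
    using H_eq
  proof eventually_elim
    case (elim \<omega>)
    then show ?case using norm_\<sigma>_le by (auto simp: stopped_growth_def split: split_indicator)
  qed
qed

lemma stopped_noise_le:
  assumes t: "0 \<le> t"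
  shows "(\<integral>\<^sup>+\<omega>. stopped_noise t \<omega> \<partial>M) \<le> 16 * stopped_energy t"
proof -
  obtain W :: "'a \<Rightarrow> ennreal" where W: "AE \<omega> in M. \<forall>u\<in>{0..t}. stopped_noise u \<omega> \<le> W \<omega>"
    "(\<integral>\<^sup>+\<omega>. W \<omega> \<partial>M) \<le> 16 * stopped_energy t"
    using ito_L2_sup[OF stopped_ito t] by blast
  have "(\<integral>\<^sup>+\<omega>. stopped_noise t \<omega> \<partial>M) \<le> (\<integral>\<^sup>+\<omega>. W \<omega> \<partial>M)"
    using W(1) t by (intro nn_integral_mono_AE) auto
  then show ?thesis using W(2) by (rule order_trans)
qed

text \<open>Gronwall's inequality in expectation needs a finite a priori bound. It is obtained from
  Gronwall's inequality on each path, where finiteness holds by continuity: the squared noise is dominated by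
  one integrable variable \<open>W\<close> up to time \<open>t\<close>.\<close>

lemma stopped_second_moment_bounded:
  assumes t: "0 \<le> t"
  obtains m where "m < \<top>" "\<And>u. 0 \<le> u \<Longrightarrow> u \<le> t \<Longrightarrow> second_moment stopped_norm u \<le> m"
proof -
  let ?k = "ennreal (K\<^sup>2)"
  obtain W :: "'a \<Rightarrow> ennreal" where Wm[measurable]: "W \<in> borel_measurable M"
    and W: "AE \<omega> in M. \<forall>u\<in>{0..t}. stopped_noise u \<omega> \<le> W \<omega>" and EW: "(\<integral>\<^sup>+\<omega>. W \<omega> \<partial>M) \<le> 16 * stopped_energy t"
    using ito_L2_sup[OF stopped_ito t] by blast
  let ?A = "\<lambda>\<omega>. 2 * sqn y0 + 8 * ?k + 4 * W \<omega>"
  define m where "m = (\<integral>\<^sup>+\<omega>. 2 * ?A \<omega> * exp_rate t \<partial>M)"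
  have "stopped_energy t \<le> (\<integral>\<^sup>+\<omega>. (\<integral>\<^sup>+r\<in>{0..t}. sqn (indicat_real {0..\<tau> \<omega>} r *\<^sub>R H r \<omega>) \<partial>lborel) \<partial>M)"
    unfolding energy_def by (intro nn_integral_mono) (auto split: split_indicator)
  also have "\<dots> < \<infinity>" using stopped_ito t unfolding ito_integral_L2_def by blast
  finally have "16 * stopped_energy t < \<top>" by (simp add: ennreal_mult_less_top)
  then have "(\<integral>\<^sup>+\<omega>. W \<omega> \<partial>M) < \<top>" using EW by (rule le_less_trans[rotated])
  moreover have "m = 2 * (2 * sqn y0 + 8 * ?k + 4 * (\<integral>\<^sup>+\<omega>. W \<omega> \<partial>M)) * exp_rate t"
    unfolding m_def by (simp add: nn_integral_multc nn_integral_cmult nn_integral_add emeasure_space_1)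
  ultimately have "m < \<top>" by (simp add: ennreal_mult_less_top)
  moreover have "second_moment stopped_norm u \<le> m" if u: "0 \<le> u" "u \<le> t" for u
    unfolding second_moment_def m_def
  proof (rule nn_integral_mono_AE)
    show "AE \<omega> in M. ennreal ((stopped_norm u \<omega>)\<^sup>2) \<le> 2 * ?A \<omega> * exp_rate t"
      using stopped_path_bound W AE_space
    proof eventually_elim
      case (elim \<omega>)
      let ?f = "\<lambda>r. ennreal ((stopped_norm r \<omega>)\<^sup>2)"
      have f: "?f \<in> borel_measurable borel"
        using joint_section_measurable(2)[OF stopped_joint(1) elim(3)] by measurable
      have "compact ((\<lambda>r. norm (Y r \<omega>)) ` {0..t})"
        by (intro compact_continuous_image continuous_on_norm continuous_on_subset[OF Y_continuous]) auto
      then have "bounded ((\<lambda>r. norm (Y r \<omega>)) ` {0..t})" by (rule compact_imp_bounded)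
      then obtain c where c: "\<And>r. r \<in> {0..t} \<Longrightarrow> norm (Y r \<omega>) \<le> c"
        unfolding bounded_iff by force
      have "?f u \<le> 2 * ?A \<omega> * exp_rate u"
      proof (rule gronwall_exp[where f="?f" and T=t and C="8 * K\<^sup>2" and m="ennreal (c\<^sup>2)"])
        show "0 < 8 * K\<^sup>2" using K_pos by simp
        show "2 * (8 * K\<^sup>2) + 1 \<le> rate" by (rule rate_ge)
        fix r assume r: "0 \<le> r" "r \<le> t"
        have "(stopped_norm r \<omega>)\<^sup>2 \<le> (norm (Y r \<omega>))\<^sup>2" by (auto simp: stopped_norm_def split: split_indicator)
        also have "\<dots> \<le> c\<^sup>2" using c[of r] r by (intro power_mono) auto
        finally show "?f r \<le> ennreal (c\<^sup>2)" by (rule ennreal_leI)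
        have "path_conv r \<omega> \<le> 2 * exp_rate r + 2 * exp_conv ?f r"
        proof (rule nn_integral_exp_conv_le[OF rate_ge(1) r(1) f])
          fix u :: real assume "0 < u"
          then show "ennreal ((stopped_growth u \<omega>)\<^sup>2) \<le> 2 * exp_rate u + 2 * ?f u"
            using stopped_growth_sq_le[of u \<omega>] two_le_exp[of u] by (meson add_right_mono less_imp_le order_trans)
        qed
        then have "?f r \<le> 2 * sqn y0 + 4 * (?k * (2 * exp_rate r + 2 * exp_conv ?f r)) + 4 * W \<omega>"
          using elim(1,2) r by (meson add_mono atLeastAtMost_iff mult_left_mono order_refl order_trans zero_le)
        also have "\<dots> = (2 * sqn y0 + 4 * W \<omega>) * 1 + 8 * ?k * exp_rate r + ennreal (8 * K\<^sup>2) * exp_conv ?f r"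
        proof -
          have arith: "4 * (k * (2 * e + 2 * c)) = 8 * k * e + 8 * k * c" for k e c :: ennreal
            by (simp add: ring_distribs mult.left_commute[of k 2] mult.assoc)
          have k8: "ennreal (8 * K\<^sup>2) = 8 * ?k" by (simp add: ennreal_mult)
          show ?thesis unfolding arith k8 mult_1_right by (simp only: ac_simps)
        qed
        also have "\<dots> \<le> (2 * sqn y0 + 4 * W \<omega>) * exp_rate r + 8 * ?k * exp_rate r + ennreal (8 * K\<^sup>2) * exp_conv ?f r"
          by (intro add_right_mono mult_left_mono one_le_exp r) auto
        also have "\<dots> = ?A \<omega> * exp_rate r + ennreal (8 * K\<^sup>2) * exp_conv ?f r"
          by (simp add: ring_distribs ac_simps)
        finally show "?f r \<le> ?A \<omega> * exp_rate r + ennreal (8 * K\<^sup>2) * exp_conv ?f r" .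
      qed (use u in auto)
      also have "\<dots> \<le> 2 * ?A \<omega> * exp_rate t"
        using u rate_ge(1) by (intro mult_left_mono ennreal_leI) auto
      finally show ?case .
    qed
  qed
  ultimately show ?thesis by (rule that)
qed

text \<open>The constant is \<open>136 = 2 (4 + 4 \<cdot> 16)\<close>, from the weights in \<open>stopped_path_bound\<close>, the constant of the
  maximal estimate and \<open>(1 + x)\<^sup>2 \<le> 2 + 2 x\<^sup>2\<close>.\<close>

lemma stopped_second_moment_rec:
  assumes t: "0 \<le> t"
  defines "h \<equiv> second_moment stopped_norm"
  shows "h t \<le> ennreal moment_const * exp_rate t + ennreal (136 * K\<^sup>2) * exp_conv h t"
proof -
  let ?k = "ennreal (K\<^sup>2)" and ?C = "exp_conv (second_moment stopped_growth) t"
  have hm: "h \<in> borel_measurable borel"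
    unfolding h_def by (rule Fubini_second_moment(2)[OF stopped_joint(1), of "\<lambda>_. 0"]) simp
  have growth_h: "second_moment stopped_growth r \<le> 2 + 2 * h r" for r
  proof -
    have "second_moment stopped_growth r \<le> (\<integral>\<^sup>+\<omega>. 2 + 2 * ennreal ((stopped_norm r \<omega>)\<^sup>2) \<partial>M)"
      unfolding second_moment_def by (intro nn_integral_mono stopped_growth_sq_le)
    also have "\<dots> = 2 + 2 * h r"
      unfolding h_def second_moment_def using joint_section_measurable(1)[OF stopped_joint(1), of r]
      by (subst nn_integral_add) (auto simp: nn_integral_cmult emeasure_space_1)
    finally show ?thesis .
  qed
  have "h t \<le> (\<integral>\<^sup>+\<omega>. 2 * sqn y0 + 4 * (?k * path_conv t \<omega>) + 4 * stopped_noise t \<omega> \<partial>M)"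
    unfolding h_def second_moment_def using stopped_path_bound t by (intro nn_integral_mono_AE) auto
  also have "\<dots> = 2 * sqn y0 + 4 * (?k * (\<integral>\<^sup>+\<omega>. path_conv t \<omega> \<partial>M)) + 4 * (\<integral>\<^sup>+\<omega>. stopped_noise t \<omega> \<partial>M)"
  proof -
    have lin: "(\<integral>\<^sup>+\<omega>. 2 * sqn y0 + 4 * (?k * c \<omega>) + 4 * i \<omega> \<partial>M)
        = 2 * sqn y0 + 4 * (?k * (\<integral>\<^sup>+\<omega>. c \<omega> \<partial>M)) + 4 * (\<integral>\<^sup>+\<omega>. i \<omega> \<partial>M)"
      if [measurable]: "c \<in> borel_measurable M" "i \<in> borel_measurable M" for c i :: "'a \<Rightarrow> ennreal"
      by (simp add: nn_integral_add nn_integral_cmult emeasure_space_1)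
    show ?thesis
      using stopped_joint(2)
      by (intro lin stopped_noise_measurable t path_integral_measurable) (simp add: split_def)
  qed
  also have "(\<integral>\<^sup>+\<omega>. path_conv t \<omega> \<partial>M) = ?C"
    by (intro Fubini_second_moment(1) stopped_joint) measurable
  also have "(\<integral>\<^sup>+\<omega>. stopped_noise t \<omega> \<partial>M) \<le> 16 * (?k * ?C)"
  proof -
    have "stopped_energy t \<le> ?k * ?C"
      using stopped_energy_le[of t] nn_integral_le_exp_conv by (rule order_trans[OF _ mult_left_mono]) simp
    then show ?thesis
      using stopped_noise_le[OF t] by (meson mult_left_mono order_trans zero_le)
  qed
  also have "2 * sqn y0 + 4 * (?k * ?C) + 4 * (16 * (?k * ?C)) = 2 * sqn y0 + 68 * ?k * ?C"
    by (simp add: add.assoc distrib_right[symmetric] mult.assoc[symmetric])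
  also have "?C \<le> 2 * exp_rate t + 2 * exp_conv h t"
  proof (rule nn_integral_exp_conv_le[OF rate_ge(1) t hm])
    fix r :: real assume "0 < r"
    then show "second_moment stopped_growth r \<le> 2 * exp_rate r + 2 * h r"
      using growth_h[of r] two_le_exp[of r] by (meson add_right_mono less_imp_le order_trans)
  qed
  also have "2 * sqn y0 + 68 * ?k * (2 * exp_rate t + 2 * exp_conv h t)
      = 2 * sqn y0 + ennreal (136 * K\<^sup>2) * exp_rate t + ennreal (136 * K\<^sup>2) * exp_conv h t"
  proof -
    have "ennreal (136 * K\<^sup>2) = 68 * ?k * 2" by (simp add: ennreal_mult mult.commute[of _ 2] mult.assoc[symmetric])
    then show ?thesis by (simp add: ring_distribs mult.assoc add.assoc)
  qed
  also have "2 * sqn y0 + ennreal (136 * K\<^sup>2) * exp_rate t \<le> ennreal moment_const * exp_rate t"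
  proof -
    have "2 * sqn y0 * 1 \<le> 2 * sqn y0 * exp_rate t"
      by (intro mult_left_mono one_le_exp t) auto
    moreover have "ennreal moment_const = 2 * sqn y0 + ennreal (136 * K\<^sup>2)"
      by (simp add: moment_const_def ennreal_mult)
    ultimately show ?thesis by (simp add: ring_distribs add_right_mono)
  qed
  finally show ?thesis by (simp add: add_right_mono mult_left_mono)
qed

lemma stopped_second_moment:
  assumes t: "0 \<le> t"
  shows "second_moment stopped_norm t \<le> 2 * ennreal moment_const * exp_rate t"
proof -
  obtain m where m: "m < \<top>" "\<And>u. 0 \<le> u \<Longrightarrow> u \<le> t \<Longrightarrow> second_moment stopped_norm u \<le> m"
    using stopped_second_moment_bounded[OF t] by blast
  show ?thesis
  proof (rule gronwall_exp[where T=t and C="136 * K\<^sup>2" and m=m])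
    show "0 < 136 * K\<^sup>2" using K_pos by simp
  qed (use rate_ge(3) stopped_second_moment_rec m t in auto)
qed

end

text \<open>Fatou's lemma along the localizing sequence.\<close>

lemma second_moment_solution:
  assumes t: "0 \<le> t"
  shows "second_moment (\<lambda>r \<omega>. norm (Y r \<omega>)) t \<le> 2 * ennreal moment_const * exp_rate t"
proof -
  obtain \<tau> where stop: "\<And>n. nonneg_stopping_time M F (\<tau> n)"
    and \<tau>_lim: "AE \<omega> in M. incseq (\<lambda>n. \<tau> n \<omega>) \<and> filterlim (\<lambda>n. \<tau> n \<omega>) at_top sequentially"
    and L2: "\<And>n. ito_integral_L2 M F B (\<lambda>r \<omega>. indicat_real {0..\<tau> n \<omega>} r *\<^sub>R H r \<omega>) (\<lambda>t \<omega>. I (min t (\<tau> n \<omega>)) \<omega>)"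
    using ito unfolding ito_integral_def by blast
  let ?N = "\<lambda>n \<omega>. ennreal ((indicat_real {0..\<tau> n \<omega>} t * norm (Y t \<omega>))\<^sup>2)"
  have NM: "?N n \<in> borel_measurable M" for n
    using nonneg_stopping_time_measurable[OF stop, of n] Y_measurable[of t]
    unfolding indicator_def atLeastAtMost_iff by measurable
  have "second_moment (\<lambda>r \<omega>. norm (Y r \<omega>)) t \<le> (\<integral>\<^sup>+\<omega>. liminf (\<lambda>n. ?N n \<omega>) \<partial>M)"
    unfolding second_moment_def
  proof (rule nn_integral_mono_AE)
    show "AE \<omega> in M. sqn (Y t \<omega>) \<le> liminf (\<lambda>n. ?N n \<omega>)"
      using \<tau>_lim
    proof eventually_elim
      case (elim \<omega>)
      then have "\<forall>\<^sub>F n in sequentially. t \<le> \<tau> n \<omega>" by (simp add: filterlim_at_top)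
      then have "\<forall>\<^sub>F n in sequentially. sqn (Y t \<omega>) \<le> ?N n \<omega>"
        by eventually_elim (use t in simp)
      then show ?case by (rule Liminf_bounded)
    qed
  qed
  also have "\<dots> \<le> liminf (\<lambda>n. \<integral>\<^sup>+\<omega>. ?N n \<omega> \<partial>M)"
    by (intro nn_integral_liminf NM)
  also have "\<dots> \<le> liminf (\<lambda>n::nat. 2 * ennreal moment_const * exp_rate t)"
    using stopped_second_moment[OF stop L2 t] unfolding second_moment_def stopped_norm_def[OF stop L2]
    by (intro Liminf_mono always_eventually allI) simp
  also have "\<dots> = 2 * ennreal moment_const * exp_rate t" by (simp add: Liminf_const)
  finally show ?thesis .
qed

definition growth_const :: real where "growth_const = 2 + 4 * moment_const"

lemma growth_const_nonneg: "0 \<le> growth_const"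
  by (simp add: growth_const_def moment_const_def)

lemma second_moment_growth:
  assumes t: "0 \<le> t"
  shows "second_moment (\<lambda>r \<omega>. 1 + norm (Y r \<omega>)) t \<le> ennreal growth_const * exp_rate t"
proof -
  have "second_moment (\<lambda>r \<omega>. 1 + norm (Y r \<omega>)) t \<le> (\<integral>\<^sup>+\<omega>. 2 + 2 * sqn (Y t \<omega>) \<partial>M)"
    unfolding second_moment_def by (intro nn_integral_mono one_plus_square_le)
  also have "\<dots> = 2 + 2 * second_moment (\<lambda>r \<omega>. norm (Y r \<omega>)) t"
    unfolding second_moment_def using Y_measurable[of t]
    by (subst nn_integral_add) (auto simp: nn_integral_cmult emeasure_space_1)
  also have "\<dots> \<le> 2 * exp_rate t + 2 * (2 * ennreal moment_const * exp_rate t)"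
    by (intro add_mono two_le_exp t mult_left_mono second_moment_solution) auto
  also have "\<dots> = ennreal growth_const * exp_rate t"
  proof -
    have "ennreal growth_const = 2 + 4 * ennreal moment_const"
      by (simp add: growth_const_def ennreal_mult moment_const_def del: ennreal_plus) 
         (simp add: ennreal_plus ennreal_mult)
    then show ?thesis by (simp add: ring_distribs mult.assoc[symmetric])
  qed
  finally show ?thesis .
qed

lemma growth_joint: "(\<lambda>(r, \<omega>). 1 + norm (Y r \<omega>)) \<in> borel_measurable (borel \<Otimes>\<^sub>M M)"
  using Y_joint by (simp add: split_def)

text \<open>The drift contributes \<open>(t - s)\<^sup>2\<close>, which the restriction to unit intervals reduces to \<open>t - s\<close>, and the
  noise contributes \<open>t - s\<close> by the maximal estimate for the Ito integral.\<close>

lemma increment_second_moment: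
  assumes st: "0 \<le> s" "s \<le> t" "t \<le> s + 1"
  shows "(\<integral>\<^sup>+\<omega>. sqn (Y t \<omega> - Y s \<omega>) \<partial>M)
    \<le> ennreal (34 * K\<^sup>2 * growth_const) * (ennreal (t - s) * exp_rate t)"
proof -
  let ?D = "\<lambda>r \<omega>. 1 + norm (Y r \<omega>)"
  let ?d = "\<lambda>\<omega>. \<integral>\<^sup>+r\<in>{s<..t}. ennreal (?D r \<omega>) \<partial>lborel"
  let ?i = "\<lambda>\<omega>. sqn (I t \<omega> - I s \<omega>)"
  let ?k = "ennreal (K\<^sup>2)" and ?S = "\<integral>\<^sup>+r\<in>{s<..t}. second_moment ?D r \<partial>lborel"
  have path: "AE \<omega> in M. sqn (Y t \<omega> - Y s \<omega>) \<le> 2 * (?k * (?d \<omega>)\<^sup>2) + 2 * ?i \<omega>"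
    using drift_integrable equation AE_space
  proof eventually_elim
    case (elim \<omega>)
    let ?b = "\<lambda>r. b r (Y r \<omega>)"
    have [measurable]: "(\<lambda>r. Y r \<omega>) \<in> borel_measurable borel"
      by (rule joint_section_measurable(2)[OF Y_joint elim(3)])
    have int_t: "set_integrable lborel {0..t} ?b" using elim(1) st by auto
    have int: "set_integrable lborel {0..s} ?b" "set_integrable lborel {s<..t} ?b"
      using st by (auto intro!: set_integrable_subset[OF int_t])
    have "{0..t} = {0..s} \<union> {s<..t}" using st by auto
    moreover have "{0..s} \<inter> {s<..t} = {}" by auto
    ultimately have "(LINT r:{0..t}|lborel. ?b r) = (LINT r:{0..s}|lborel. ?b r) + (LINT r:{s<..t}|lborel. ?b r)"
      using set_integral_Un[OF _ int] by simp
    then have eq: "Y t \<omega> - Y s \<omega> = (LINT r:{s<..t}|lborel. ?b r) + (I t \<omega> - I s \<omega>)"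
      using elim(2) st by (simp add: algebra_simps)
    have drift: "ennreal (norm (LINT r:{s<..t}|lborel. ?b r)) \<le> ennreal K * ?d \<omega>"
      using K_pos st by (intro norm_drift_le[OF int(2)] norm_b_le) auto
    have "sqn (Y t \<omega> - Y s \<omega>) \<le> ennreal (2 * (norm (LINT r:{s<..t}|lborel. ?b r))\<^sup>2 + 2 * (norm (I t \<omega> - I s \<omega>))\<^sup>2)"
      unfolding eq by (intro ennreal_leI norm_add_sq_le)
    also have "\<dots> = 2 * (ennreal (norm (LINT r:{s<..t}|lborel. ?b r)))\<^sup>2 + 2 * ?i \<omega>"
      by (simp add: ennreal_mult ennreal_power)
    also have "\<dots> \<le> 2 * (ennreal K * ?d \<omega>)\<^sup>2 + 2 * ?i \<omega>"
      by (intro add_right_mono mult_left_mono power_mono drift) auto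
    also have "\<dots> = 2 * (?k * (?d \<omega>)\<^sup>2) + 2 * ?i \<omega>"
      using K_pos by (simp add: power_mult_distrib ennreal_power)
    finally show ?case .
  qed
  have dM: "?d \<in> borel_measurable M"
    using growth_joint by (intro path_integral_measurable) (simp add: split_def)
  have iM: "?i \<in> borel_measurable M"
  proof -
    have "adapted_process F I" using ito by (simp add: ito_integral_def)
    then have "I t \<in> borel_measurable M" "I s \<in> borel_measurable M"
      using st by (auto intro: process_adapted_measurable)
    then show ?thesis by measurable
  qed
  have norm_H: "AE \<omega> in M. \<forall>r\<in>{s<..t}. norm (H r \<omega>) \<le> K * ?D r \<omega>"
    using H_eq by eventually_elim (use st norm_\<sigma>_le in auto)
  have Ei: "(\<integral>\<^sup>+\<omega>. ?i \<omega> \<partial>M) \<le> 16 * (?k * ?S)"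
    using ito_increment[OF ito st(1,2)] energy_le_second_moment[OF growth_joint norm_H]
    by (meson mult_left_mono order_trans zero_le)
  have Ed: "(\<integral>\<^sup>+\<omega>. (?d \<omega>)\<^sup>2 \<partial>M) \<le> ?S"
  proof -
    have "(\<integral>\<^sup>+\<omega>. (?d \<omega>)\<^sup>2 \<partial>M) \<le> ennreal (t - s) * ?S"
      by (rule drift_square_le_length[OF growth_joint _ st(2)]) simp
    also have "\<dots> \<le> 1 * ?S" using st by (intro mult_right_mono) (auto simp: ennreal_le_1)
    finally show ?thesis by simp
  qed
  have S: "?S \<le> ennreal growth_const * (ennreal (t - s) * exp_rate t)"
  proof -
    have "?S \<le> (\<integral>\<^sup>+r. ennreal growth_const * exp_rate t * indicator {s<..t} r \<partial>lborel)"
    proof (intro nn_integral_mono)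
      fix r
      have "second_moment ?D r \<le> ennreal growth_const * exp_rate t" if "r \<in> {s<..t}"
      proof -
        have "second_moment ?D r \<le> ennreal growth_const * exp_rate r"
          using that st by (intro second_moment_growth) auto
        also have "\<dots> \<le> ennreal growth_const * exp_rate t"
          using that rate_ge(1) by (intro mult_left_mono ennreal_leI) auto
        finally show ?thesis .
      qed
      then show "second_moment ?D r * indicator {s<..t} r \<le> ennreal growth_const * exp_rate t * indicator {s<..t} r"
        by (auto split: split_indicator)
    qed
    also have "\<dots> = ennreal growth_const * (ennreal (t - s) * exp_rate t)"
      using st by (subst nn_integral_cmult) (auto simp: ac_simps)
    finally show ?thesis .
  qed
  have "(\<integral>\<^sup>+\<omega>. sqn (Y t \<omega> - Y s \<omega>) \<partial>M) \<le> (\<integral>\<^sup>+\<omega>. 2 * (?k * (?d \<omega>)\<^sup>2) + 2 * ?i \<omega> \<partial>M)"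
    using path by (rule nn_integral_mono_AE)
  also have "\<dots> = 2 * (?k * (\<integral>\<^sup>+\<omega>. (?d \<omega>)\<^sup>2 \<partial>M)) + 2 * (\<integral>\<^sup>+\<omega>. ?i \<omega> \<partial>M)"
    by (rule nn_integral_drift_noise[OF dM iM])
  also have "\<dots> \<le> 2 * (?k * ?S) + 2 * (16 * (?k * ?S))"
    by (intro add_mono mult_left_mono Ed Ei) auto
  also have "\<dots> = ennreal (34 * K\<^sup>2) * ?S"
    by (simp add: ennreal_mult distrib_right[symmetric] mult.assoc[symmetric])
  also have "\<dots> \<le> ennreal (34 * K\<^sup>2) * (ennreal growth_const * (ennreal (t - s) * exp_rate t))"
    by (intro mult_left_mono S) auto
  also have "\<dots> = ennreal (34 * K\<^sup>2 * growth_const) * (ennreal (t - s) * exp_rate t)"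
    using growth_const_nonneg by (simp add: ennreal_mult mult.assoc)
  finally show ?thesis .
qed

end

section \<open>The error of the Euler--Maruyama process\<close>

text \<open>The index \<open>k\<close> with \<open>k \<delta> < r \<le> (k + 1) \<delta>\<close>. Half-open cells with the right endpoint included match the
  convention for simple integrands, which are left-continuous in time. At \<open>r = 0\<close> the conversion to a
  natural number yields \<open>0\<close>, so that time zero is its own grid point.\<close>

definition step_index :: "real \<Rightarrow> real \<Rightarrow> nat" where
  "step_index \<delta> r = nat (\<lceil>r / \<delta>\<rceil> - 1)"

lemma step_index_bounds:
  assumes "0 < \<delta>" "0 < r"
  shows "real (step_index \<delta> r) * \<delta> < r" "r \<le> real (Suc (step_index \<delta> r)) * \<delta>"
proof -
  have "0 < r / \<delta>" using assms by simp
  then have c: "1 \<le> \<lceil>r / \<delta>\<rceil>" by linarith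
  then have k: "real (step_index \<delta> r) = real_of_int \<lceil>r / \<delta>\<rceil> - 1" by (simp add: step_index_def)
  have "real (step_index \<delta> r) < r / \<delta>" "r / \<delta> \<le> real (Suc (step_index \<delta> r))"
    unfolding of_nat_Suc k by linarith+
  then show "real (step_index \<delta> r) * \<delta> < r" "r \<le> real (Suc (step_index \<delta> r)) * \<delta>"
    using assms by (auto simp: pos_less_divide_eq pos_divide_le_eq)
qed

lemma mem_step_iff:
  assumes "0 < \<delta>" "0 < r"
  shows "r \<in> {real k * \<delta><..real (Suc k) * \<delta>} \<longleftrightarrow> k = step_index \<delta> r"
proof
  assume "r \<in> {real k * \<delta><..real (Suc k) * \<delta>}"
  then have "real k * \<delta> < real (Suc (step_index \<delta> r)) * \<delta>" "real (step_index \<delta> r) * \<delta> < real (Suc k) * \<delta>"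
    using step_index_bounds[OF assms] by auto
  then have "real k < real (Suc (step_index \<delta> r))" "real (step_index \<delta> r) < real (Suc k)"
    using assms by (simp_all only: mult_less_cancel_right_pos)
  then show "k = step_index \<delta> r" by linarith
qed (use step_index_bounds[OF assms] in auto)

lemma sum_step_indicator:
  fixes f :: "nat \<Rightarrow> 'v::real_vector"
  assumes "0 < \<delta>" "0 < r" "r \<le> real N * \<delta>"
  shows "(\<Sum>k<N. indicat_real {real k * \<delta><..real (Suc k) * \<delta>} r *\<^sub>R f k) = f (step_index \<delta> r)"
proof -
  have "real (step_index \<delta> r) * \<delta> < real N * \<delta>" using step_index_bounds(1)[OF assms(1,2)] assms by linarith
  then have N: "step_index \<delta> r < N" using assms by (simp add: mult_less_cancel_right_pos)
  have "(\<Sum>k<N. indicat_real {real k * \<delta><..real (Suc k) * \<delta>} r *\<^sub>R f k) = (\<Sum>k<N. if k = step_index \<delta> r then f k else 0)"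
    unfolding indicator_def mem_step_iff[OF assms(1,2)] by (intro sum.cong) auto
  also have "\<dots> = f (step_index \<delta> r)" using N by simp
  finally show ?thesis .
qed

lemma integrable_square_of_linear_growth:
  fixes Z :: "'a \<Rightarrow> 'b::euclidean_space" and f :: "'a \<Rightarrow> 'c::euclidean_space"
  assumes "finite_measure M" and [measurable]: "f \<in> borel_measurable M" "Z \<in> borel_measurable M"
    and int: "integrable M (\<lambda>x. (norm (Z x))\<^sup>2)" and le: "\<And>x. norm (f x) \<le> K * (1 + norm (Z x))"
  shows "integrable M (\<lambda>x. (norm (f x))\<^sup>2)"
proof (rule Bochner_Integration.integrable_bound)
  interpret finite_measure M by fact
  show "integrable M (\<lambda>x. K\<^sup>2 * (2 + 2 * (norm (Z x))\<^sup>2))" using int by simp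
  show "AE x in M. norm ((norm (f x))\<^sup>2) \<le> norm (K\<^sup>2 * (2 + 2 * (norm (Z x))\<^sup>2))"
  proof (intro AE_I2)
    fix x
    have "(norm (f x))\<^sup>2 \<le> (K * (1 + norm (Z x)))\<^sup>2" using le by (intro power_mono) auto
    also have "\<dots> = K\<^sup>2 * (1 + norm (Z x))\<^sup>2" by (simp add: power_mult_distrib)
    also have "\<dots> \<le> K\<^sup>2 * (2 + 2 * (norm (Z x))\<^sup>2)"
      using sum_squares_bound[of 1 "norm (Z x)"] by (intro mult_left_mono) (auto simp: power2_sum)
    finally show "norm ((norm (f x))\<^sup>2) \<le> norm (K\<^sup>2 * (2 + 2 * (norm (Z x))\<^sup>2))" by simp
  qed
qed simp

context ito_equation
begin

lemma b_measurable: "0 \<le> t \<Longrightarrow> b t \<in> borel_measurable borel"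
proof -
  assume t: "0 \<le> t"
  have "K-lipschitz_on UNIV (b t)"
    using lipschitz[OF t] K_pos norm_ge_zero
    by (intro lipschitz_onI) (auto simp: dist_norm intro: order_trans[OF _ lipschitz[OF t]])
  then show ?thesis by (intro borel_measurable_continuous_onI lipschitz_on_continuous_on)
qed

lemma \<sigma>_measurable: "0 \<le> t \<Longrightarrow> \<sigma> t \<in> borel_measurable borel"
proof -
  assume t: "0 \<le> t"
  have "K-lipschitz_on UNIV (\<sigma> t)"
    using lipschitz[OF t] K_pos norm_ge_zero
    by (intro lipschitz_onI) (auto simp: dist_norm intro: order_trans[OF _ lipschitz[OF t]])
  then show ?thesis by (intro borel_measurable_continuous_onI lipschitz_on_continuous_on)
qed

text \<open>In each step the noise is an elementary integral over a single interval, which provides both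
  measurability and square integrability.\<close>

lemma em_grid_L2:
  assumes \<delta>: "0 < \<delta>"
  shows "em_grid B b \<sigma> y0 \<delta> k \<in> borel_measurable (F (real k * \<delta>)) \<and>
    integrable M (\<lambda>\<omega>. (norm (em_grid B b \<sigma> y0 \<delta> k \<omega>))\<^sup>2)"
proof (induction k)
  case 0
  have "em_grid B b \<sigma> y0 \<delta> 0 = (\<lambda>_. y0)" by (intro ext) simp
  then show ?case by simp
next
  case (Suc k)
  let ?Z = "em_grid B b \<sigma> y0 \<delta> k" and ?s = "real k * \<delta>" and ?t = "real (Suc k) * \<delta>"
  have st: "0 \<le> ?s" "?s \<le> ?t" using \<delta> by auto
  have Z: "?Z \<in> borel_measurable (F ?s)" "integrable M (\<lambda>\<omega>. (norm (?Z \<omega>))\<^sup>2)" using Suc by auto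
  have Z': "?Z \<in> borel_measurable (F ?t)" using Z(1) st by (rule F_measurable_mono)
  have bZ: "(\<lambda>\<omega>. b ?s (?Z \<omega>)) \<in> borel_measurable (F ?t)"
    by (rule measurable_compose[OF Z' b_measurable[OF st(1)]])
  have sZ: "(\<lambda>\<omega>. \<sigma> ?s (?Z \<omega>)) \<in> borel_measurable (F ?s)"
    by (rule measurable_compose[OF Z(1) \<sigma>_measurable[OF st(1)]])
  have M: "?Z \<in> borel_measurable M" "(\<lambda>\<omega>. b ?s (?Z \<omega>)) \<in> borel_measurable M" "(\<lambda>\<omega>. \<sigma> ?s (?Z \<omega>)) \<in> borel_measurable M"
    using Z(1) bZ sZ st by (auto intro: F_measurable_M)
  have bL2: "integrable M (\<lambda>\<omega>. (norm (b ?s (?Z \<omega>)))\<^sup>2)"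
    by (rule integrable_square_of_linear_growth[OF finite_measure_axioms M(2,1) Z(2)]) (rule norm_b_le[OF st(1)])
  have sL2: "integrable M (\<lambda>\<omega>. (norm (\<sigma> ?s (?Z \<omega>)))\<^sup>2)"
    by (rule integrable_square_of_linear_growth[OF finite_measure_axioms M(3,1) Z(2)]) (rule norm_\<sigma>_le[OF st(1)])
  have el: "elementary {()} (\<lambda>_. ?s) (\<lambda>_. ?t) (\<lambda>_ \<omega>. \<sigma> ?s (?Z \<omega>))"
    using st sZ sL2 by (simp add: elementary_def)
  let ?J = "elem_integral {()} (\<lambda>_. ?s) (\<lambda>_. ?t) (\<lambda>_ \<omega>. \<sigma> ?s (?Z \<omega>))"
  have inc: "?J ?t \<omega> - ?J ?s \<omega> = \<sigma> ?s (?Z \<omega>) *v (B ?t \<omega> - B ?s \<omega>)" for \<omega>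
    using st by (simp add: elem_integral_def min_def)
  note J = elem_integral_increment_L2(1,2)[OF el st, unfolded inc]
  have comp: "em_grid B b \<sigma> y0 \<delta> (Suc k) \<omega> $ i
      = ?Z \<omega> $ i + ((?t - ?s) * b ?s (?Z \<omega>) $ i + (\<sigma> ?s (?Z \<omega>) *v (B ?t \<omega> - B ?s \<omega>)) $ i)" for \<omega> i
    by (simp only: em_grid.simps vector_add_component vector_scaleR_component real_scaleR_def add.assoc)
  show ?case
  proof
    show "em_grid B b \<sigma> y0 \<delta> (Suc k) \<in> borel_measurable (F ?t)"
      by (rule borel_measurable_vecI, subst comp)
         (intro borel_measurable_add borel_measurable_times borel_measurable_const measurable_vec_nth Z' bZ J(1))
    have nth_L2: "integrable M (\<lambda>\<omega>. (f \<omega> $ i)\<^sup>2)"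
      if "f \<in> borel_measurable M" "integrable M (\<lambda>\<omega>. (norm (f \<omega>))\<^sup>2)" for f :: "'a \<Rightarrow> real ^ 'd" and i
    proof (rule Bochner_Integration.integrable_bound[OF that(2)])
      show "(\<lambda>\<omega>. (f \<omega> $ i)\<^sup>2) \<in> borel_measurable M" using that(1) by measurable
      show "AE \<omega> in M. norm ((f \<omega> $ i)\<^sup>2) \<le> norm ((norm (f \<omega>))\<^sup>2)"
        using component_le_norm_cart by (intro AE_I2) (auto simp: abs_le_square_iff[symmetric])
    qed
    have "integrable M (\<lambda>\<omega>. ((?t - ?s) * b ?s (?Z \<omega>) $ i)\<^sup>2)" for i
      unfolding power_mult_distrib by (intro integrable_mult_right nth_L2 M bL2)
    moreover have "(\<lambda>\<omega>. (?t - ?s) * b ?s (?Z \<omega>) $ i) \<in> borel_measurable M" for i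
      by (intro borel_measurable_times borel_measurable_const measurable_vec_nth M)
    moreover have "(\<lambda>\<omega>. (\<sigma> ?s (?Z \<omega>) *v (B ?t \<omega> - B ?s \<omega>)) $ i) \<in> borel_measurable M" for i
      by (rule F_measurable_M[OF J(1) order_trans[OF st]])
    ultimately have "integrable M (\<lambda>\<omega>. (em_grid B b \<sigma> y0 \<delta> (Suc k) \<omega> $ i)\<^sup>2)" for i
      unfolding comp
      by (intro integrable_square_add borel_measurable_add nth_L2[OF M(1) Z(2)] measurable_vec_nth[OF M(1)] J(2))
    then show "integrable M (\<lambda>\<omega>. (norm (em_grid B b \<sigma> y0 \<delta> (Suc k) \<omega>))\<^sup>2)"
      unfolding norm_vec_sq by (intro Bochner_Integration.integrable_sum)
  qed
qed

text \<open>The constant for one evaluation of \<open>coeff_error\<close>: \<open>2\<close> and \<open>4\<close> are the weights in splitting its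
  square, and \<open>136 = 4 \<cdot> 34\<close> contains the constant of \<open>increment_second_moment\<close>.\<close>

definition local_const :: real where
  "local_const = 2 * growth_const + 136 * K\<^sup>2 * growth_const"

lemma local_const_nonneg: "0 \<le> local_const"
  using growth_const_nonneg by (simp add: local_const_def)

text \<open>The summand \<open>1\<close> is the direct contribution of \<open>local_const\<close>, and \<open>272 K\<^sup>2 = 2 \<cdot> 136 K\<^sup>2\<close> the
  one that passes through Gronwall's inequality for the grid error.\<close>

definition error_const :: real where
  "error_const = 34 * K\<^sup>2 * local_const * (1 + 272 * K\<^sup>2)"

text \<open>For a fixed step size, the frozen coefficients form the step processes \<open>em_drift\<close> and
  \<open>em_process\<close>, given on the first \<open>N\<close> cells.\<close>

context
  fixes \<delta> :: real
  assumes \<delta>: "0 < \<delta>" "\<delta> < 1"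
begin

abbreviation em :: "nat \<Rightarrow> 'a \<Rightarrow> real ^ 'd" where
  "em \<equiv> em_grid B b \<sigma> y0 \<delta>"

abbreviation grid :: "real \<Rightarrow> real" where
  "grid r \<equiv> real (step_index \<delta> r) * \<delta>"

abbreviation em_process :: "nat \<Rightarrow> real \<Rightarrow> 'a \<Rightarrow> real ^ 'm ^ 'd" where
  "em_process N \<equiv> elem_process {..<N} (\<lambda>k. real k * \<delta>) (\<lambda>k. real (Suc k) * \<delta>) (\<lambda>k \<omega>. \<sigma> (real k * \<delta>) (em k \<omega>))"

abbreviation em_integral :: "nat \<Rightarrow> real \<Rightarrow> 'a \<Rightarrow> real ^ 'd" where
  "em_integral N \<equiv> elem_integral {..<N} (\<lambda>k. real k * \<delta>) (\<lambda>k. real (Suc k) * \<delta>) (\<lambda>k \<omega>. \<sigma> (real k * \<delta>) (em k \<omega>))"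

abbreviation em_drift :: "nat \<Rightarrow> real \<Rightarrow> 'a \<Rightarrow> real ^ 'd" where
  "em_drift N r \<omega> \<equiv> \<Sum>k<N. indicat_real {real k * \<delta><..real (Suc k) * \<delta>} r *\<^sub>R b (real k * \<delta>) (em k \<omega>)"

lemma em_measurable: "em k \<in> borel_measurable M"
  using em_grid_L2[OF \<delta>(1), of k] \<delta> by (intro F_measurable_M[of _ "real k * \<delta>"]) auto

lemma em_elementary:
  "elementary {..<N} (\<lambda>k. real k * \<delta>) (\<lambda>k. real (Suc k) * \<delta>) (\<lambda>k \<omega>. \<sigma> (real k * \<delta>) (em k \<omega>))"
proof -
  have "(\<lambda>\<omega>. \<sigma> (real k * \<delta>) (em k \<omega>)) \<in> borel_measurable (F (real k * \<delta>))" for k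
    using em_grid_L2[OF \<delta>(1), of k] \<sigma>_measurable[of "real k * \<delta>"] \<delta> by (auto intro: measurable_compose)
  moreover from this have "integrable M (\<lambda>\<omega>. (norm (\<sigma> (real k * \<delta>) (em k \<omega>)))\<^sup>2)" for k
    using em_grid_L2[OF \<delta>(1), of k] \<delta>
    by (intro integrable_square_of_linear_growth[OF finite_measure_axioms _ em_measurable _ norm_\<sigma>_le])
       (auto intro: F_measurable_M[of _ "real k * \<delta>"])
  ultimately show ?thesis using \<delta> by (auto simp: elementary_def)
qed

text \<open>The one-step formula telescopes: each summand is the contribution of one cell, and the cells beyond
  \<open>t\<close> contribute nothing because both endpoints are cut off at \<open>t\<close>.\<close>

lemma euler_maruyama_eq:
  assumes "0 \<le> t" "t \<le> real N * \<delta>"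
  shows "euler_maruyama B b \<sigma> y0 \<delta> t \<omega>
    = y0 + (\<Sum>k<N. (min t (real (Suc k) * \<delta>) - min t (real k * \<delta>)) *\<^sub>R b (real k * \<delta>) (em k \<omega>)) + em_integral N t \<omega>"
  using assms
proof (induction N arbitrary: t)
  case 0
  then have "t = 0" by simp
  then show ?case using euler_maruyama_0[OF \<delta>(1)] by (simp add: elem_integral_def)
next
  case (Suc N)
  let ?s = "real N * \<delta>"
  have s0: "0 \<le> ?s" using \<delta> by simp
  show ?case
  proof (cases "t \<le> ?s")
    case True
    moreover from True have "t \<le> real (Suc N) * \<delta>" using \<delta> by (simp add: distrib_right)
    ultimately show ?thesis using Suc.IH[OF Suc.prems(1) True] by (simp add: elem_integral_def min_absorb1 del: of_nat_Suc)
  next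
    case False
    have le: "real (Suc k) * \<delta> \<le> ?s" "real k * \<delta> \<le> ?s" if "k < N" for k
      using that \<delta> by (intro mult_right_mono; simp)+
    have min_eq: "min t (real (Suc k) * \<delta>) = min ?s (real (Suc k) * \<delta>)" "min t (real k * \<delta>) = min ?s (real k * \<delta>)"
      if "k < N" for k using le[OF that] False by linarith+
    have IH: "euler_maruyama B b \<sigma> y0 \<delta> ?s \<omega>
      = y0 + (\<Sum>k<N. (min t (real (Suc k) * \<delta>) - min t (real k * \<delta>)) *\<^sub>R b (real k * \<delta>) (em k \<omega>)) + em_integral N t \<omega>"
      using Suc.IH[OF s0 order_refl] min_eq by (simp add: elem_integral_def cong: sum.cong_simp del: of_nat_Suc)
    have "euler_maruyama B b \<sigma> y0 \<delta> t \<omega> = euler_maruyama B b \<sigma> y0 \<delta> ?s \<omega>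
        + (t - ?s) *\<^sub>R b ?s (em N \<omega>) + \<sigma> ?s (em N \<omega>) *v (B t \<omega> - B ?s \<omega>)"
      using euler_maruyama_step[OF \<delta>(1), of t N B b \<sigma> y0 \<omega>] False Suc.prems
      by (simp add: euler_maruyama_grid[OF \<delta>(1)] del: of_nat_Suc)
    then show ?thesis
      unfolding IH using False Suc.prems
      by (simp add: elem_integral_def min_absorb1 min_absorb2 algebra_simps del: of_nat_Suc)
  qed
qed

lemma em_drift_integral:
  assumes "0 \<le> t"
  shows "set_integrable lborel {0..t} (\<lambda>r. em_drift N r \<omega>)"
    "(LINT r:{0..t}|lborel. em_drift N r \<omega>)
       = (\<Sum>k<N. (min t (real (Suc k) * \<delta>) - min t (real k * \<delta>)) *\<^sub>R b (real k * \<delta>) (em k \<omega>))"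
proof -
  have step: "has_bochner_integral lborel (\<lambda>r. indicat_real ({0..t} \<inter> {real k * \<delta><..real (Suc k) * \<delta>}) r *\<^sub>R v)
      ((min t (real (Suc k) * \<delta>) - min t (real k * \<delta>)) *\<^sub>R v)" for k and v :: "real ^ 'd"
  proof -
    let ?A = "{0..t} \<inter> {real k * \<delta><..real (Suc k) * \<delta>}"
    have le: "real k * \<delta> \<le> real (Suc k) * \<delta>" "0 \<le> real k * \<delta>" using \<delta> by auto
    then have A: "?A = {min t (real k * \<delta>)<..min t (real (Suc k) * \<delta>)}" using assms by auto
    have "measure lborel ?A = min t (real (Suc k) * \<delta>) - min t (real k * \<delta>)"
      unfolding A using le by (subst measure_lborel_Ioc) auto
    moreover have "has_bochner_integral lborel (indicat_real ?A) (measure lborel ?A)"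
      unfolding A using le by (intro has_bochner_integral_real_indicator) auto
    ultimately show ?thesis by (intro has_bochner_integral_scaleR_left) simp
  qed
  have "has_bochner_integral lborel (\<lambda>r. indicat_real {0..t} r *\<^sub>R em_drift N r \<omega>)
      (\<Sum>k<N. (min t (real (Suc k) * \<delta>) - min t (real k * \<delta>)) *\<^sub>R b (real k * \<delta>) (em k \<omega>))"
    unfolding scaleR_sum_right scaleR_scaleR indicator_inter_arith[symmetric]
    by (intro has_bochner_integral_sum step)
  then show "set_integrable lborel {0..t} (\<lambda>r. em_drift N r \<omega>)"
    "(LINT r:{0..t}|lborel. em_drift N r \<omega>)
       = (\<Sum>k<N. (min t (real (Suc k) * \<delta>) - min t (real k * \<delta>)) *\<^sub>R b (real k * \<delta>) (em k \<omega>))"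
    unfolding set_integrable_def set_lebesgue_integral_def by (simp_all add: has_bochner_integral_iff)
qed

text \<open>Up to the factor \<open>K\<close>, the difference of the coefficients: freezing the time argument, freezing the solution
  at the previous grid point, and replacing it by the approximation there.\<close>

definition coeff_error :: "real \<Rightarrow> 'a \<Rightarrow> real" where
  "coeff_error r \<omega> = (1 + norm (Y r \<omega>)) * \<delta> powr \<gamma> + norm (Y r \<omega> - Y (grid r) \<omega>)
     + norm (Y (grid r) \<omega> - em (step_index \<delta> r) \<omega>)"

definition grid_error :: "real \<Rightarrow> 'a \<Rightarrow> real" where
  "grid_error r \<omega> = norm (Y (grid r) \<omega> - em (step_index \<delta> r) \<omega>)"

lemma step_index_measurable[measurable]: "step_index \<delta> \<in> measurable borel (count_space UNIV)"
  unfolding step_index_def[abs_def] by measurable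

lemma Y_grid_joint: "(\<lambda>x. Y (grid (fst x)) (snd x)) \<in> borel_measurable (borel \<Otimes>\<^sub>M M)"
  by (rule measurable_compose_countable[where f="\<lambda>k x. Y (real k * \<delta>) (snd x)"])
     (auto intro!: measurable_compose[OF measurable_snd Y_measurable] measurable_compose[OF measurable_fst step_index_measurable])

lemma em_joint: "(\<lambda>x. em (step_index \<delta> (fst x)) (snd x)) \<in> borel_measurable (borel \<Otimes>\<^sub>M M)"
  by (rule measurable_compose_countable[where f="\<lambda>k x. em k (snd x)"])
     (auto intro!: measurable_compose[OF measurable_snd em_measurable] measurable_compose[OF measurable_fst step_index_measurable])

lemma error_joint:
  "(\<lambda>(r, \<omega>). coeff_error r \<omega>) \<in> borel_measurable (borel \<Otimes>\<^sub>M M)"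
  "(\<lambda>(r, \<omega>). grid_error r \<omega>) \<in> borel_measurable (borel \<Otimes>\<^sub>M M)"
proof -
  have "(\<lambda>x. Y (fst x) (snd x)) \<in> borel_measurable (borel \<Otimes>\<^sub>M M)" using Y_joint by (simp add: split_def)
  then show "(\<lambda>(r, \<omega>). coeff_error r \<omega>) \<in> borel_measurable (borel \<Otimes>\<^sub>M M)"
    "(\<lambda>(r, \<omega>). grid_error r \<omega>) \<in> borel_measurable (borel \<Otimes>\<^sub>M M)"
    unfolding coeff_error_def grid_error_def split_def using Y_grid_joint em_joint by measurable
qed

lemma coeff_error_nonneg: "0 \<le> coeff_error r \<omega>"
  by (simp add: coeff_error_def)

lemma coefficient_difference:
  assumes r: "0 < r"
  shows "norm (b r (Y r \<omega>) - b (grid r) (em (step_index \<delta> r) \<omega>))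
     + norm (\<sigma> r (Y r \<omega>) - \<sigma> (grid r) (em (step_index \<delta> r) \<omega>)) \<le> K * coeff_error r \<omega>"
proof -
  let ?g = "grid r" and ?e = "em (step_index \<delta> r) \<omega>"
  have g: "0 \<le> ?g" "?g < r" "r \<le> ?g + \<delta>"
    using step_index_bounds[OF \<delta>(1) r] \<delta> by (auto simp: distrib_right)
  have "norm (b r (Y r \<omega>) - b ?g (Y r \<omega>)) + norm (\<sigma> r (Y r \<omega>) - \<sigma> ?g (Y r \<omega>)) \<le> K * (1 + norm (Y r \<omega>)) * \<bar>r - ?g\<bar> powr \<gamma>"
    using g r by (intro hoelder) auto
  also have "\<dots> \<le> K * (1 + norm (Y r \<omega>)) * \<delta> powr \<gamma>"
    using g \<gamma>_pos K_pos by (intro mult_left_mono powr_mono2) auto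
  finally have 1: "norm (b r (Y r \<omega>) - b ?g (Y r \<omega>)) + norm (\<sigma> r (Y r \<omega>) - \<sigma> ?g (Y r \<omega>)) \<le> K * ((1 + norm (Y r \<omega>)) * \<delta> powr \<gamma>)"
    by (simp add: mult.assoc)
  have 2: "norm (b ?g (Y r \<omega>) - b ?g ?e) + norm (\<sigma> ?g (Y r \<omega>) - \<sigma> ?g ?e) \<le> K * norm (Y r \<omega> - ?e)"
    using g by (intro lipschitz)
  have "norm (Y r \<omega> - ?e) \<le> norm (Y r \<omega> - Y ?g \<omega>) + norm (Y ?g \<omega> - ?e)"
    using norm_triangle_ineq[of "Y r \<omega> - Y ?g \<omega>" "Y ?g \<omega> - ?e"] by simp
  then have 3: "K * norm (Y r \<omega> - ?e) \<le> K * (norm (Y r \<omega> - Y ?g \<omega>) + norm (Y ?g \<omega> - ?e))"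
    using K_pos by (intro mult_left_mono) auto
  have "norm (b r (Y r \<omega>) - b ?g ?e) \<le> norm (b r (Y r \<omega>) - b ?g (Y r \<omega>)) + norm (b ?g (Y r \<omega>) - b ?g ?e)"
    "norm (\<sigma> r (Y r \<omega>) - \<sigma> ?g ?e) \<le> norm (\<sigma> r (Y r \<omega>) - \<sigma> ?g (Y r \<omega>)) + norm (\<sigma> ?g (Y r \<omega>) - \<sigma> ?g ?e)"
    using norm_triangle_ineq[of "b r (Y r \<omega>) - b ?g (Y r \<omega>)" "b ?g (Y r \<omega>) - b ?g ?e"]
      norm_triangle_ineq[of "\<sigma> r (Y r \<omega>) - \<sigma> ?g (Y r \<omega>)" "\<sigma> ?g (Y r \<omega>) - \<sigma> ?g ?e"] by simp_all
  then show ?thesis using 1 2 3 unfolding coeff_error_def ring_distribs by linarith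
qed

text \<open>The error is the drift of the difference of the coefficients plus the difference \<open>I - J\<close> of the noises, to
  which \<open>ito_sup\<close> applies with the frozen diffusion coefficient as elementary integrand. The constant is
  \<open>34 = 2 + 2 \<cdot> 16\<close>.\<close>

lemma sup_error_by_coefficient_error:
  assumes T: "0 \<le> T"
  obtains Z :: "'a \<Rightarrow> ennreal" where
    "AE \<omega> in M. \<forall>s\<in>{0..T}. sqn (Y s \<omega> - euler_maruyama B b \<sigma> y0 \<delta> s \<omega>) \<le> Z \<omega>"
    "(\<integral>\<^sup>+\<omega>. Z \<omega> \<partial>M) \<le> ennreal (34 * K\<^sup>2) * exp_conv (second_moment coeff_error) T"
proof -
  define N where "N = nat \<lceil>T / \<delta>\<rceil>"
  have "T / \<delta> \<le> real N" unfolding N_def by linarith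
  then have N: "T \<le> real N * \<delta>" using \<delta> by (simp add: pos_divide_le_eq)
  let ?k = "ennreal (K\<^sup>2)" and ?G = "em_process N" and ?J = "em_integral N"
  let ?d = "\<lambda>\<omega>. \<integral>\<^sup>+r\<in>{0<..T}. ennreal (coeff_error r \<omega>) \<partial>lborel"
  obtain W :: "'a \<Rightarrow> ennreal" where Wm: "W \<in> borel_measurable M"
    and W: "AE \<omega> in M. \<forall>u\<in>{0..T}. sqn ((I u \<omega> - ?J u \<omega>) - (I 0 \<omega> - ?J 0 \<omega>)) \<le> W \<omega>"
    and EW: "(\<integral>\<^sup>+\<omega>. W \<omega> \<partial>M) \<le> 16 * energy 0 T (\<lambda>r \<omega>. H r \<omega> - ?G r \<omega>)"
    using ito_sup[OF ito em_elementary order_refl T] by blast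
  have dM: "?d \<in> borel_measurable M"
    using error_joint(1) by (intro path_integral_measurable) (simp add: split_def)
  have eval: "?G r \<omega> = \<sigma> (grid r) (em (step_index \<delta> r) \<omega>)" "em_drift N r \<omega> = b (grid r) (em (step_index \<delta> r) \<omega>)"
    if "0 < r" "r \<le> T" for r \<omega>
    unfolding elem_process_def using sum_step_indicator[OF \<delta>(1), of r N] that N by auto
  have bound_b: "norm (b r (Y r \<omega>) - em_drift N r \<omega>) \<le> K * coeff_error r \<omega>" if "0 < r" "r \<le> T" for r \<omega>
    using coefficient_difference[OF that(1), of \<omega>] norm_ge_zero[of "\<sigma> r (Y r \<omega>) - \<sigma> (grid r) (em (step_index \<delta> r) \<omega>)"]
    unfolding eval(2)[OF that] by linarith
  have bound_\<sigma>: "norm (\<sigma> r (Y r \<omega>) - ?G r \<omega>) \<le> K * coeff_error r \<omega>" if "0 < r" "r \<le> T" for r \<omega>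
    using coefficient_difference[OF that(1), of \<omega>] norm_ge_zero[of "b r (Y r \<omega>) - b (grid r) (em (step_index \<delta> r) \<omega>)"]
    unfolding eval(1)[OF that] by linarith
  have "AE \<omega> in M. \<forall>r\<in>{0<..T}. norm (H r \<omega> - ?G r \<omega>) \<le> K * coeff_error r \<omega>"
    using H_eq by eventually_elim (use bound_\<sigma> in auto)
  then have "energy 0 T (\<lambda>r \<omega>. H r \<omega> - ?G r \<omega>) \<le> ?k * (\<integral>\<^sup>+r\<in>{0<..T}. second_moment coeff_error r \<partial>lborel)"
    by (rule energy_le_second_moment[OF error_joint(1)])
  also have "\<dots> \<le> ?k * exp_conv (second_moment coeff_error) T"
    by (intro mult_left_mono nn_integral_le_exp_conv) auto
  finally have EW': "(\<integral>\<^sup>+\<omega>. W \<omega> \<partial>M) \<le> 16 * (?k * exp_conv (second_moment coeff_error) T)"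
    using EW by (meson mult_left_mono order_trans zero_le)
  show ?thesis
  proof (rule that[of "\<lambda>\<omega>. 2 * (?k * (?d \<omega>)\<^sup>2) + 2 * W \<omega>"])
    show "AE \<omega> in M. \<forall>s\<in>{0..T}. sqn (Y s \<omega> - euler_maruyama B b \<sigma> y0 \<delta> s \<omega>) \<le> 2 * (?k * (?d \<omega>)\<^sup>2) + 2 * W \<omega>"
      using drift_integrable equation W ito_0[OF ito] AE_space
    proof eventually_elim
      case (elim \<omega>)
      show ?case
      proof
        fix s assume s: "s \<in> {0..T}"
        let ?f = "\<lambda>r. b r (Y r \<omega>) - em_drift N r \<omega>"
        have [measurable]: "(\<lambda>r. coeff_error r \<omega>) \<in> borel_measurable borel"
          by (rule joint_section_measurable(2)[OF error_joint(1) elim(5)])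
        have s': "0 \<le> s" "s \<le> real N * \<delta>" using s N by auto
        have int: "set_integrable lborel {0..s} (\<lambda>r. b r (Y r \<omega>))" using elim(1) s' by auto
        note D = em_drift_integral[OF s'(1), where N=N and \<omega>=\<omega>]
        have J0: "?J 0 \<omega> = 0" by (rule elem_integral_0[OF em_elementary])
        have "Y s \<omega> - euler_maruyama B b \<sigma> y0 \<delta> s \<omega>
            = (LINT r:{0..s}|lborel. b r (Y r \<omega>)) - (LINT r:{0..s}|lborel. em_drift N r \<omega>) + (I s \<omega> - ?J s \<omega>)"
          using elim(2) s'(1) unfolding euler_maruyama_eq[OF s'] D(2) by (simp add: algebra_simps)
        also have "\<dots> = (LINT r:{0..s}|lborel. ?f r) + (I s \<omega> - ?J s \<omega>)"
          using set_integral_diff(2)[OF int D(1)] by simp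
        finally have eq: "Y s \<omega> - euler_maruyama B b \<sigma> y0 \<delta> s \<omega> = (LINT r:{0..s}|lborel. ?f r) + (I s \<omega> - ?J s \<omega>)" .
        have "ennreal (norm (LINT r:{0..s}|lborel. ?f r)) \<le> ennreal K * (\<integral>\<^sup>+r\<in>{0<..s}. ennreal (coeff_error r \<omega>) \<partial>lborel)"
          using K_pos s by (intro norm_drift_le[OF set_integral_diff(1)[OF int D(1)]] bound_b) auto
        also have "\<dots> \<le> ennreal K * ?d \<omega>"
          using s by (intro mult_left_mono nn_integral_mono) (auto split: split_indicator)
        finally have drift: "ennreal (norm (LINT r:{0..s}|lborel. ?f r)) \<le> ennreal K * ?d \<omega>" .
        have "sqn (Y s \<omega> - euler_maruyama B b \<sigma> y0 \<delta> s \<omega>)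
            \<le> ennreal (2 * (norm (LINT r:{0..s}|lborel. ?f r))\<^sup>2 + 2 * (norm (I s \<omega> - ?J s \<omega>))\<^sup>2)"
          unfolding eq by (intro ennreal_leI norm_add_sq_le)
        also have "\<dots> = 2 * (ennreal (norm (LINT r:{0..s}|lborel. ?f r)))\<^sup>2 + 2 * sqn (I s \<omega> - ?J s \<omega>)"
          by (simp add: ennreal_mult ennreal_power)
        also have "\<dots> \<le> 2 * (ennreal K * ?d \<omega>)\<^sup>2 + 2 * W \<omega>"
          using elim(3,4) s J0 by (intro add_mono mult_left_mono power_mono drift) auto
        also have "\<dots> = 2 * (?k * (?d \<omega>)\<^sup>2) + 2 * W \<omega>"
          using K_pos by (simp add: power_mult_distrib ennreal_power)
        finally show "sqn (Y s \<omega> - euler_maruyama B b \<sigma> y0 \<delta> s \<omega>) \<le> 2 * (?k * (?d \<omega>)\<^sup>2) + 2 * W \<omega>" .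
      qed
    qed
    have "(\<integral>\<^sup>+\<omega>. 2 * (?k * (?d \<omega>)\<^sup>2) + 2 * W \<omega> \<partial>M) = 2 * (?k * (\<integral>\<^sup>+\<omega>. (?d \<omega>)\<^sup>2 \<partial>M)) + 2 * (\<integral>\<^sup>+\<omega>. W \<omega> \<partial>M)"
      by (rule nn_integral_drift_noise[OF dM Wm])
    also have "\<dots> \<le> 2 * (?k * exp_conv (second_moment coeff_error) T) + 2 * (16 * (?k * exp_conv (second_moment coeff_error) T))"
      by (intro add_mono mult_left_mono drift_square_le_exp[OF error_joint(1)] EW' coeff_error_nonneg T) auto
    also have "\<dots> = ennreal (34 * K\<^sup>2) * exp_conv (second_moment coeff_error) T"
      by (simp add: ennreal_mult distrib_right[symmetric] mult.assoc[symmetric])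
    finally show "(\<integral>\<^sup>+\<omega>. 2 * (?k * (?d \<omega>)\<^sup>2) + 2 * W \<omega> \<partial>M) \<le> ennreal (34 * K\<^sup>2) * exp_conv (second_moment coeff_error) T" .
  qed
qed

abbreviation order_factor :: real where
  "order_factor \<equiv> \<delta> powr (min (2 * \<gamma>) 1)"

text \<open>Since \<open>\<delta> < 1\<close>, both \<open>\<delta>\<^sup>2\<^sup>\<gamma>\<close> and \<open>\<delta>\<close> are at most \<open>\<delta>\<close> to the power \<open>min (2\<gamma>) 1\<close>.\<close>

lemma coeff_error_second_moment:
  assumes r: "0 < r"
  shows "second_moment coeff_error r
    \<le> ennreal (local_const * order_factor) * exp_rate r + 4 * second_moment grid_error r"
proof -
  let ?g = "grid r" and ?e = "exp_rate r"
  have g: "0 \<le> ?g" "?g < r" "r - ?g \<le> \<delta>"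
    using step_index_bounds[OF \<delta>(1) r] \<delta> by (auto simp: distrib_right)
  have [measurable]: "Y r \<in> borel_measurable M" "Y ?g \<in> borel_measurable M" "grid_error r \<in> borel_measurable M"
    using Y_measurable joint_section_measurable(1)[OF error_joint(2)] by auto
  have pw: "ennreal ((coeff_error r \<omega>)\<^sup>2) \<le> 2 * (ennreal ((\<delta> powr \<gamma>)\<^sup>2) * ennreal ((1 + norm (Y r \<omega>))\<^sup>2))
      + 4 * sqn (Y r \<omega> - Y ?g \<omega>) + 4 * ennreal ((grid_error r \<omega>)\<^sup>2)" for \<omega>
  proof -
    have "(coeff_error r \<omega>)\<^sup>2 \<le> 2 * ((1 + norm (Y r \<omega>)) * \<delta> powr \<gamma>)\<^sup>2 + 4 * (norm (Y r \<omega> - Y ?g \<omega>))\<^sup>2 + 4 * (grid_error r \<omega>)\<^sup>2"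
      using norm_add3_sq_le[of "(1 + norm (Y r \<omega>)) * \<delta> powr \<gamma>" "norm (Y r \<omega> - Y ?g \<omega>)" "grid_error r \<omega>"]
      unfolding coeff_error_def grid_error_def by simp
    then have "ennreal ((coeff_error r \<omega>)\<^sup>2) \<le> ennreal (2 * ((1 + norm (Y r \<omega>)) * \<delta> powr \<gamma>)\<^sup>2 + 4 * (norm (Y r \<omega> - Y ?g \<omega>))\<^sup>2 + 4 * (grid_error r \<omega>)\<^sup>2)"
      by (rule ennreal_leI)
    also have "\<dots> = 2 * (ennreal ((\<delta> powr \<gamma>)\<^sup>2) * ennreal ((1 + norm (Y r \<omega>))\<^sup>2))
      + 4 * sqn (Y r \<omega> - Y ?g \<omega>) + 4 * ennreal ((grid_error r \<omega>)\<^sup>2)"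
      by (simp add: ennreal_mult power_mult_distrib mult.commute)
    finally show ?thesis .
  qed
  have "second_moment coeff_error r \<le> (\<integral>\<^sup>+\<omega>. 2 * (ennreal ((\<delta> powr \<gamma>)\<^sup>2) * ennreal ((1 + norm (Y r \<omega>))\<^sup>2))
      + 4 * sqn (Y r \<omega> - Y ?g \<omega>) + 4 * ennreal ((grid_error r \<omega>)\<^sup>2) \<partial>M)"
    unfolding second_moment_def by (intro nn_integral_mono pw)
  also have "\<dots> = 2 * (ennreal ((\<delta> powr \<gamma>)\<^sup>2) * second_moment (\<lambda>r \<omega>. 1 + norm (Y r \<omega>)) r)
      + 4 * (\<integral>\<^sup>+\<omega>. sqn (Y r \<omega> - Y ?g \<omega>) \<partial>M) + 4 * second_moment grid_error r"
    unfolding second_moment_def by (simp add: nn_integral_add nn_integral_cmult)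
  also have "\<dots> \<le> 2 * (ennreal order_factor * (ennreal growth_const * ?e))
      + 4 * (ennreal (34 * K\<^sup>2 * growth_const) * (ennreal order_factor * ?e)) + 4 * second_moment grid_error r"
  proof (intro add_right_mono add_mono mult_left_mono)
    have "(\<delta> powr \<gamma>)\<^sup>2 = \<delta> powr (2 * \<gamma>)"
      by (simp add: power2_eq_square powr_add[symmetric])
    also have "\<dots> \<le> order_factor"
      using \<delta> by (intro powr_mono') auto
    finally show "ennreal ((\<delta> powr \<gamma>)\<^sup>2) * second_moment (\<lambda>r \<omega>. 1 + norm (Y r \<omega>)) r \<le> ennreal order_factor * (ennreal growth_const * ?e)"
      using r by (intro mult_mono ennreal_leI second_moment_growth) auto
    have "r - ?g \<le> \<delta> powr 1" using g \<delta> by simp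
    also have "\<dots> \<le> order_factor" using \<delta> by (intro powr_mono') auto
    finally have "ennreal (r - ?g) * ?e \<le> ennreal order_factor * ?e"
      by (intro mult_right_mono ennreal_leI) auto
    moreover have "(\<integral>\<^sup>+\<omega>. sqn (Y r \<omega> - Y ?g \<omega>) \<partial>M)
        \<le> ennreal (34 * K\<^sup>2 * growth_const) * (ennreal (r - ?g) * ?e)"
      using g \<delta> by (intro increment_second_moment) auto
    ultimately show "(\<integral>\<^sup>+\<omega>. sqn (Y r \<omega> - Y ?g \<omega>) \<partial>M)
        \<le> ennreal (34 * K\<^sup>2 * growth_const) * (ennreal order_factor * ?e)"
      by (meson mult_left_mono order_trans zero_le)
  qed auto
  also have "2 * (ennreal order_factor * (ennreal growth_const * ?e))
      + 4 * (ennreal (34 * K\<^sup>2 * growth_const) * (ennreal order_factor * ?e))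
      = ennreal (local_const * order_factor) * ?e"
  proof -
    have gen: "2 * (ennreal x * (ennreal y * ennreal z)) = ennreal (2 * (x * (y * z)))"
      "4 * (ennreal x * (ennreal y * ennreal z)) = ennreal (4 * (x * (y * z)))"
      if "0 \<le> x" "0 \<le> y" "0 \<le> z" for x y z
      using that by (simp_all add: ennreal_mult)
    have "2 * (ennreal order_factor * (ennreal growth_const * ?e)) = ennreal (2 * (order_factor * (growth_const * exp (rate * r))))"
      using growth_const_nonneg by (intro gen) auto
    moreover have "4 * (ennreal (34 * K\<^sup>2 * growth_const) * (ennreal order_factor * ?e))
        = ennreal (4 * ((34 * K\<^sup>2 * growth_const) * (order_factor * exp (rate * r))))"
      using growth_const_nonneg by (intro gen) auto
    moreover have "ennreal (local_const * order_factor) * ?e = ennreal (local_const * order_factor * exp (rate * r))"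
      using local_const_nonneg by (simp add: ennreal_mult)
    ultimately show ?thesis
      using growth_const_nonneg by (simp add: ennreal_plus[symmetric] local_const_def algebra_simps del: ennreal_plus)
  qed
  finally show ?thesis .
qed

text \<open>The a priori bound for Gronwall's inequality: only finitely many grid points precede \<open>T\<close>, and at each of
  them the solution and its approximation are square integrable.\<close>

lemma grid_error_finite:
  assumes "0 \<le> t" "t \<le> T"
  shows "second_moment grid_error t \<le> (\<Sum>k\<le>nat \<lceil>T / \<delta>\<rceil>. \<integral>\<^sup>+\<omega>. sqn (Y (real k * \<delta>) \<omega> - em k \<omega>) \<partial>M)"
    "(\<Sum>k\<le>nat \<lceil>T / \<delta>\<rceil>. \<integral>\<^sup>+\<omega>. sqn (Y (real k * \<delta>) \<omega> - em k \<omega>) \<partial>M) < \<top>"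
proof -
  have "t / \<delta> \<le> T / \<delta>" using assms \<delta> by (intro divide_right_mono) auto
  then have "step_index \<delta> t \<le> nat \<lceil>T / \<delta>\<rceil>" unfolding step_index_def using ceiling_mono by (intro nat_mono) force
  then show "second_moment grid_error t \<le> (\<Sum>k\<le>nat \<lceil>T / \<delta>\<rceil>. \<integral>\<^sup>+\<omega>. sqn (Y (real k * \<delta>) \<omega> - em k \<omega>) \<partial>M)"
    unfolding second_moment_def grid_error_def by (intro member_le_sum) auto
  have "(\<integral>\<^sup>+\<omega>. sqn (Y (real k * \<delta>) \<omega> - em k \<omega>) \<partial>M) < \<top>" for k
  proof -
    have t: "0 \<le> real k * \<delta>" using \<delta> by simp
    have "(\<integral>\<^sup>+\<omega>. sqn (Y (real k * \<delta>) \<omega> - em k \<omega>) \<partial>M)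
        \<le> (\<integral>\<^sup>+\<omega>. 2 * sqn (Y (real k * \<delta>) \<omega>) + 2 * sqn (em k \<omega>) \<partial>M)"
    proof (intro nn_integral_mono)
      fix \<omega>
      have "sqn (Y (real k * \<delta>) \<omega> - em k \<omega>) \<le> ennreal (2 * (norm (Y (real k * \<delta>) \<omega>))\<^sup>2 + 2 * (norm (em k \<omega>))\<^sup>2)"
        using norm_add_sq_le[of "Y (real k * \<delta>) \<omega>" "- em k \<omega>"] by (intro ennreal_leI) simp
      then show "sqn (Y (real k * \<delta>) \<omega> - em k \<omega>) \<le> 2 * sqn (Y (real k * \<delta>) \<omega>) + 2 * sqn (em k \<omega>)"
        by (simp add: ennreal_mult)
    qed
    also have "\<dots> = 2 * second_moment (\<lambda>r \<omega>. norm (Y r \<omega>)) (real k * \<delta>) + 2 * (\<integral>\<^sup>+\<omega>. sqn (em k \<omega>) \<partial>M)"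
      unfolding second_moment_def using Y_measurable[of "real k * \<delta>"] em_measurable[of k]
      by (simp add: nn_integral_add nn_integral_cmult)
    also have "\<dots> < \<top>"
    proof -
      have "second_moment (\<lambda>r \<omega>. norm (Y r \<omega>)) (real k * \<delta>) < \<top>"
        using second_moment_solution[OF t] by (rule le_less_trans) (simp add: ennreal_mult_less_top)
      moreover have "(\<integral>\<^sup>+\<omega>. sqn (em k \<omega>) \<partial>M) < \<top>"
        using em_grid_L2[OF \<delta>(1), of k] by (subst nn_integral_eq_integral) auto
      ultimately show ?thesis by (simp add: ennreal_mult_less_top)
    qed
    finally show ?thesis .
  qed
  then show "(\<Sum>k\<le>nat \<lceil>T / \<delta>\<rceil>. \<integral>\<^sup>+\<omega>. sqn (Y (real k * \<delta>) \<omega> - em k \<omega>) \<partial>M) < \<top>"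
    by simp
qed

text \<open>The grid error at time \<open>t\<close> is the error at one time in \<open>[0, t]\<close>, so \<open>sup_error_by_coefficient_error\<close> and
  \<open>coeff_error_second_moment\<close> give a closed Gronwall inequality for its second moment. Inserting the resulting
  bound once more controls the supremum.\<close>

lemma strong_error:
  assumes T: "0 \<le> T"
  shows "(\<integral>\<^sup>+\<omega>. (SUP s\<in>{0..T}. sqn (Y s \<omega> - euler_maruyama B b \<sigma> y0 \<delta> s \<omega>)) \<partial>M)
    \<le> ennreal (error_const * exp (rate * T) * order_factor)"
proof -
  let ?A = "34 * K\<^sup>2 * local_const * order_factor"
  let ?e = "\<lambda>t. exp_rate t"
  let ?g = "second_moment grid_error"
  have A: "0 \<le> ?A" using local_const_nonneg by simp
  have gm: "?g \<in> borel_measurable borel"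
    by (rule Fubini_second_moment(2)[OF error_joint(2), of "\<lambda>_. 0"]) simp
  have coeff: "ennreal (34 * K\<^sup>2) * exp_conv (second_moment coeff_error) t
      \<le> ennreal ?A * ?e t + ennreal (136 * K\<^sup>2) * exp_conv ?g t" if t: "0 \<le> t" for t
  proof -
    have "ennreal (34 * K\<^sup>2) * exp_conv (second_moment coeff_error) t
        \<le> ennreal (34 * K\<^sup>2) * (ennreal (local_const * order_factor) * ?e t + 4 * exp_conv ?g t)"
      by (intro mult_left_mono nn_integral_exp_conv_le rate_ge t gm coeff_error_second_moment) auto
    also have "\<dots> = ennreal (34 * K\<^sup>2) * ennreal (local_const * order_factor) * ?e t + (ennreal (34 * K\<^sup>2) * 4) * exp_conv ?g t"
      by (simp only: ring_distribs mult.assoc)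
    also have "ennreal (34 * K\<^sup>2) * ennreal (local_const * order_factor) = ennreal ?A"
      using local_const_nonneg by (subst ennreal_mult[symmetric]) (auto simp: mult.assoc)
    also have "ennreal (34 * K\<^sup>2) * 4 = ennreal (136 * K\<^sup>2)"
    proof -
      have "ennreal (34 * K\<^sup>2) * 4 = ennreal (34 * K\<^sup>2 * 4)" by (subst ennreal_mult) auto
      then show ?thesis by simp
    qed
    finally show ?thesis .
  qed
  have g: "?g t \<le> 2 * ennreal ?A * ?e t" if t: "0 \<le> t" "t \<le> T" for t
  proof (rule gronwall_exp[where C="136 * K\<^sup>2"])
    show "0 < 136 * K\<^sup>2" using K_pos by simp
    fix t assume t: "0 \<le> t" "t \<le> T"
    obtain Z :: "'a \<Rightarrow> ennreal" where
      Z: "AE \<omega> in M. \<forall>s\<in>{0..t}. sqn (Y s \<omega> - euler_maruyama B b \<sigma> y0 \<delta> s \<omega>) \<le> Z \<omega>"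
      "(\<integral>\<^sup>+\<omega>. Z \<omega> \<partial>M) \<le> ennreal (34 * K\<^sup>2) * exp_conv (second_moment coeff_error) t"
      using sup_error_by_coefficient_error[OF t(1)] by blast
    have "grid t \<in> {0..t}"
    proof (cases "t = 0")
      case False
      then show ?thesis using step_index_bounds(1)[OF \<delta>(1), of t] t \<delta> by auto
    qed (simp add: step_index_def)
    then have "?g t \<le> (\<integral>\<^sup>+\<omega>. Z \<omega> \<partial>M)"
      unfolding second_moment_def grid_error_def using Z(1)
      by (intro nn_integral_mono_AE) (auto simp: euler_maruyama_grid[OF \<delta>(1)] elim!: eventually_mono dest!: bspec)
    also note Z(2)
    also note coeff[OF t(1)]
    finally show "?g t \<le> ennreal ?A * ?e t + ennreal (136 * K\<^sup>2) * exp_conv ?g t" .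
    show "?g t \<le> (\<Sum>k\<le>nat \<lceil>T / \<delta>\<rceil>. \<integral>\<^sup>+\<omega>. sqn (Y (real k * \<delta>) \<omega> - em k \<omega>) \<partial>M)"
      by (rule grid_error_finite(1)[OF t])
  next
    show "(\<Sum>k\<le>nat \<lceil>T / \<delta>\<rceil>. \<integral>\<^sup>+\<omega>. sqn (Y (real k * \<delta>) \<omega> - em k \<omega>) \<partial>M) < \<top>"
      by (rule grid_error_finite(2)[OF t])
  qed (use rate_ge t in auto)
  have conv_g: "exp_conv ?g T \<le> 2 * ennreal ?A * ?e T"
    using nn_integral_exp_conv_le[OF rate_ge(1) T, of "\<lambda>_. 0" ?g "2 * ennreal ?A" 0] g by auto
  obtain Z :: "'a \<Rightarrow> ennreal" where
    Z: "AE \<omega> in M. \<forall>s\<in>{0..T}. sqn (Y s \<omega> - euler_maruyama B b \<sigma> y0 \<delta> s \<omega>) \<le> Z \<omega>"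
    "(\<integral>\<^sup>+\<omega>. Z \<omega> \<partial>M) \<le> ennreal (34 * K\<^sup>2) * exp_conv (second_moment coeff_error) T"
    using sup_error_by_coefficient_error[OF T] by blast
  have "(\<integral>\<^sup>+\<omega>. (SUP s\<in>{0..T}. sqn (Y s \<omega> - euler_maruyama B b \<sigma> y0 \<delta> s \<omega>)) \<partial>M) \<le> (\<integral>\<^sup>+\<omega>. Z \<omega> \<partial>M)"
    using Z(1) by (intro nn_integral_mono_AE) (auto elim!: eventually_mono intro!: SUP_least)
  also note Z(2)
  also note coeff[OF T]
  also have "ennreal ?A * ?e T + ennreal (136 * K\<^sup>2) * exp_conv ?g T \<le> ennreal ?A * ?e T + ennreal (136 * K\<^sup>2) * (2 * ennreal ?A * ?e T)"
    by (intro add_left_mono mult_left_mono conv_g) auto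
  also have "\<dots> = ennreal (?A * exp (rate * T) + 136 * K\<^sup>2 * (2 * ?A * exp (rate * T)))"
  proof -
    have gen: "ennreal a * ennreal x + ennreal c * (2 * ennreal a * ennreal x) = ennreal (a * x + c * (2 * a * x))"
      if "0 \<le> a" "0 \<le> x" "0 \<le> c" for a x c
      using that by (simp add: ennreal_mult)
    show ?thesis using A by (intro gen) auto
  qed
  also have "?A * exp (rate * T) + 136 * K\<^sup>2 * (2 * ?A * exp (rate * T)) = error_const * exp (rate * T) * order_factor"
    by (simp add: error_const_def algebra_simps)
  finally show ?thesis .
qed

end
end

theorem proposition3:
  fixes M :: "'a measure"
    and F :: "real \<Rightarrow> 'a measure"
    and B :: "real \<Rightarrow> 'a \<Rightarrow> real ^ 'm"
    and y0 :: "real ^ 'd"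
    and b :: "real \<Rightarrow> real ^ 'd \<Rightarrow> real ^ 'd"
    and \<sigma> :: "real \<Rightarrow> real ^ 'd \<Rightarrow> real ^ 'm ^ 'd"
    and K \<gamma> :: real
    and X :: "real \<Rightarrow> 'a \<Rightarrow> real ^ 'd"
  assumes "prob_space M" and "complete_measure M"
    and "usual_filtration M F"
    and "brownian_motion M F B"
    and "(\<lambda>(t, x). b t x) \<in> borel_measurable (restrict_space borel {0..} \<Otimes>\<^sub>M borel)"
    and "(\<lambda>(t, x). \<sigma> t x) \<in> borel_measurable (restrict_space borel {0..} \<Otimes>\<^sub>M borel)"
    and "K > 0" and "\<gamma> > 0"
    and "\<And>t x y. t \<ge> 0 \<Longrightarrow>
           norm (b t x - b t y) + norm (\<sigma> t x - \<sigma> t y) \<le> K * norm (x - y)"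
    and "\<And>t x. t \<ge> 0 \<Longrightarrow> norm (b t x) + norm (\<sigma> t x) \<le> K * (1 + norm x)"
    and "\<And>s t x. s \<ge> 0 \<Longrightarrow> t \<ge> 0 \<Longrightarrow>
           norm (b s x - b t x) + norm (\<sigma> s x - \<sigma> t x) \<le> K * (1 + norm x) * \<bar>s - t\<bar> powr \<gamma>"
    and "strong_solution M F B b \<sigma> y0 X"
  shows "\<exists>C>0. \<forall>\<delta>\<in>{0<..<1}. \<forall>t\<ge>0.
           (\<integral>\<^sup>+\<omega>. (SUP s\<in>{0..t}. ennreal ((norm (X s \<omega> - euler_maruyama B b \<sigma> y0 \<delta> s \<omega>))\<^sup>2)) \<partial>M)
             \<le> ennreal (C * exp (C * t) * \<delta> powr (min (2 * \<gamma>) 1))"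
proof -
  interpret brownian_space M F B
    using assms(1,3,4) by (simp add: brownian_space_def brownian_space_axioms_def)
  have X: "adapted_process F X" "continuous_process M X"
    and int: "AE \<omega> in M. \<forall>t\<ge>0. set_integrable lborel {0..t} (\<lambda>r. b r (X r \<omega>))"
    using assms(12) unfolding strong_solution_def by blast+
  obtain I where ito: "ito_integral M F B (\<lambda>r \<omega>. \<sigma> r (X r \<omega>)) I"
    and eq: "AE \<omega> in M. \<forall>t\<ge>0. X t \<omega> = y0 + (LINT r:{0..t}|lborel. b r (X r \<omega>)) + I t \<omega>"
    using assms(12) unfolding strong_solution_def by blast
  obtain Y where Y: "\<And>t. Y t \<in> borel_measurable M" "\<And>\<omega>. continuous_on UNIV (\<lambda>t. Y t \<omega>)"
    and YX: "AE \<omega> in M. \<forall>t\<ge>0. Y t \<omega> = X t \<omega>"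
    using continuous_modification[OF X] by blast
  \<comment> \<open>a continuous modification changes neither the hypotheses nor the error, up to null sets\<close>
  interpret ito_equation M F B b \<sigma> y0 K \<gamma> Y I "\<lambda>r \<omega>. \<sigma> r (X r \<omega>)"
  proof
    show "AE \<omega> in M. \<forall>r\<ge>0. \<sigma> r (X r \<omega>) = \<sigma> r (Y r \<omega>)"
      using YX by eventually_elim simp
    show "AE \<omega> in M. \<forall>t\<ge>0. set_integrable lborel {0..t} (\<lambda>r. b r (Y r \<omega>))"
      using YX int
    proof eventually_elim
      case (elim \<omega>)
      show ?case
      proof (intro allI impI)
        fix t :: real assume "0 \<le> t"
        then have "set_integrable lborel {0..t} (\<lambda>r. b r (X r \<omega>))" using elim(2) by simp
        moreover have "set_integrable lborel {0..t} (\<lambda>r. b r (X r \<omega>)) = set_integrable lborel {0..t} (\<lambda>r. b r (Y r \<omega>))"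
          using elim(1) by (intro set_integrable_cong) auto
        ultimately show "set_integrable lborel {0..t} (\<lambda>r. b r (Y r \<omega>))" by simp
      qed
    qed
    show "AE \<omega> in M. \<forall>t\<ge>0. Y t \<omega> = y0 + (LINT r:{0..t}|lborel. b r (Y r \<omega>)) + I t \<omega>"
      using YX eq
    proof eventually_elim
      case (elim \<omega>)
      show ?case
      proof (intro allI impI)
        fix t :: real assume t: "0 \<le> t"
        have "(LINT r:{0..t}|lborel. b r (Y r \<omega>)) = (LINT r:{0..t}|lborel. b r (X r \<omega>))"
          using elim(1) by (intro set_lebesgue_integral_cong) auto
        then show "Y t \<omega> = y0 + (LINT r:{0..t}|lborel. b r (Y r \<omega>)) + I t \<omega>"
          using elim t by simp
      qed
    qed
  qed (use assms(7-11) Y ito in auto)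
  define C where "C = error_const + rate"
  have C: "0 \<le> error_const" "error_const \<le> C" "rate \<le> C" "0 < C"
  proof -
    show "0 \<le> error_const" using local_const_nonneg by (simp add: error_const_def)
    then show "error_const \<le> C" "rate \<le> C" "0 < C" using rate_ge(1) by (auto simp: C_def)
  qed
  show ?thesis
  proof (intro exI[of _ C] conjI ballI allI impI)
    fix \<delta> t :: real assume \<delta>: "\<delta> \<in> {0<..<1}" and t: "0 \<le> t"
    have "(\<integral>\<^sup>+\<omega>. (SUP s\<in>{0..t}. ennreal ((norm (X s \<omega> - euler_maruyama B b \<sigma> y0 \<delta> s \<omega>))\<^sup>2)) \<partial>M)
        = (\<integral>\<^sup>+\<omega>. (SUP s\<in>{0..t}. ennreal ((norm (Y s \<omega> - euler_maruyama B b \<sigma> y0 \<delta> s \<omega>))\<^sup>2)) \<partial>M)"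
    proof (rule nn_integral_cong_AE)
      show "AE \<omega> in M. (SUP s\<in>{0..t}. ennreal ((norm (X s \<omega> - euler_maruyama B b \<sigma> y0 \<delta> s \<omega>))\<^sup>2))
          = (SUP s\<in>{0..t}. ennreal ((norm (Y s \<omega> - euler_maruyama B b \<sigma> y0 \<delta> s \<omega>))\<^sup>2))"
        using YX by eventually_elim (intro SUP_cong, auto)
    qed
    also have "\<dots> \<le> ennreal (error_const * exp (rate * t) * \<delta> powr (min (2 * \<gamma>) 1))"
      using \<delta> t by (intro strong_error) auto
    also have "\<dots> \<le> ennreal (C * exp (C * t) * \<delta> powr (min (2 * \<gamma>) 1))"
      using C t by (intro ennreal_leI mult_right_mono mult_mono) (auto intro: mult_right_mono)
    finally show "(\<integral>\<^sup>+\<omega>. (SUP s\<in>{0..t}. ennreal ((norm (X s \<omega> - euler_maruyama B b \<sigma> y0 \<delta> s \<omega>))\<^sup>2)) \<partial>M)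
        \<le> ennreal (C * exp (C * t) * \<delta> powr (min (2 * \<gamma>) 1))" .
  qed (rule C)
qed

end
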